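(* For $t\in\mathbb{R}$, $A\in\mathcal{A}_X$ and $a,b\in T_A\mathcal{A}_X$ put $$\Omega^{t}_A(a,b)=\Omega_A(a,b)-(t-1)\,\gamma'_A(a,b),$$ where $$\Omega_A(a,b)=\frac{1}{8\pi^3}\int_X\mathrm{tr}\,[(a\wedge b-b\wedge a)\wedge F_A]-\frac{1}{24\pi^3}\int_M\mathrm{tr}\,[(a\wedge b-b\wedge a)\wedge A],$$ $$\gamma'_A(a,b)=\frac{1}{24\pi^3}\int_X\mathrm{tr}\,[(a\wedge b-b\wedge a)\wedge A\wedge A].$$ Then $\{\Omega^t\}_{t\in\mathbb{R}}$ is a family of pre-symplectic structures on $\mathcal{A}_X$; that is, for every $t\in\mathbb{R}$, $\Omega^t$ is a closed 2-form on $\mathcal{A}_X$ ($\tilde{\mathrm d}\,\Omega^t=0$).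
   Context: $X$ is a compact, connected, oriented Riemannian four-manifold with boundary three-manifold $M=\partial X$; $G=SU(n)$, $n\ge 2$, $\mathfrak g=\mathfrak{su}(n)$. $\mathcal{A}_X$ is the space of irreducible connections on the trivial bundle $X\times G$, regarded as $\mathfrak g$-valued 1-forms on $X$; its tangent space is $T_A\mathcal{A}_X=\Omega^1(X,\mathfrak g)$ (forms of a fixed, sufficiently high Sobolev class). Products of matrix-valued forms are wedge products combined with matrix multiplication. The curvature is $F_A=\mathrm dA+A\wedge A$. In boundary integrals forms are restricted to $M$. Forms on $\mathcal A_X$ obtained from the trace may take complex values. Differential calculus: the directional derivative of a function $H$ on $\mathcal{A}_X$ is $(\partial_aH)(A)=\lim_{\epsilon\to0}\frac1\epsilon\{H(A+\epsilon a)-H(A)\}$. For a 2-form $\varphi$ on $\mathcal{A}_X$ its exterior derivative is $(\tilde{\mathrm d}\varphi)_A(a,b,c)=(\partial_a\varphi)_A(b,c)+(\partial_b\varphi)_A(c,a)+(\partial_c\varphi)_A(a,b)$, where $\partial_a\varphi$ is obtained by differentiating the coefficients of $\varphi$ (i.e. differentiating in $A$ with the arguments fixed). A pre-symplectic structure is a closed 2-form. *)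

theory Defs
  imports "HOL-Analysis.Analysis" "HOL-Combinatorics.Permutations"
begin

section \<open>Functions of class $C^k$ and Sobolev functions on subsets of Euclidean space\<close>

text \<open>
  \<open>Ck k V f\<close> is used for relatively open subsets \<open>V\<close> of a Euclidean space or of a closed half-space.
  On such sets the derivative within \<open>V\<close> is unique, and the definition says that the partial
  derivatives up to order \<open>k\<close> exist and are continuous up to the boundary.
\<close>

primrec Ck :: "nat \<Rightarrow> 'a::euclidean_space set \<Rightarrow> ('a \<Rightarrow> 'b::real_normed_vector) \<Rightarrow> bool" where
  "Ck 0 V f \<longleftrightarrow> continuous_on V f"
| "Ck (Suc k) V f \<longleftrightarrow>
     (\<exists>D. (\<forall>x\<in>V. (f has_derivative D x) (at x within V)) \<and> (\<forall>v. Ck k V (\<lambda>x. D x v)))"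

definition smooth :: "'a::euclidean_space set \<Rightarrow> ('a \<Rightarrow> 'b::real_normed_vector) \<Rightarrow> bool" where
  "smooth V f \<longleftrightarrow> (\<forall>k. Ck k V f)"

definition test_function :: "'a::euclidean_space set \<Rightarrow> ('a \<Rightarrow> real) \<Rightarrow> bool" where
  "test_function W \<psi> \<longleftrightarrow>
     smooth UNIV \<psi> \<and> compact (closure {x. \<psi> x \<noteq> 0}) \<and> closure {x. \<psi> x \<noteq> 0} \<subseteq> W"

definition L2_loc :: "'a::euclidean_space set \<Rightarrow> ('a \<Rightarrow> 'b::euclidean_space) \<Rightarrow> bool" where
  "L2_loc V f \<longleftrightarrow> set_borel_measurable lebesgue V f \<and>
     (\<forall>K. compact K \<and> K \<subseteq> V \<longrightarrow> set_integrable lebesgue K (\<lambda>x. (norm (f x))\<^sup>2))"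

definition weak_deriv ::
  "'a::euclidean_space set \<Rightarrow> 'a \<Rightarrow> ('a \<Rightarrow> 'b::euclidean_space) \<Rightarrow> ('a \<Rightarrow> 'b) \<Rightarrow> bool" where
  "weak_deriv W e f h \<longleftrightarrow> (\<forall>\<psi>. test_function W \<psi> \<longrightarrow>
     integral W (\<lambda>x. frechet_derivative \<psi> (at x) e *\<^sub>R f x) = - integral W (\<lambda>x. \<psi> x *\<^sub>R h x))"

text \<open>
  Weak derivatives are tested in the interior of \<open>V\<close>, but are required to be square integrable on
  compact subsets of \<open>V\<close> itself, which may contain boundary points.  On a compact manifold, being
  of this local class in every chart is the same as being globally of class $L^2_s$.
\<close>

primrec H_loc :: "nat \<Rightarrow> 'a::euclidean_space set \<Rightarrow> ('a \<Rightarrow> 'b::euclidean_space) \<Rightarrow> bool" where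
  "H_loc 0 V f \<longleftrightarrow> L2_loc V f"
| "H_loc (Suc s) V f \<longleftrightarrow> L2_loc V f \<and>
     (\<forall>e\<in>Basis. \<exists>h. weak_deriv (interior V) e f h \<and> H_loc s V h)"

text \<open>
  We use the Sobolev class $L^2_s$ in dimension 4 with \<open>s \<ge> 4\<close>.  Since $s > 4/2 + 1$, a class has
  a unique representative that is $C^1$ up to the boundary; a Sobolev function is taken to be this
  representative, so that its first derivatives and its restriction to the boundary are pointwise
  defined.
\<close>

definition sobolev :: "nat \<Rightarrow> 'a::euclidean_space set \<Rightarrow> ('a \<Rightarrow> 'b::euclidean_space) \<Rightarrow> bool" where
  "sobolev s V f \<longleftrightarrow> Ck 1 V f \<and> H_loc s V f"


section \<open>Oriented manifolds with boundary\<close>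

text \<open>
  A manifold is given by its set of points together with an atlas, indexed by \<open>idx\<close>.  The chart
  with index \<open>i\<close> is the restriction of \<open>chart i\<close> to \<open>cdom i\<close>.
\<close>

record ('x, 'i, 'd) mfd =
  pts :: "'x set"
  idx :: "'i set"
  cdom :: "'i \<Rightarrow> 'x set"
  chart :: "'i \<Rightarrow> 'x \<Rightarrow> real^'d"

definition cimg :: "('x, 'i, 'd::finite) mfd \<Rightarrow> 'i \<Rightarrow> (real^'d) set" where
  "cimg X i = chart X i ` cdom X i"

definition cinv :: "('x, 'i, 'd::finite) mfd \<Rightarrow> 'i \<Rightarrow> real^'d \<Rightarrow> 'x" where
  "cinv X i = inv_into (cdom X i) (chart X i)"

definition overlap :: "('x, 'i, 'd::finite) mfd \<Rightarrow> 'i \<Rightarrow> 'i \<Rightarrow> (real^'d) set" where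
  "overlap X i j = chart X i ` (cdom X i \<inter> cdom X j)"

definition transition :: "('x, 'i, 'd::finite) mfd \<Rightarrow> 'i \<Rightarrow> 'i \<Rightarrow> real^'d \<Rightarrow> real^'d" where
  "transition X i j = chart X j \<circ> cinv X i"

definition dtransition ::
  "('x, 'i, 'd::finite) mfd \<Rightarrow> 'i \<Rightarrow> 'i \<Rightarrow> real^'d \<Rightarrow> real^'d \<Rightarrow> real^'d" where
  "dtransition X i j x = frechet_derivative (transition X i j) (at x within overlap X i j)"

text \<open>\<open>H\<close> is the local model: the whole space, or a closed half-space if there is a boundary.\<close>

definition oriented_manifold ::
  "(real^'d::finite) set \<Rightarrow> ('x::t2_space, 'i, 'd) mfd \<Rightarrow> bool" where
  "oriented_manifold H X \<longleftrightarrow>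
     pts X = (\<Union>i\<in>idx X. cdom X i) \<and>
     (\<forall>i\<in>idx X. openin (top_of_set (pts X)) (cdom X i) \<and>
        openin (top_of_set H) (cimg X i) \<and>
        homeomorphism (cdom X i) (cimg X i) (chart X i) (cinv X i)) \<and>
     (\<forall>i\<in>idx X. \<forall>j\<in>idx X.
        smooth (overlap X i j) (transition X i j) \<and>
        (\<forall>x\<in>overlap X i j. det (matrix (dtransition X i j x)) > 0))"

text \<open>
  With this half-space the outward normal at the boundary is the first basis vector, so that the
  remaining coordinates are positively oriented for the boundary orientation (outward normal first).
\<close>

definition half_space :: "(real^4) set" where
  "half_space = {x. x $ 1 \<le> 0}"

definition bdry_incl :: "real^3 \<Rightarrow> real^4" where
  "bdry_incl y = vector [0, y $ 1, y $ 2, y $ 3]"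

definition bdry_proj :: "real^4 \<Rightarrow> real^3" where
  "bdry_proj x = vector [x $ 2, x $ 3, x $ 4]"

definition bdry_pts :: "('x, 'i, 4) mfd \<Rightarrow> 'x set" where
  "bdry_pts X = {p. \<exists>i\<in>idx X. p \<in> cdom X i \<and> chart X i p $ 1 = 0}"

definition bdry :: "('x, 'i, 4) mfd \<Rightarrow> ('x, 'i, 3) mfd" where
  "bdry X = \<lparr>pts = bdry_pts X, idx = idx X, cdom = (\<lambda>i. cdom X i \<inter> bdry_pts X),
     chart = (\<lambda>i p. bdry_proj (chart X i p))\<rparr>"

definition riemannian_metric ::
  "('x, 'i, 'd::finite) mfd \<Rightarrow> ('i \<Rightarrow> real^'d \<Rightarrow> real^'d \<Rightarrow> real^'d \<Rightarrow> real) \<Rightarrow> bool" where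
  "riemannian_metric X g \<longleftrightarrow>
     (\<forall>i\<in>idx X.
        (\<forall>u v. smooth (cimg X i) (\<lambda>x. g i x u v)) \<and>
        (\<forall>x\<in>cimg X i. bilinear (g i x) \<and> (\<forall>u v. g i x u v = g i x v u) \<and>
           (\<forall>v. v \<noteq> 0 \<longrightarrow> g i x v v > 0))) \<and>
     (\<forall>i\<in>idx X. \<forall>j\<in>idx X. \<forall>x\<in>overlap X i j. \<forall>u v.
        g i x u v = g j (transition X i j x) (dtransition X i j x u) (dtransition X i j x v))"


section \<open>Integration of top-degree forms\<close>

definition partition_of_unity ::
  "('x::t2_space, 'i, 'd::finite) mfd \<Rightarrow> 'i set \<Rightarrow> ('i \<Rightarrow> 'x \<Rightarrow> real) \<Rightarrow> bool" where
  "partition_of_unity X J \<rho> \<longleftrightarrow>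
     finite J \<and> J \<subseteq> idx X \<and>
     (\<forall>j\<in>J. (\<forall>p\<in>pts X. \<rho> j p \<ge> 0) \<and>
        (\<forall>i\<in>idx X. smooth (cimg X i) (\<rho> j \<circ> cinv X i)) \<and>
        pts X \<inter> closure {p\<in>pts X. \<rho> j p \<noteq> 0} \<subseteq> cdom X j) \<and>
     (\<forall>p\<in>pts X. (\<Sum>j\<in>J. \<rho> j p) = 1)"

text \<open>
  A top-degree form is given here by its coefficients \<open>\<omega> i\<close> with respect to the coordinates of the
  charts.  The value does not depend on the chosen partition of unity.
\<close>

definition mfd_integral ::
  "('x::t2_space, 'i, 'd::finite) mfd \<Rightarrow> ('i \<Rightarrow> real^'d \<Rightarrow> complex) \<Rightarrow> complex" where
  "mfd_integral X \<omega> =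
     (let (J, \<rho>) = (SOME (J, \<rho>). partition_of_unity X J \<rho>)
      in \<Sum>j\<in>J. integral (cimg X j) (\<lambda>x. \<rho> j (cinv X j x) *\<^sub>R \<omega> j x))"


section \<open>Matrix-valued differential forms\<close>

type_synonym 'n cmat = "complex^'n^'n"

text \<open>
  \<open>\<omega> i x v\<close> is the value at the point \<open>x\<close> of the image of chart \<open>i\<close> of the local representative of
  \<open>\<omega>\<close> on the tangent vectors \<open>v 0, v 1, \<dots>\<close>.  Values outside the chart images are irrelevant.
\<close>

type_synonym ('i, 'd, 'n) form = "'i \<Rightarrow> real^'d \<Rightarrow> (nat \<Rightarrow> real^'d) \<Rightarrow> 'n cmat"

definition alternating :: "nat \<Rightarrow> ((nat \<Rightarrow> real^'d::finite) \<Rightarrow> 'n::finite cmat) \<Rightarrow> bool" where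
  "alternating p \<eta> \<longleftrightarrow>
     (\<forall>v w. (\<forall>k<p. v k = w k) \<longrightarrow> \<eta> v = \<eta> w) \<and>
     (\<forall>v. \<forall>k<p. linear (\<lambda>y. \<eta> (v(k := y)))) \<and>
     (\<forall>v. \<forall>k<p. \<forall>l<k. v k = v l \<longrightarrow> \<eta> v = 0)"

definition diff_form ::
  "('x, 'i, 'd::finite) mfd \<Rightarrow> nat \<Rightarrow> ('i, 'd, 'n::finite) form \<Rightarrow> bool" where
  "diff_form X p \<omega> \<longleftrightarrow>
     (\<forall>i\<in>idx X. \<forall>x\<in>cimg X i. alternating p (\<omega> i x)) \<and>
     (\<forall>i\<in>idx X. \<forall>j\<in>idx X. \<forall>x\<in>overlap X i j. \<forall>v.
        \<omega> i x v = \<omega> j (transition X i j x) (\<lambda>k. dtransition X i j x (v k)))"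

text \<open>Wedge product of a \<open>p\<close>-form and a \<open>q\<close>-form, combined with matrix multiplication.\<close>

definition wedge ::
  "nat \<Rightarrow> nat \<Rightarrow> ('i, 'd::finite, 'n::finite) form \<Rightarrow> ('i, 'd, 'n) form \<Rightarrow> ('i, 'd, 'n) form" where
  "wedge p q \<alpha> \<beta> = (\<lambda>i x v. (1 / (fact p * fact q)) *\<^sub>R
     (\<Sum>\<sigma> | \<sigma> permutes {..<p+q}. of_int (sign \<sigma>) *\<^sub>R
        (\<alpha> i x (\<lambda>k. v (\<sigma> k)) ** \<beta> i x (\<lambda>k. v (\<sigma> (p + k))))))"

text \<open>Exterior derivative of a \<open>p\<close>-form; in the \<open>k\<close>-th summand the argument \<open>v k\<close> is omitted.\<close>

definition ext_deriv ::
  "('x, 'i, 'd::finite) mfd \<Rightarrow> nat \<Rightarrow> ('i, 'd, 'n::finite) form \<Rightarrow> ('i, 'd, 'n) form" where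
  "ext_deriv X p \<alpha> = (\<lambda>i x v. \<Sum>k\<le>p. (-1) ^ k *\<^sub>R
     frechet_derivative (\<lambda>y. \<alpha> i y (\<lambda>l. if l < k then v l else v (Suc l)))
       (at x within cimg X i) (v k))"

definition form_add ::
  "('i, 'd::finite, 'n::finite) form \<Rightarrow> ('i, 'd, 'n) form \<Rightarrow> ('i, 'd, 'n) form" where
  "form_add \<alpha> \<beta> = (\<lambda>i x v. \<alpha> i x v + \<beta> i x v)"

definition form_diff ::
  "('i, 'd::finite, 'n::finite) form \<Rightarrow> ('i, 'd, 'n) form \<Rightarrow> ('i, 'd, 'n) form" where
  "form_diff \<alpha> \<beta> = (\<lambda>i x v. \<alpha> i x v - \<beta> i x v)"

definition form_scale ::
  "real \<Rightarrow> ('i, 'd::finite, 'n::finite) form \<Rightarrow> ('i, 'd, 'n) form" where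
  "form_scale r \<alpha> = (\<lambda>i x v. r *\<^sub>R \<alpha> i x v)"

definition frame4 :: "nat \<Rightarrow> real^4" where
  "frame4 k = [axis 1 1, axis 2 1, axis 3 1, axis 4 1] ! k"

definition frame3 :: "nat \<Rightarrow> real^3" where
  "frame3 k = [axis 1 1, axis 2 1, axis 3 1] ! k"

text \<open>The integrals of \<open>tr \<omega>\<close> over \<open>X\<close> for a 4-form, and over the boundary for a 3-form on \<open>X\<close>.\<close>

definition int_tr ::
  "('x::t2_space, 'i, 4) mfd \<Rightarrow> ('i, 4, 'n::finite) form \<Rightarrow> complex" where
  "int_tr X \<omega> = mfd_integral X (\<lambda>i x. trace (\<omega> i x frame4))"

definition int_tr_bdry ::
  "('x::t2_space, 'i, 4) mfd \<Rightarrow> ('i, 4, 'n::finite) form \<Rightarrow> complex" where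
  "int_tr_bdry X \<omega> = mfd_integral (bdry X)
     (\<lambda>i y. trace (\<omega> i (bdry_incl y) (\<lambda>k. bdry_incl (frame3 k))))"


section \<open>Connections\<close>

definition conj_transpose :: "'n::finite cmat \<Rightarrow> 'n cmat" where
  "conj_transpose B = (\<chi> i j. cnj (B $ j $ i))"

definition SU :: "'n::finite cmat set" where
  "SU = {B. conj_transpose B ** B = mat 1 \<and> det B = 1}"

definition su :: "'n::finite cmat set" where
  "su = {B. conj_transpose B = - B \<and> trace B = 0}"

text \<open>The space of \<open>su\<close>-valued 1-forms, of Sobolev class \<open>s\<close>.\<close>

definition one_forms ::
  "('x, 'i, 'd::finite) mfd \<Rightarrow> nat \<Rightarrow> ('i, 'd, 'n::finite) form set" where
  "one_forms X s = {a. diff_form X 1 a \<and>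
     (\<forall>i\<in>idx X. (\<forall>x\<in>cimg X i. \<forall>v. a i x v \<in> su) \<and>
        (\<forall>v. sobolev s (cimg X i) (\<lambda>x. a i x v)))}"

text \<open>Gauge transformations have one more derivative than connections.\<close>

definition gauge_group ::
  "('x, 'i, 'd::finite) mfd \<Rightarrow> nat \<Rightarrow> ('x \<Rightarrow> 'n::finite cmat) set" where
  "gauge_group X s = {u. (\<forall>p\<in>pts X. u p \<in> SU) \<and>
     (\<forall>i\<in>idx X. sobolev (Suc s) (cimg X i) (u \<circ> cinv X i))}"

definition gauge_act ::
  "('x, 'i, 'd::finite) mfd \<Rightarrow> ('x \<Rightarrow> 'n::finite cmat) \<Rightarrow> ('i, 'd, 'n) form \<Rightarrow> ('i, 'd, 'n) form" where
  "gauge_act X u A = (\<lambda>i x v.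
     matrix_inv (u (cinv X i x)) ** A i x v ** u (cinv X i x) +
     matrix_inv (u (cinv X i x)) **
       frechet_derivative (u \<circ> cinv X i) (at x within cimg X i) (v 0))"

text \<open>
  A connection is irreducible if its stabiliser in the gauge group is the centre of \<open>SU\<close>.
  For a connected base and structure group $SU(n)$ this is the same as irreducibility of the
  holonomy representation on $\mathbb{C}^n$, and as injectivity of the covariant derivative
  $d_A$ on \<open>su\<close>-valued functions.
\<close>

definition irreducible_connection ::
  "('x, 'i, 'd::finite) mfd \<Rightarrow> nat \<Rightarrow> ('i, 'd, 'n::finite) form \<Rightarrow> bool" where
  "irreducible_connection X s A \<longleftrightarrow>
     (\<forall>u\<in>gauge_group X s.
        (\<forall>i\<in>idx X. \<forall>x\<in>cimg X i. \<forall>v. gauge_act X u A i x v = A i x v) \<longrightarrow>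
        (\<exists>z\<in>SU. (\<forall>h\<in>SU. z ** h = h ** z) \<and> (\<forall>p\<in>pts X. u p = z)))"

definition connections ::
  "('x, 'i, 'd::finite) mfd \<Rightarrow> nat \<Rightarrow> ('i, 'd, 'n::finite) form set" where
  "connections X s = {A \<in> one_forms X s. irreducible_connection X s A}"

definition curvature ::
  "('x, 'i, 'd::finite) mfd \<Rightarrow> ('i, 'd, 'n::finite) form \<Rightarrow> ('i, 'd, 'n) form" where
  "curvature X A = form_add (ext_deriv X 1 A) (wedge 1 1 A A)"


section \<open>Differential calculus on the space of connections\<close>

definition diff_quot ::
  "('i, 'd::finite, 'n::finite) form \<Rightarrow> (('i, 'd, 'n) form \<Rightarrow> complex) \<Rightarrow> ('i, 'd, 'n) form \<Rightarrow>
   real \<Rightarrow> complex" where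
  "diff_quot a H A \<epsilon> = (1 / \<epsilon>) *\<^sub>R (H (form_add A (form_scale \<epsilon> a)) - H A)"

definition dir_deriv ::
  "('i, 'd::finite, 'n::finite) form \<Rightarrow> (('i, 'd, 'n) form \<Rightarrow> complex) \<Rightarrow> ('i, 'd, 'n) form \<Rightarrow>
   complex" where
  "dir_deriv a H A = Lim (at 0) (diff_quot a H A)"

type_synonym ('i, 'd, 'n) form2 =
  "('i, 'd, 'n) form \<Rightarrow> ('i, 'd, 'n) form \<Rightarrow> ('i, 'd, 'n) form \<Rightarrow> complex"

text \<open>
  A 2-form on \<open>\<A>\<close> with tangent spaces \<open>T\<close>: alternating real bilinear forms whose coefficients have
  directional derivatives.
\<close>

definition two_form ::
  "('i, 'd::finite, 'n::finite) form set \<Rightarrow> ('i, 'd, 'n) form set \<Rightarrow> ('i, 'd, 'n) form2 \<Rightarrow> bool" where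
  "two_form \<A> T \<phi> \<longleftrightarrow> (\<forall>A\<in>\<A>.
     (\<forall>a\<in>T. \<forall>b\<in>T. \<forall>c\<in>T. \<forall>r.
        \<phi> A (form_add (form_scale r a) b) c = r *\<^sub>R \<phi> A a c + \<phi> A b c \<and>
        \<phi> A c (form_add (form_scale r a) b) = r *\<^sub>R \<phi> A c a + \<phi> A c b) \<and>
     (\<forall>a\<in>T. \<phi> A a a = 0) \<and>
     (\<forall>a\<in>T. \<forall>b\<in>T. \<forall>c\<in>T. \<exists>l. (diff_quot c (\<lambda>B. \<phi> B a b) A \<longlongrightarrow> l) (at 0)))"

definition ext_deriv2 ::
  "('i, 'd::finite, 'n::finite) form2 \<Rightarrow> ('i, 'd, 'n) form \<Rightarrow> ('i, 'd, 'n) form \<Rightarrow>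
   ('i, 'd, 'n) form \<Rightarrow> ('i, 'd, 'n) form \<Rightarrow> complex" where
  "ext_deriv2 \<phi> A a b c =
     dir_deriv a (\<lambda>B. \<phi> B b c) A + dir_deriv b (\<lambda>B. \<phi> B c a) A + dir_deriv c (\<lambda>B. \<phi> B a b) A"

definition presymplectic ::
  "('i, 'd::finite, 'n::finite) form set \<Rightarrow> ('i, 'd, 'n) form set \<Rightarrow> ('i, 'd, 'n) form2 \<Rightarrow> bool" where
  "presymplectic \<A> T \<phi> \<longleftrightarrow> two_form \<A> T \<phi> \<and>
     (\<forall>A\<in>\<A>. \<forall>a\<in>T. \<forall>b\<in>T. \<forall>c\<in>T. ext_deriv2 \<phi> A a b c = 0)"

definition wedge_comm ::
  "('i, 'd::finite, 'n::finite) form \<Rightarrow> ('i, 'd, 'n) form \<Rightarrow> ('i, 'd, 'n) form" where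
  "wedge_comm a b = form_diff (wedge 1 1 a b) (wedge 1 1 b a)"

definition Omega :: "('x::t2_space, 'i, 4) mfd \<Rightarrow> ('i, 4, 'n::finite) form2" where
  "Omega X A a b =
     of_real (1 / (8 * pi ^ 3)) * int_tr X (wedge 2 2 (wedge_comm a b) (curvature X A)) -
     of_real (1 / (24 * pi ^ 3)) * int_tr_bdry X (wedge 2 1 (wedge_comm a b) A)"

definition gamma' :: "('x::t2_space, 'i, 4) mfd \<Rightarrow> ('i, 4, 'n::finite) form2" where
  "gamma' X A a b =
     of_real (1 / (24 * pi ^ 3)) * int_tr X (wedge 2 2 (wedge_comm a b) (wedge 1 1 A A))"

definition Omega_t :: "('x::t2_space, 'i, 4) mfd \<Rightarrow> real \<Rightarrow> ('i, 4, 'n::finite) form2" where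
  "Omega_t X t A a b = Omega X A a b - of_real (t - 1) * gamma' X A a b"

end

theory Submission
  imports Defs
begin

text \<open>
  In the directional derivative of \<open>\<Omega>\<^sup>t\<close> the terms $\mathrm{tr}[(a\wedge b-b\wedge a)\wedge(A\wedge c+c\wedge A)]$
  cancel in the cyclic sum over $a,b,c$, because the trace of a product of four 1-forms changes sign
  under a cyclic shift; the same cancellation makes $\gamma'$ closed.  The terms with $\mathrm{d}c$ sum
  to $\mathrm{d}\,\mathrm{tr}[(a\wedge b-b\wedge a)\wedge c]$, while the boundary terms are three equal copies of
  $\mathrm{tr}[(a\wedge b-b\wedge a)\wedge c]$, so that Stokes' theorem and $3/(24\pi^3)=1/(8\pi^3)$ finish the proof.

  For Stokes' theorem write $\sum_j\rho_j\,\mathrm{d}\omega=\sum_j\mathrm{d}(\rho_j\omega)-\sum_j\mathrm{d}\rho_j\wedge\omega$.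
  The first sum is computed in the charts by Fubini's theorem.  Each form in the second sum is
  supported in one chart, so its integral may be computed with the whole partition of unity, and then
  the sum vanishes because $\sum_j\mathrm{d}\rho_j=0$.  No second derivatives of transition maps are needed.
\<close>

section \<open>Functions of class $C^k$\<close>

text \<open>What a Sobolev one-form contributes pointwise is its C^1 representative, so tr(a b c) is
  a three-form of class C^1 and its derivatives have to make sense at boundary points. Hence the
  calculus of derivatives within sets on which they are unique, instead of on open sets.

  \<open>mfd_integral\<close> takes its partition of unity from \<open>SOME\<close>, separately on X
  and on the boundary. Existence of partitions therefore comes before any computation, and
  independence of the choice is what allows the partition chosen on X, restricted to the boundary,
  to compute the boundary integral.

  The sign of the cyclic shift arises from moving a 1-form past a 3-form. In a product of three
  1-forms it passes a 2-form instead, which costs no sign; this is why the three boundary copies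
  agree.

  Along a line A + \<epsilon> c every coefficient of \<Omega>^t is a polynomial in \<epsilon> of
  degree at most two. Directional derivatives are thus read off algebraically, without exchanging a
  limit with an integral.\<close>

lemma Ck_cong:
  assumes "\<And>x. x \<in> V \<Longrightarrow> f x = g x"
  shows "Ck k V f \<longleftrightarrow> Ck k V g"
proof (cases k)
  case 0
  then show ?thesis using assms continuous_on_cong by auto
next
  case (Suc m)
  have "(f has_derivative D) (at x within V) \<longleftrightarrow> (g has_derivative D) (at x within V)"
    if "x \<in> V" for x D
    using assms that by (metis has_derivative_transform)
  with Suc show ?thesis by simp
qed

lemma Ck_Suc_imp: "Ck (Suc k) V f \<Longrightarrow> Ck k V f"
proof (induction k arbitrary: f)
  case 0
  then show ?case
    by (auto simp: continuous_on_eq_continuous_within intro: has_derivative_continuous)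
next
  case (Suc k)
  from Suc.prems obtain D where
    "\<forall>x\<in>V. (f has_derivative D x) (at x within V)" "\<forall>v. Ck (Suc k) V (\<lambda>x. D x v)"
    unfolding Ck.simps(2)[of "Suc k"] by blast
  with Suc.IH show ?case by auto
qed

lemma Ck_le: "Ck m V f \<Longrightarrow> k \<le> m \<Longrightarrow> Ck k V f"
  by (induction m) (auto simp: le_Suc_eq simp del: Ck.simps intro: Ck_Suc_imp)

lemma Ck_imp_continuous_on: "Ck k V f \<Longrightarrow> continuous_on V f"
  using Ck_le[of k V f 0] by simp

lemma Ck_const: "Ck k V (\<lambda>x. c)"
  by (induction k arbitrary: c) (auto intro!: exI[of _ "\<lambda>x v. 0"])

lemma Ck_linear:
  assumes "bounded_linear f" shows "Ck k V f"
proof (cases k)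
  case 0
  then show ?thesis using assms linear_continuous_on by auto
next
  case (Suc m)
  then show ?thesis
    using assms by (auto intro!: exI[of _ "\<lambda>x. f"] Ck_const bounded_linear_imp_has_derivative)
qed

lemma Ck_add: "Ck k V f \<Longrightarrow> Ck k V g \<Longrightarrow> Ck k V (\<lambda>x. f x + g x)"
proof (induction k arbitrary: f g)
  case 0
  then show ?case by (auto intro: continuous_intros)
next
  case (Suc k)
  then obtain D E where
    "\<forall>x\<in>V. (f has_derivative D x) (at x within V)" "\<forall>v. Ck k V (\<lambda>x. D x v)"
    "\<forall>x\<in>V. (g has_derivative E x) (at x within V)" "\<forall>v. Ck k V (\<lambda>x. E x v)" by auto
  with Suc show ?case
    by (auto intro!: exI[of _ "\<lambda>x v. D x v + E x v"] derivative_eq_intros)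
qed

lemma Ck_sum: "finite I \<Longrightarrow> (\<And>i. i \<in> I \<Longrightarrow> Ck k V (f i)) \<Longrightarrow> Ck k V (\<lambda>x. \<Sum>i\<in>I. f i x)"
  by (induction I rule: finite_induct) (auto intro: Ck_add Ck_const simp del: Ck.simps)

text \<open>One Leibniz rule for products, scalar multiples, inner products and matrix
  multiplication. Both summands of the derivative are values of the same bilinear map with one order
  less, so the induction closes.\<close>

lemma Ck_bilinear:
  assumes B: "bounded_bilinear B"
  shows "Ck k V f \<Longrightarrow> Ck k V g \<Longrightarrow> Ck k V (\<lambda>x. B (f x) (g x))"
proof (induction k arbitrary: f g)
  case 0
  then show ?case using bounded_bilinear.continuous_on[OF B] by auto
next
  case (Suc k)
  then obtain D E where D:
    "\<forall>x\<in>V. (f has_derivative D x) (at x within V)" "\<forall>v. Ck k V (\<lambda>x. D x v)" and E: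
    "\<forall>x\<in>V. (g has_derivative E x) (at x within V)" "\<forall>v. Ck k V (\<lambda>x. E x v)" by auto
  have f: "Ck k V f" and g: "Ck k V g" using Suc.prems Ck_Suc_imp by blast+
  have "((\<lambda>x. B (f x) (g x)) has_derivative (\<lambda>h. B (f x) (E x h) + B (D x h) (g x))) (at x within V)"
    if "x \<in> V" for x
    using bounded_bilinear.FDERIV[OF B] D E that by blast
  moreover have "Ck k V (\<lambda>x. B (f x) (E x v) + B (D x v) (g x))" for v
    by (intro Ck_add Suc.IH f g) (use D E in auto)
  ultimately show ?case by (auto intro!: exI[of _ "\<lambda>x h. B (f x) (E x h) + B (D x h) (g x)"])
qed

lemmas Ck_mult = Ck_bilinear[OF bounded_bilinear_mult]
lemmas Ck_scaleR = Ck_bilinear[OF bounded_bilinear_scaleR]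
lemmas Ck_inner = Ck_bilinear[OF bounded_bilinear_inner]

lemma Ck_compose:
  fixes g :: "'a::euclidean_space \<Rightarrow> 'b::euclidean_space" and f :: "'b \<Rightarrow> 'c::real_normed_vector"
  shows "Ck k W f \<Longrightarrow> Ck k V g \<Longrightarrow> g ` V \<subseteq> W \<Longrightarrow> Ck k V (\<lambda>x. f (g x))"
proof (induction k arbitrary: f g)
  case 0
  then show ?case by (auto intro: continuous_on_compose2)
next
  case (Suc k)
  then obtain D E where D:
    "\<forall>x\<in>W. (f has_derivative D x) (at x within W)" "\<forall>v. Ck k W (\<lambda>x. D x v)" and E:
    "\<forall>x\<in>V. (g has_derivative E x) (at x within V)" "\<forall>v. Ck k V (\<lambda>x. E x v)" by auto
  have g: "Ck k V g" using Suc.prems Ck_Suc_imp by blast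
  have der: "((\<lambda>x. f (g x)) has_derivative (\<lambda>v. D (g x) (E x v))) (at x within V)"
    if "x \<in> V" for x
  proof -
    have "(f has_derivative D (g x)) (at (g x) within g ` V)"
      using D Suc.prems(3) that by (meson has_derivative_subset imageI subsetD)
    with E that show ?thesis by (auto intro: has_derivative_in_compose)
  qed
  \<comment> \<open>\<open>Ck\<close> controls \<open>D\<close> in a fixed direction only, while the
    direction \<open>E x v\<close> moves with x. Expanding it in the basis leaves fixed directions
    with scalar coefficients, to which the induction hypothesis applies.\<close>
  have eq: "D (g x) (E x v) = (\<Sum>b\<in>Basis. (E x v \<bullet> b) *\<^sub>R D (g x) b)" if "x \<in> V" for x v
  proof -
    interpret bounded_linear "D (g x)"
      using D(1) Suc.prems(3) that by (meson has_derivative_bounded_linear image_subset_iff)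
    have "D (g x) (E x v) = D (g x) (\<Sum>b\<in>Basis. (E x v \<bullet> b) *\<^sub>R b)"
      by (simp add: euclidean_representation)
    also have "\<dots> = (\<Sum>b\<in>Basis. (E x v \<bullet> b) *\<^sub>R D (g x) b)" by (simp add: sum scaleR)
    finally show ?thesis .
  qed
  have "Ck k V (\<lambda>x. D (g x) (E x v))" for v
  proof -
    have "Ck k V (\<lambda>x. \<Sum>b\<in>Basis. (E x v \<bullet> b) *\<^sub>R D (g x) b)"
      by (intro Ck_sum finite_Basis Ck_scaleR Ck_inner Ck_const Suc.IH g) (use D E Suc.prems in auto)
    then show ?thesis using Ck_cong[of V "\<lambda>x. D (g x) (E x v)" _ k] eq by auto
  qed
  with der show ?case by (auto intro!: exI[of _ "\<lambda>x v. D (g x) (E x v)"])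
qed

lemma Ck_inverse:
  fixes f :: "'a::euclidean_space \<Rightarrow> real"
  shows "Ck k V f \<Longrightarrow> (\<And>x. x \<in> V \<Longrightarrow> f x \<noteq> 0) \<Longrightarrow> Ck k V (\<lambda>x. inverse (f x))"
proof (induction k)
  case 0
  then show ?case by (auto intro!: continuous_intros)
next
  case (Suc k)
  then obtain D where D:
    "\<forall>x\<in>V. (f has_derivative D x) (at x within V)" "\<forall>v. Ck k V (\<lambda>x. D x v)" by auto
  have f: "Ck k V f" using Suc.prems Ck_Suc_imp by blast
  \<comment> \<open>The sign is kept as a factor \<open>- 1\<close>, so that the derivative is a
    product that \<open>Ck_mult\<close> and \<open>Ck_const\<close> can handle.\<close>
  have "((\<lambda>x. inverse (f x)) has_derivative
      (\<lambda>v. (- 1) * (inverse (f x) * D x v * inverse (f x)))) (at x within V)"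
    if "x \<in> V" for x
    using Deriv.has_derivative_inverse[where f = f and x = x and S = V, OF Suc.prems(2)[OF that]] D that by simp
  moreover have "Ck k V (\<lambda>x. (- 1) * (inverse (f x) * D x v * inverse (f x)))" for v
    by (intro Ck_mult Ck_const Suc.IH f) (use Suc.prems D in auto)
  ultimately show ?case
    by (auto intro!: exI[of _ "\<lambda>x v. (- 1) * (inverse (f x) * D x v * inverse (f x))"]
             simp del: mult_minus_left)
qed

text \<open>The condition under which derivatives within \<open>V\<close> are unique.\<close>

definition axis_accessible :: "'a::euclidean_space set \<Rightarrow> bool" where
  "axis_accessible V \<longleftrightarrow>
     (\<forall>x\<in>V. \<forall>b\<in>Basis. \<forall>e>0. \<exists>d. 0 < \<bar>d\<bar> \<and> \<bar>d\<bar> < e \<and> x + d *\<^sub>R b \<in> V)"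

lemma has_derivative_within_unique:
  assumes "axis_accessible V" "x \<in> V"
    and "(f has_derivative D) (at x within V)" "(f has_derivative D') (at x within V)"
  shows "D = D'"
  using frechet_derivative_unique_within[OF assms(3,4)] assms(1,2) unfolding axis_accessible_def by blast

lemma frechet_derivative_eqI:
  assumes "axis_accessible V" "x \<in> V" "(f has_derivative D) (at x within V)"
  shows "frechet_derivative f (at x within V) = D"
  using assms has_derivative_within_unique frechet_derivative_works differentiableI by blast

lemma at_within_openin:
  assumes "openin (top_of_set V) U" "x \<in> U"
  shows "at x within U = at x within V"
proof -
  obtain T where "open T" "U = V \<inter> T" using assms(1) by (auto simp: openin_open)
  then show ?thesis using assms(2) by (intro at_within_nhd[of x T]) auto
qed

text \<open>The derivatives supplied by different neighbourhoods must fit together. Uniqueness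
  within \<open>V\<close> identifies each of them with \<open>frechet_derivative\<close>, which is a
  single global choice.\<close>

lemma Ck_local:
  fixes f :: "'a::euclidean_space \<Rightarrow> 'b::real_normed_vector"
  assumes V: "axis_accessible V"
  shows "(\<And>x. x \<in> V \<Longrightarrow> \<exists>U. openin (top_of_set V) U \<and> x \<in> U \<and> Ck k U f) \<Longrightarrow> Ck k V f"
proof (induction k arbitrary: f)
  case 0
  show ?case unfolding Ck.simps continuous_on_eq_continuous_within
  proof
    fix x assume "x \<in> V"
    then obtain U where "openin (top_of_set V) U" "x \<in> U" "continuous_on U f" using 0 by auto
    then show "continuous (at x within V) f"
      using at_within_openin by (metis continuous_on_eq_continuous_within)
  qed
next
  case (Suc k)
  let ?D = "\<lambda>x. frechet_derivative f (at x within V)"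
  have loc: "\<exists>U. openin (top_of_set V) U \<and> x \<in> U \<and>
      (\<forall>y\<in>U. (f has_derivative ?D y) (at y within V)) \<and> (\<forall>v. Ck k U (\<lambda>y. ?D y v))"
    if x: "x \<in> V" for x
  proof -
    obtain U D where U: "openin (top_of_set V) U" "x \<in> U" and
      D: "\<forall>x\<in>U. (f has_derivative D x) (at x within U)" "\<forall>v. Ck k U (\<lambda>x. D x v)"
      using Suc.prems[OF x] by auto
    have sub: "U \<subseteq> V" using U openin_imp_subset by blast
    have h: "(f has_derivative D y) (at y within V)" if "y \<in> U" for y
      using D at_within_openin[OF U(1) that] that by auto
    have "?D y = D y" if "y \<in> U" for y
      using frechet_derivative_eqI[OF V _ h[OF that]] that sub by auto
    with h D U show ?thesis using Ck_cong by (smt (verit))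
  qed
  have "\<forall>x\<in>V. (f has_derivative ?D x) (at x within V)" using loc by blast
  moreover have "Ck k V (\<lambda>x. ?D x v)" for v
    by (rule Suc.IH) (use loc in blast)
  ultimately show ?case by auto
qed

text \<open>
  This class of functions contains $t\mapsto e^{-1/t}$ and is closed under differentiation, hence
  consists of smooth functions.
\<close>

definition flat_poly :: "real poly \<Rightarrow> real \<Rightarrow> real" where
  "flat_poly p t = (if t > 0 then poly p (1 / t) * exp (- (1 / t)) else 0)"

text \<open>The free exponent k makes the induction work: the variable that \<open>pCons\<close>
  multiplies onto the tail is absorbed into the power of s.\<close>

lemma poly_times_exp_tendsto_0: "((\<lambda>s::real. s ^ k * poly p s * exp (- s)) \<longlongrightarrow> 0) at_top"
proof (induction p arbitrary: k)
  case 0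
  then show ?case by simp
next
  case (pCons a p)
  have "((\<lambda>s::real. a * (s ^ k / exp s) + s ^ Suc k * poly p s * exp (- s)) \<longlongrightarrow> a * 0 + 0) at_top"
    by (intro tendsto_intros tendsto_power_div_exp_0 pCons)
  then show ?case by (simp add: algebra_simps exp_minus field_simps)
qed

text \<open>With s = 1/t, both p(s) and exp(-s) contribute a factor s^2 when differentiated in t,
  and together they give s^2 (p(s) - p'(s)) exp(-s); this is the polynomial in the statement. At t =
  0 the right difference quotient is s p(s) exp(-s), which tends to 0.\<close>

lemma flat_poly_DERIV:
  "(flat_poly p has_real_derivative flat_poly ([:0, 0, 1:] * (p - pderiv p)) t) (at t)"
proof (cases "t \<le> 0")
  case False
  then have t: "t > 0" by simp
  have "((\<lambda>t. poly p (1 / t) * exp (- (1 / t))) has_real_derivative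
      flat_poly ([:0, 0, 1:] * (p - pderiv p)) t) (at t)"
    unfolding flat_poly_def
    using t by (auto intro!: derivative_eq_intros simp: field_simps power2_eq_square)
  then show ?thesis
  proof (rule has_field_derivative_transform_within[of _ _ _ _ t])
    show "dist y t < t \<Longrightarrow> poly p (1 / y) * exp (- (1 / y)) = flat_poly p y" for y
      by (auto simp: flat_poly_def dist_real_def)
  qed (use t in auto)
next
  case True
  then show ?thesis
  proof (cases "t = 0")
    case False
    with True have "t < 0" by simp
    have "((\<lambda>_. 0) has_real_derivative 0) (at t)" by auto
    then have "(flat_poly p has_real_derivative 0) (at t)"
      by (rule has_field_derivative_transform_within[of _ _ _ _ "- t"])
         (use \<open>t < 0\<close> in \<open>auto simp: flat_poly_def dist_real_def\<close>)
    then show ?thesis using True by (simp add: flat_poly_def)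
  next
    case True
    have "((\<lambda>h. (1 / h) ^ 1 * poly p (1 / h) * exp (- (1 / h))) \<longlongrightarrow> 0) (at_right (0::real))"
      using filterlim_compose[OF poly_times_exp_tendsto_0[of 1 p] filterlim_inverse_at_top_right]
      by (simp add: inverse_eq_divide)
    then have "((\<lambda>h. flat_poly p h / h) \<longlongrightarrow> 0) (at_right 0)"
      by (rule Lim_transform_eventually)
         (auto simp: eventually_at_filter flat_poly_def)
    moreover have "((\<lambda>h. flat_poly p h / h) \<longlongrightarrow> 0) (at_left 0)"
      by (rule Lim_transform_eventually[OF tendsto_const])
         (auto simp: eventually_at_filter flat_poly_def)
    ultimately have "((\<lambda>h. flat_poly p h / h) \<longlongrightarrow> 0) (at 0)"
      by (simp add: filterlim_split_at)
    with True show ?thesis by (simp add: DERIV_def flat_poly_def)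
  qed
qed

lemma Ck_flat_poly: "Ck k UNIV (flat_poly p)"
proof (induction k arbitrary: p)
  case 0
  then show ?case
    by (auto intro!: DERIV_continuous_on flat_poly_DERIV[THEN has_field_derivative_at_within])
next
  case (Suc k)
  let ?q = "[:0, 0, 1:] * (p - pderiv p)"
  have "(flat_poly p has_derivative (\<lambda>v. flat_poly ?q x * v)) (at x)" for x
    using flat_poly_DERIV by (simp add: has_field_derivative_def)
  moreover have "Ck k UNIV (\<lambda>x. flat_poly ?q x * v)" for v
    by (intro Ck_mult Ck_const Suc.IH)
  ultimately show ?case by (auto intro!: exI[of _ "\<lambda>x v. flat_poly ?q x * v"])
qed

lemma smooth_bump_exists:
  fixes c :: "'a::euclidean_space"
  assumes "r > 0"
  obtains h :: "'a \<Rightarrow> real" where "smooth UNIV h" "\<And>x. h x \<ge> 0" "\<And>x. h x \<noteq> 0 \<longleftrightarrow> x \<in> ball c r"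
proof
  \<comment> \<open>For p = 1 this is exp(-1/u) with u = r^2 - |x - c|^2, cut off where u \<le> 0.
    The squared distance is used because it is smooth also at the centre.\<close>
  let ?h = "\<lambda>x. flat_poly 1 (r\<^sup>2 - (x - c) \<bullet> (x - c))"
  have lin: "Ck k UNIV (\<lambda>x::'a. x - c)" for k
  proof -
    have "Ck k UNIV (\<lambda>x::'a. x + (- c))" by (intro Ck_add Ck_const Ck_linear bounded_linear_ident)
    then show ?thesis by simp
  qed
  have "Ck k UNIV (\<lambda>x. r\<^sup>2 + (- 1) * ((x - c) \<bullet> (x - c)))" for k
    by (intro Ck_add Ck_mult Ck_const Ck_inner lin)
  then have "Ck k UNIV (\<lambda>x. flat_poly 1 (r\<^sup>2 + (- 1) * ((x - c) \<bullet> (x - c))))" for k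
    by (rule Ck_compose[OF Ck_flat_poly]) auto
  then show "smooth UNIV ?h" by (simp add: smooth_def)
  show "?h x \<ge> 0" for x by (simp add: flat_poly_def)
  show "?h x \<noteq> 0 \<longleftrightarrow> x \<in> ball c r" for x
  proof -
    have "(x - c) \<bullet> (x - c) = (dist c x)\<^sup>2"
      by (simp add: dist_norm power2_norm_eq_inner inner_diff_left inner_diff_right)
    moreover have "(dist c x)\<^sup>2 < r\<^sup>2 \<longleftrightarrow> dist c x < r"
      using assms by (metis abs_of_nonneg abs_of_pos power2_less_imp_less power_strict_mono zero_le_dist less_eq_real_def pos2)
    ultimately show ?thesis by (simp add: flat_poly_def)
  qed
qed

section \<open>Charts and partitions of unity\<close>

text \<open>Covers the whole space and the half-space; relatively open subsets are axis accessible.\<close>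

definition model_space :: "'a::euclidean_space set \<Rightarrow> bool" where
  "model_space H \<longleftrightarrow> closed H \<and> (\<forall>x\<in>H. \<forall>b\<in>Basis. \<forall>t\<le>0. x + t *\<^sub>R b \<in> H)"

lemma model_space_UNIV: "model_space UNIV"
  by (simp add: model_space_def)

lemma model_space_half_space: "model_space half_space"
proof -
  have "closed half_space" unfolding half_space_def by (intro closed_Collect_le continuous_intros)
  moreover have "t * b $ 1 \<le> 0" if "b \<in> Basis" "t \<le> 0" for b :: "real^4" and t :: real
  proof -
    have "b $ 1 \<ge> 0" using that(1) by (auto simp: Basis_vec_def axis_def)
    with that(2) show ?thesis by (simp add: mult_nonpos_nonneg)
  qed
  ultimately show ?thesis unfolding model_space_def half_space_def
    by (smt (verit) mem_Collect_eq vector_add_component vector_scaleR_component real_scaleR_def)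
qed

lemma model_space_openin_accessible:
  fixes H :: "'a::euclidean_space set"
  assumes H: "model_space H" and V: "openin (top_of_set H) V"
  shows "axis_accessible V"
  unfolding axis_accessible_def
proof (intro ballI allI impI)
  fix x b :: 'a and e :: real
  assume x: "x \<in> V" and b: "b \<in> Basis" and e: "e > 0"
  obtain T where T: "open T" "V = H \<inter> T" using V by (auto simp: openin_open)
  then obtain r where r: "r > 0" "ball x r \<subseteq> T" using x by (meson IntD2 openE)
  \<comment> \<open>The step is negative because a model space is closed under moving against the
    basis vectors; half of the minimum keeps both strict bounds.\<close>
  let ?d = "- (min e r / 2)"
  have "x + ?d *\<^sub>R b \<in> ball x r"
    using r e b by (simp add: dist_norm)
  moreover have "x + ?d *\<^sub>R b \<in> H"
    using H b x T r e unfolding model_space_def by (metis IntD1 divide_nonneg_pos dual_order.strict_implies_order min_less_iff_conj neg_le_0_iff_le zero_less_numeral)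
  ultimately show "\<exists>d. 0 < \<bar>d\<bar> \<and> \<bar>d\<bar> < e \<and> x + d *\<^sub>R b \<in> V"
    using r e T by (intro exI[of _ ?d]) auto
qed

text \<open>The local model is a parameter so that every result applies twice: to X with the
  half-space, and to its boundary with the whole space.\<close>

locale model_manifold =
  fixes H :: "(real^'d::finite) set" and X :: "('x::t2_space, 'i, 'd) mfd"
  assumes model: "model_space H" and manifold: "oriented_manifold H X"
begin

lemma pts_eq: "pts X = (\<Union>i\<in>idx X. cdom X i)"
  using manifold unfolding oriented_manifold_def by blast

lemma cdom_openin: "i \<in> idx X \<Longrightarrow> openin (top_of_set (pts X)) (cdom X i)"
  using manifold unfolding oriented_manifold_def by blast

lemma cimg_openin: "i \<in> idx X \<Longrightarrow> openin (top_of_set H) (cimg X i)"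
  using manifold unfolding oriented_manifold_def by blast

lemma chart_homeo: "i \<in> idx X \<Longrightarrow> homeomorphism (cdom X i) (cimg X i) (chart X i) (cinv X i)"
  using manifold unfolding oriented_manifold_def by blast

lemma cimg_accessible: "i \<in> idx X \<Longrightarrow> axis_accessible (cimg X i)"
  using cimg_openin model model_space_openin_accessible by blast

lemma cinv_chart: "i \<in> idx X \<Longrightarrow> p \<in> cdom X i \<Longrightarrow> cinv X i (chart X i p) = p"
  using chart_homeo by (auto simp: homeomorphism_def)

lemma chart_cinv: "i \<in> idx X \<Longrightarrow> x \<in> cimg X i \<Longrightarrow> chart X i (cinv X i x) = x"
  using chart_homeo by (auto simp: homeomorphism_def)

lemma cinv_in: "i \<in> idx X \<Longrightarrow> x \<in> cimg X i \<Longrightarrow> cinv X i x \<in> cdom X i"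
  using chart_homeo by (fastforce simp: homeomorphism_def)

lemma cdom_pts: "i \<in> idx X \<Longrightarrow> p \<in> cdom X i \<Longrightarrow> p \<in> pts X"
  using pts_eq by auto

lemma chart_in: "p \<in> cdom X i \<Longrightarrow> chart X i p \<in> cimg X i"
  by (simp add: cimg_def)

lemma overlap_eq: "i \<in> idx X \<Longrightarrow> overlap X i j = {x \<in> cimg X i. cinv X i x \<in> cdom X j}"
  unfolding overlap_def cimg_def by (auto simp: cinv_chart)

lemma overlap_sub: "i \<in> idx X \<Longrightarrow> overlap X i j \<subseteq> cimg X i"
  by (auto simp: overlap_eq)

lemma overlap_openin_cimg:
  assumes "i \<in> idx X" "j \<in> idx X"
  shows "openin (top_of_set (cimg X i)) (overlap X i j)"
proof -
  obtain T where T: "open T" "cdom X j = pts X \<inter> T"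
    using cdom_openin[OF assms(2)] by (auto simp: openin_open)
  have "openin (top_of_set (cimg X i)) (cimg X i \<inter> cinv X i -` T)"
    using chart_homeo[OF assms(1)] T(1)
    by (intro continuous_openin_preimage_gen) (auto simp: homeomorphism_def)
  moreover have "cimg X i \<inter> cinv X i -` T = overlap X i j"
    using T cinv_in cdom_pts assms by (auto simp: overlap_eq)
  ultimately show ?thesis by simp
qed

lemma overlap_openin:
  assumes "i \<in> idx X" "j \<in> idx X"
  shows "openin (top_of_set H) (overlap X i j)"
  using openin_trans[OF overlap_openin_cimg[OF assms] cimg_openin[OF assms(1)]] .

lemma at_within_overlap:
  assumes "i \<in> idx X" "j \<in> idx X" "x \<in> overlap X i j"
  shows "at x within overlap X i j = at x within cimg X i"
  using at_within_openin[OF overlap_openin_cimg[OF assms(1,2)] assms(3)] .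

lemma cinv_transition: 
  assumes "i \<in> idx X" "j \<in> idx X" "x \<in> overlap X i j"
  shows "cinv X j (transition X i j x) = cinv X i x"
  using assms by (simp add: transition_def overlap_eq cinv_chart)

lemma transition_in: 
  assumes "i \<in> idx X" "j \<in> idx X" "x \<in> overlap X i j"
  shows "transition X i j x \<in> overlap X j i"
  using assms by (simp add: transition_def overlap_eq cinv_chart chart_in cinv_in)

lemma transition_transition: 
  assumes "i \<in> idx X" "j \<in> idx X" "x \<in> overlap X i j"
  shows "transition X j i (transition X i j x) = x"
  using assms cinv_transition[OF assms] by (simp add: transition_def overlap_eq chart_cinv)

lemma transition_image:
  assumes "i \<in> idx X" "j \<in> idx X"
  shows "transition X i j ` overlap X i j = overlap X j i"
proof
  show "transition X i j ` overlap X i j \<subseteq> overlap X j i" using transition_in assms by blast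
  show "overlap X j i \<subseteq> transition X i j ` overlap X i j"
    using transition_in transition_transition assms by (metis image_eqI subsetI)
qed

lemma transition_inj: "i \<in> idx X \<Longrightarrow> j \<in> idx X \<Longrightarrow> inj_on (transition X i j) (overlap X i j)"
  by (rule inj_on_inverseI[of _ "transition X j i"]) (rule transition_transition)

lemma transition_smooth:
  "i \<in> idx X \<Longrightarrow> j \<in> idx X \<Longrightarrow> smooth (overlap X i j) (transition X i j)"
  using manifold unfolding oriented_manifold_def by blast

lemma det_pos:
  "i \<in> idx X \<Longrightarrow> j \<in> idx X \<Longrightarrow> x \<in> overlap X i j \<Longrightarrow> det (matrix (dtransition X i j x)) > 0"
  using manifold unfolding oriented_manifold_def by blast

lemma transition_deriv:
  assumes "i \<in> idx X" "j \<in> idx X" "x \<in> overlap X i j"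
  shows "(transition X i j has_derivative dtransition X i j x) (at x within overlap X i j)"
proof -
  have "Ck (Suc 0) (overlap X i j) (transition X i j)"
    using transition_smooth assms unfolding smooth_def by blast
  then have "transition X i j differentiable (at x within overlap X i j)"
    using assms by (auto simp: differentiable_def)
  then show ?thesis unfolding dtransition_def by (simp add: frechet_derivative_works)
qed

lemma dtransition_linear:
  assumes "i \<in> idx X" "j \<in> idx X" "x \<in> overlap X i j"
  shows "linear (dtransition X i j x)"
  using transition_deriv[OF assms] has_derivative_linear by blast

text \<open>For extension by zero: seen in any chart, a function supported in a compact set vanishes
  on a relatively open set. Compact sets are closed here because the space is Hausdorff.\<close>

lemma cimg_minus_openin:
  assumes "i \<in> idx X" "compact K"
  shows "openin (top_of_set (cimg X i)) {x \<in> cimg X i. cinv X i x \<notin> K}"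
proof -
  have "openin (top_of_set (cimg X i)) (cimg X i \<inter> cinv X i -` (- K))"
    using chart_homeo[OF assms(1)] compact_imp_closed[OF assms(2)]
    by (intro continuous_openin_preimage_gen) (auto simp: homeomorphism_def)
  moreover have "cimg X i \<inter> cinv X i -` (- K) = {x \<in> cimg X i. cinv X i x \<notin> K}" by auto
  ultimately show ?thesis by simp
qed

text \<open>A Euclidean bump is pulled back by one chart and extended by zero. The compact set
  \<open>K\<close> containing its support makes the extension smooth in every other chart, and later
  bounds the closure of the support.\<close>

lemma bump_exists:
  assumes "p \<in> pts X"
  shows "\<exists>i \<phi> K. i \<in> idx X \<and> compact K \<and> K \<subseteq> cdom X i \<and> (\<forall>q. \<phi> q \<ge> (0::real)) \<and>
    (\<forall>q. \<phi> q \<noteq> 0 \<longrightarrow> q \<in> K) \<and> openin (top_of_set (pts X)) {q \<in> pts X. \<phi> q \<noteq> 0} \<and> \<phi> p \<noteq> 0 \<and>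
    (\<forall>j\<in>idx X. smooth (cimg X j) (\<phi> \<circ> cinv X j))"
proof -
  obtain i where i: "i \<in> idx X" "p \<in> cdom X i" using assms pts_eq by auto
  define c where "c = chart X i p"
  obtain T where T: "open T" "cimg X i = H \<inter> T"
    using cimg_openin[OF i(1)] by (auto simp: openin_open)
  have "c \<in> T" using chart_in[OF i(2)] T by (auto simp: c_def)
  then obtain r where r: "r > 0" "cball c r \<subseteq> T" using T(1) open_contains_cball by blast
  \<comment> \<open>\<open>H\<close> is closed, so this is compact even if the ball crosses the
    boundary of the half-space.\<close>
  define C where "C = H \<inter> cball c r"
  have C: "compact C" "C \<subseteq> cimg X i"
    using model r T by (auto simp: C_def model_space_def intro: closed_Int_compact)
  define K where "K = cinv X i ` C"
  have K: "compact K" "K \<subseteq> cdom X i"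
    using C chart_homeo[OF i(1)] cinv_in[OF i(1)] unfolding K_def
    by (meson compact_continuous_image continuous_on_subset homeomorphism_def) (use C cinv_in[OF i(1)] in auto)
  obtain h :: "real^'d \<Rightarrow> real" where h: "smooth UNIV h" "\<And>x. h x \<ge> 0" "\<And>x. h x \<noteq> 0 \<longleftrightarrow> x \<in> ball c r"
    using smooth_bump_exists[OF r(1)] by metis
  define \<phi> where "\<phi> q = (if q \<in> cdom X i then h (chart X i q) else 0)" for q
  have \<phi>K: "q \<in> K" if "\<phi> q \<noteq> 0" for q
  proof -
    have q: "q \<in> cdom X i" "chart X i q \<in> ball c r" using that h(3) by (auto simp: \<phi>_def split: if_splits)
    then have "chart X i q \<in> C" using chart_in[OF q(1)] T by (auto simp: C_def)
    then show ?thesis using cinv_chart[OF i(1) q(1)] unfolding K_def by (metis imageI)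
  qed
  have "openin (top_of_set (cdom X i)) (cdom X i \<inter> chart X i -` ball c r)"
    using chart_homeo[OF i(1)] by (intro continuous_openin_preimage_gen) (auto simp: homeomorphism_def)
  then have "openin (top_of_set (pts X)) (cdom X i \<inter> chart X i -` ball c r)"
    using cdom_openin[OF i(1)] by (rule openin_trans)
  moreover have "cdom X i \<inter> chart X i -` ball c r = {q \<in> pts X. \<phi> q \<noteq> 0}"
  proof (intro set_eqI)
    show "q \<in> cdom X i \<inter> chart X i -` ball c r \<longleftrightarrow> q \<in> {q \<in> pts X. \<phi> q \<noteq> 0}" for q
      using h(3)[of "chart X i q"] cdom_pts[OF i(1), of q] unfolding \<phi>_def by simp
  qed
  ultimately have op: "openin (top_of_set (pts X)) {q \<in> pts X. \<phi> q \<noteq> 0}" by simp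
  have sm: "smooth (cimg X j) (\<phi> \<circ> cinv X j)" if j: "j \<in> idx X" for j
    unfolding smooth_def
  proof
    fix k
    show "Ck k (cimg X j) (\<phi> \<circ> cinv X j)"
    proof (rule Ck_local[OF cimg_accessible[OF j]])
      fix x assume x: "x \<in> cimg X j"
      show "\<exists>U. openin (top_of_set (cimg X j)) U \<and> x \<in> U \<and> Ck k U (\<phi> \<circ> cinv X j)"
      \<comment> \<open>The overlap with chart i and the complement of \<open>K\<close> are
        relatively open and cover chart j. On the first the function is a composition of smooth
        maps, on the second it is 0.\<close>
      proof (cases "cinv X j x \<in> cdom X i")
        case True
        have "Ck k (overlap X j i) (\<lambda>x. h (transition X j i x))"
          by (rule Ck_compose[where W = UNIV and f = h and g = "transition X j i"]) (use h(1) transition_smooth[OF j i(1)] in \<open>simp_all add: smooth_def\<close>)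
        moreover have "(\<phi> \<circ> cinv X j) y = h (transition X j i y)" if "y \<in> overlap X j i" for y
          using that overlap_eq[OF j] by (simp add: \<phi>_def transition_def)
        ultimately have "Ck k (overlap X j i) (\<phi> \<circ> cinv X j)"
          using Ck_cong[of "overlap X j i" "\<phi> \<circ> cinv X j" "\<lambda>x. h (transition X j i x)" k] by metis
        then show ?thesis using True x overlap_eq[OF j] overlap_openin_cimg[OF j i(1)] by blast
      next
        case False
        let ?U = "{x \<in> cimg X j. cinv X j x \<notin> K}"
        have "Ck k ?U (\<phi> \<circ> cinv X j) \<longleftrightarrow> Ck k ?U (\<lambda>x. 0 :: real)"
          by (rule Ck_cong) (use \<phi>K in auto)
        then have "Ck k ?U (\<phi> \<circ> cinv X j)" by (simp add: Ck_const del: Ck.simps)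
        moreover have "x \<in> ?U" using x False K by auto
        ultimately show ?thesis using cimg_minus_openin[OF j K(1)] by blast
      qed
    qed
  qed
  have \<phi>p: "\<phi> p \<noteq> 0" using i h(3) r by (simp add: \<phi>_def c_def)
  have nn: "\<phi> q \<ge> 0" for q using h(2) by (simp add: \<phi>_def)
  show ?thesis
    by (intro exI[of _ i] exI[of _ \<phi>] exI[of _ K] conjI allI impI ballI; fact)
qed

lemma partition_of_unity_exists:
  assumes cpt: "compact (pts X)"
  shows "\<exists>J \<rho>. partition_of_unity X J \<rho>"
proof -
  define P where "P p i \<phi> K \<longleftrightarrow> i \<in> idx X \<and> compact K \<and> K \<subseteq> cdom X i \<and> (\<forall>q. \<phi> q \<ge> (0::real)) \<and>
    (\<forall>q. \<phi> q \<noteq> 0 \<longrightarrow> q \<in> K) \<and> openin (top_of_set (pts X)) {q \<in> pts X. \<phi> q \<noteq> 0} \<and> \<phi> p \<noteq> 0 \<and>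
    (\<forall>j\<in>idx X. smooth (cimg X j) (\<phi> \<circ> cinv X j))" for p i \<phi> K
  have "\<forall>p\<in>pts X. \<exists>i \<phi> K. P p i \<phi> K" using bump_exists unfolding P_def by blast
  then obtain i \<phi> K where "\<And>p. p \<in> pts X \<Longrightarrow> P p (i p) (\<phi> p) (K p)" by metis
  then have
    i: "\<And>p. p \<in> pts X \<Longrightarrow> i p \<in> idx X" and
    K: "\<And>p. p \<in> pts X \<Longrightarrow> compact (K p) \<and> K p \<subseteq> cdom X (i p)" and
    nn: "\<And>p q. p \<in> pts X \<Longrightarrow> \<phi> p q \<ge> (0::real)" and
    supp: "\<And>p q. p \<in> pts X \<Longrightarrow> \<phi> p q \<noteq> 0 \<Longrightarrow> q \<in> K p" and
    op: "\<And>p. p \<in> pts X \<Longrightarrow> openin (top_of_set (pts X)) {q \<in> pts X. \<phi> p q \<noteq> 0}" and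
    pp: "\<And>p. p \<in> pts X \<Longrightarrow> \<phi> p p \<noteq> 0" and
    sm: "\<And>p j. p \<in> pts X \<Longrightarrow> j \<in> idx X \<Longrightarrow> smooth (cimg X j) (\<phi> p \<circ> cinv X j)"
    unfolding P_def by blast+
  let ?U = "\<lambda>p. {q \<in> pts X. \<phi> p q \<noteq> 0}"
  have cov: "\<forall>c\<in>?U ` pts X. openin (top_of_set (pts X)) c" "pts X \<subseteq> \<Union> (?U ` pts X)"
    using op pp by auto
  obtain D where "D \<subseteq> ?U ` pts X" "finite D" "pts X \<subseteq> \<Union> D"
    using cpt cov unfolding compact_eq_openin_cover by meson
  then obtain F where F: "F \<subseteq> pts X" "finite F" "pts X \<subseteq> \<Union> (?U ` F)"
    by (metis (no_types, lifting) finite_subset_image)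
  define S where "S q = (\<Sum>p\<in>F. \<phi> p q)" for q
  have Spos: "S q > 0" if q: "q \<in> pts X" for q
  proof -
    obtain p where p: "p \<in> F" "\<phi> p q \<noteq> 0" using F(3) q by auto
    then have "\<phi> p q > 0" using nn[of p q] F(1) by force
    then show ?thesis unfolding S_def
      using p F nn by (intro sum_pos2[of F p]) auto
  qed
  \<comment> \<open>The bumps are indexed by points, a partition of unity by charts: all bumps that
    live in the same chart are added up before normalising.\<close>
  define \<rho> where "\<rho> j q = (\<Sum>p\<in>{p\<in>F. i p = j}. \<phi> p q) * inverse (S q)" for j q
  have smS: "Ck k (cimg X l) (\<lambda>x. \<Sum>p\<in>G. \<phi> p (cinv X l x))" if "l \<in> idx X" "G \<subseteq> F" for l k G
  proof (rule Ck_sum)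
    show "finite G" using that F finite_subset by blast
    show "Ck k (cimg X l) (\<lambda>x. \<phi> p (cinv X l x))" if "p \<in> G" for p
      using sm[of p l] that F \<open>G \<subseteq> F\<close> \<open>l \<in> idx X\<close> by (auto simp: smooth_def comp_def)
  qed
  have sm\<rho>: "smooth (cimg X l) (\<rho> j \<circ> cinv X l)" if l: "l \<in> idx X" for j l
    unfolding smooth_def comp_def \<rho>_def S_def
    using smS[OF l] Spos cinv_in[OF l] cdom_pts[OF l]
    by (intro allI Ck_mult Ck_inverse) (fastforce simp: S_def)+
  have supp\<rho>: "pts X \<inter> closure {p\<in>pts X. \<rho> j p \<noteq> 0} \<subseteq> cdom X j" for j
  proof -
    \<comment> \<open>A finite union of compact sets is closed, so it contains the closure of the
      support as well as the support.\<close>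
    let ?K = "\<Union>p\<in>{p\<in>F. i p = j}. K p"
    have "compact ?K" using F K by (intro compact_UN) auto
    moreover have "{p\<in>pts X. \<rho> j p \<noteq> 0} \<subseteq> ?K"
    proof
      fix q assume "q \<in> {p\<in>pts X. \<rho> j p \<noteq> 0}"
      then have "(\<Sum>p\<in>{p\<in>F. i p = j}. \<phi> p q) \<noteq> 0" by (auto simp: \<rho>_def)
      then obtain p where "p \<in> F" "i p = j" "\<phi> p q \<noteq> 0" by (metis (mono_tags, lifting) mem_Collect_eq sum.neutral)
      then show "q \<in> ?K" using supp F by auto
    qed
    ultimately have "closure {p\<in>pts X. \<rho> j p \<noteq> 0} \<subseteq> ?K"
      by (meson closure_minimal compact_imp_closed)
    moreover have "?K \<subseteq> cdom X j" using K F(1) by blast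
    ultimately show ?thesis by blast
  qed
  have sum\<rho>: "(\<Sum>j\<in>i ` F. \<rho> j p) = 1" if "p \<in> pts X" for p
  proof -
    have "(\<Sum>j\<in>i ` F. \<rho> j p) = (\<Sum>j\<in>i ` F. (\<Sum>q\<in>{q\<in>F. i q = j}. \<phi> q p)) * inverse (S p)"
      by (simp add: \<rho>_def sum_distrib_right)
    also have "(\<Sum>j\<in>i ` F. (\<Sum>q\<in>{q\<in>F. i q = j}. \<phi> q p)) = S p"
      unfolding S_def using F(2) by (rule sum.image_gen[symmetric])
    finally show ?thesis using Spos[OF that] by simp
  qed
  have nn\<rho>: "\<rho> j p \<ge> 0" if "p \<in> pts X" for j p
  proof -
    have "0 \<le> (\<Sum>q\<in>{q\<in>F. i q = j}. \<phi> q p)"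
      by (rule sum_nonneg) (use nn F(1) in blast)
    then show ?thesis unfolding \<rho>_def using Spos[OF that] by simp
  qed
  have "finite (i ` F)" "i ` F \<subseteq> idx X" using F i by auto
  then have "partition_of_unity X (i ` F) \<rho>"
    unfolding partition_of_unity_def
    using sm\<rho> supp\<rho> sum\<rho> nn\<rho> by (intro conjI ballI) simp_all
  then show ?thesis by blast
qed

end

section \<open>Integration of densities\<close>

lemma (in model_manifold) chart_integrable:
  fixes f :: "real^'d \<Rightarrow> complex"
  assumes i: "i \<in> idx X" and K: "compact K" "K \<subseteq> cdom X i"
    and f: "continuous_on (cimg X i) f"
    and zero: "\<And>x. x \<in> cimg X i \<Longrightarrow> cinv X i x \<notin> K \<Longrightarrow> f x = 0"
  shows "f absolutely_integrable_on cimg X i"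
proof -
  let ?C = "chart X i ` K"
  have cont: "continuous_on (cdom X i) (chart X i)"
    using chart_homeo[OF i] by (simp add: homeomorphism_def)
  have C: "compact ?C" "?C \<subseteq> cimg X i"
    using K continuous_on_subset[OF cont] by (auto simp: cimg_def intro: compact_continuous_image)
  have int: "integrable lborel (\<lambda>x. indicator ?C x *\<^sub>R f x)"
    using C f by (intro borel_integrable_compact) (auto intro: continuous_on_subset)
  have "indicator (cimg X i) x *\<^sub>R f x = indicator ?C x *\<^sub>R f x" for x
  proof (cases "x \<in> cimg X i \<and> x \<notin> ?C")
    case True
    then have "cinv X i x \<notin> K" using chart_cinv[OF i, of x] by (metis imageI)
    with True zero show ?thesis by simp
  next
    case False
    then show ?thesis using C by (auto simp: indicator_def)
  qed
  then have "(\<lambda>x. indicator (cimg X i) x *\<^sub>R f x) = (\<lambda>x. indicator ?C x *\<^sub>R f x)" by blast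
  then show ?thesis
    unfolding set_integrable_def using integrable_completion[OF borel_measurable_integrable[OF int]] int by simp
qed

text \<open>The sort \<open>wellorder\<close> of the index type is the one for which
  \<open>integral_change_of_variables\<close> is stated; both dimensions 3 and 4 have it.\<close>

locale compact_manifold = model_manifold H X
  for H :: "(real^'d::{finite,wellorder}) set" and X :: "('x::t2_space, 'i, 'd) mfd" +
  assumes cpt: "compact (pts X)"
begin

lemma overlap_lebesgue:
  assumes "i \<in> idx X" "j \<in> idx X"
  shows "overlap X i j \<in> sets lebesgue"
proof -
  obtain T where "open T" "overlap X i j = H \<inter> T"
    using overlap_openin[OF assms] by (auto simp: openin_open)
  then show ?thesis using model by (simp add: model_space_def borel_closed)
qed

text \<open>Both integrands vanish off the overlap, so each integral reduces to it, and there the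
  change of variables applies. Orientation enters because the theorem involves the absolute value of
  the determinant and the transformation law does not.\<close>

lemma integral_change_chart:
  fixes F :: "'i \<Rightarrow> (real^'d::_) \<Rightarrow> complex"
  assumes j: "j \<in> idx X" and k: "k \<in> idx X"
    and tr: "\<And>x. x \<in> overlap X j k \<Longrightarrow>
      F j x = det (matrix (dtransition X j k x)) *\<^sub>R F k (transition X j k x)"
    and zj: "\<And>x. x \<in> cimg X j \<Longrightarrow> x \<notin> overlap X j k \<Longrightarrow> F j x = 0"
    and zk: "\<And>x. x \<in> cimg X k \<Longrightarrow> x \<notin> overlap X k j \<Longrightarrow> F k x = 0"
    and ij: "F j absolutely_integrable_on cimg X j"
    and ik: "F k absolutely_integrable_on cimg X k"
  shows "integral (cimg X j) (F j) = integral (cimg X k) (F k)"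
proof -
  \<comment> \<open>The change of variables is for integrands with values in \<open>real^'n\<close>;
    the injective linear map \<open>h\<close> carries complex values there, and the equality is
    pulled back at the end.\<close>
  define h :: "complex \<Rightarrow> real^2" where "h z = (\<chi> i. if i = 1 then Re z else Im z)" for z
  have h_lin: "bounded_linear h"
    unfolding h_def by (rule linear_conv_bounded_linear[THEN iffD1]) (rule linearI; auto simp: vec_eq_iff)
  have h_inj: "h z = h w \<Longrightarrow> z = w" for z w
    unfolding h_def vec_eq_iff by (auto simp: complex_eq_iff forall_2 dest: spec[of _ 2])
  let ?S = "overlap X j k" and ?g = "transition X j k"
  have restr: "integral (cimg X a) f = integral (overlap X a b) f \<and>
      (f absolutely_integrable_on cimg X a \<longleftrightarrow> f absolutely_integrable_on overlap X a b)"
    if "a \<in> idx X" and z: "\<And>x. x \<in> cimg X a \<Longrightarrow> x \<notin> overlap X a b \<Longrightarrow> f x = 0"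
    for a b and f :: "(real^'d::_) \<Rightarrow> complex"
  proof -
    have eq1: "(\<lambda>x. if x \<in> cimg X a then f x else 0) = (\<lambda>x. if x \<in> overlap X a b then f x else 0)"
      using overlap_sub[OF \<open>a \<in> idx X\<close>, of b] z by (intro ext) auto
    have eq2: "(\<lambda>x. indicator (cimg X a) x *\<^sub>R f x) = (\<lambda>x. indicator (overlap X a b) x *\<^sub>R f x)"
    proof
      show "indicator (cimg X a) x *\<^sub>R f x = indicator (overlap X a b) x *\<^sub>R f x" for x
        using overlap_sub[OF \<open>a \<in> idx X\<close>, of b] z[of x]
        by (cases "x \<in> cimg X a"; cases "x \<in> overlap X a b") auto
    qed
    have "integral (cimg X a) f = integral (overlap X a b) f"
      using eq1 integral_restrict_UNIV[of "cimg X a" f] integral_restrict_UNIV[of "overlap X a b" f] by simp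
    then show ?thesis
      unfolding set_integrable_def eq2 by simp
  qed
  note rj = restr[OF j zj] and rk = restr[OF k zk]
  have Fk: "F k absolutely_integrable_on ?g ` ?S" and Fj: "F j absolutely_integrable_on ?S"
    using rj rk ij ik transition_image[OF j k] by auto
  have hk: "(h \<circ> F k) absolutely_integrable_on ?g ` ?S"
    using absolutely_integrable_linear[OF Fk h_lin] .
  have "h (integral (?g ` ?S) (F k)) = integral (?g ` ?S) (h \<circ> F k)"
    using Fk h_lin by (intro integral_linear[symmetric]) (auto intro: set_lebesgue_integral_eq_integral)
  also have "\<dots> = integral ?S (\<lambda>x. \<bar>det (matrix (dtransition X j k x))\<bar> *\<^sub>R (h \<circ> F k) (?g x))"
    using hk by (intro integral_change_of_variables overlap_lebesgue j k transition_deriv transition_inj) auto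
  also have "\<dots> = integral ?S (h \<circ> F j)"
    using det_pos[OF j k] tr
    by (intro integral_cong) (simp add: linear_cmul[OF bounded_linear.linear[OF h_lin]] abs_of_pos)
  also have "\<dots> = h (integral ?S (F j))"
    using Fj h_lin by (intro integral_linear) (auto intro: set_lebesgue_integral_eq_integral)
  finally show ?thesis
    using h_inj rj rk transition_image[OF j k] by auto
qed

section \<open>Independence of the partition of unity and linearity of the integral\<close>

definition chartwise_continuous :: "('i \<Rightarrow> (real^'d::_) \<Rightarrow> complex) \<Rightarrow> bool" where
  "chartwise_continuous \<omega> \<longleftrightarrow> (\<forall>i\<in>idx X. continuous_on (cimg X i) (\<omega> i))"

text \<open>This is the transformation law for coefficients of top-degree forms; there is no
  absolute value around the determinant.\<close>

definition top_density :: "('i \<Rightarrow> (real^'d::_) \<Rightarrow> complex) \<Rightarrow> bool" where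
  "top_density \<omega> \<longleftrightarrow> (\<forall>i\<in>idx X. \<forall>j\<in>idx X. \<forall>x\<in>overlap X i j.
     \<omega> i x = det (matrix (dtransition X i j x)) *\<^sub>R \<omega> j (transition X i j x))"

definition pou_integral :: "'i set \<Rightarrow> ('i \<Rightarrow> 'x \<Rightarrow> real) \<Rightarrow> ('i \<Rightarrow> (real^'d::_) \<Rightarrow> complex) \<Rightarrow> complex" where
  "pou_integral J \<rho> \<omega> = (\<Sum>j\<in>J. integral (cimg X j) (\<lambda>x. \<rho> j (cinv X j x) *\<^sub>R \<omega> j x))"

text \<open>Compactness of X turns the relatively closed support into a compact subset of the chart,
  which is what integrability needs.\<close>

lemma pou_support:
  assumes "partition_of_unity X J \<rho>" "j \<in> J"
  obtains K where "compact K" "K \<subseteq> cdom X j" "\<And>p. p \<in> pts X \<Longrightarrow> p \<notin> K \<Longrightarrow> \<rho> j p = 0"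
proof
  let ?K = "pts X \<inter> closure {p\<in>pts X. \<rho> j p \<noteq> 0}"
  show "compact ?K" using cpt by (intro compact_Int_closed) auto
  show "?K \<subseteq> cdom X j" using assms unfolding partition_of_unity_def by blast
  show "\<And>p. p \<in> pts X \<Longrightarrow> p \<notin> ?K \<Longrightarrow> \<rho> j p = 0" using closure_subset by fastforce
qed

lemma pou_Ck:
  assumes "partition_of_unity X J \<rho>" "j \<in> J" "i \<in> idx X"
  shows "Ck k (cimg X i) (\<lambda>x. \<rho> j (cinv X i x))"
  using assms unfolding partition_of_unity_def smooth_def comp_def by blast

lemma pou_continuous:
  assumes "partition_of_unity X J \<rho>" "j \<in> J" "i \<in> idx X"
  shows "continuous_on (cimg X i) (\<lambda>x. \<rho> j (cinv X i x))"
  using pou_Ck[OF assms] Ck_imp_continuous_on by blast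

lemma pou_sum:
  assumes "partition_of_unity X J \<rho>" "i \<in> idx X" "x \<in> cimg X i"
  shows "(\<Sum>j\<in>J. \<rho> j (cinv X i x)) = 1"
  using assms cinv_in cdom_pts unfolding partition_of_unity_def by blast

lemma pou_finite: "partition_of_unity X J \<rho> \<Longrightarrow> finite J"
  and pou_idx: "partition_of_unity X J \<rho> \<Longrightarrow> j \<in> J \<Longrightarrow> j \<in> idx X"
  unfolding partition_of_unity_def by blast+

text \<open>
  The densities \<open>\<eta> j\<close> are not assumed to be of the form \<open>\<rho>\<^sub>j \<omega>\<close>: in Stokes' theorem they are
  $\mathrm{d}\rho_j\wedge\omega$.
\<close>

lemma sum_integral_transfer:
  assumes \<tau>: "partition_of_unity X K \<tau>" and J: "finite J" "J \<subseteq> idx X"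
    and C: "\<And>j. j \<in> J \<Longrightarrow> compact (C j) \<and> C j \<subseteq> cdom X j"
    and cont: "\<And>j. j \<in> J \<Longrightarrow> chartwise_continuous (\<eta> j)"
    and dens: "\<And>j. j \<in> J \<Longrightarrow> top_density (\<eta> j)"
    and zero: "\<And>j i x. j \<in> J \<Longrightarrow> i \<in> idx X \<Longrightarrow> x \<in> cimg X i \<Longrightarrow> cinv X i x \<notin> C j \<Longrightarrow> \<eta> j i x = 0"
  shows "(\<Sum>j\<in>J. integral (cimg X j) (\<eta> j j)) = pou_integral K \<tau> (\<lambda>i x. \<Sum>j\<in>J. \<eta> j i x)"
proof -
  let ?F = "\<lambda>j k i x. \<tau> k (cinv X i x) *\<^sub>R \<eta> j i x"
  have contF: "continuous_on (cimg X i) (?F j k i)" if "j \<in> J" "k \<in> K" "i \<in> idx X" for j k i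
    using that cont pou_continuous[OF \<tau>] unfolding chartwise_continuous_def by (intro continuous_intros) auto
  have intj: "?F j k j absolutely_integrable_on cimg X j" if "j \<in> J" "k \<in> K" for j k
    by (rule chart_integrable[of j "C j"]) (use that J C contF zero in auto)
  have intk: "?F j k k absolutely_integrable_on cimg X k" if jk: "j \<in> J" "k \<in> K" for j k
  proof -
    have k: "k \<in> idx X" using pou_idx[OF \<tau> jk(2)] .
    obtain D where "compact D" "D \<subseteq> cdom X k" "\<And>p. p \<in> pts X \<Longrightarrow> p \<notin> D \<Longrightarrow> \<tau> k p = 0"
      by (rule pou_support[OF \<tau> jk(2)]) blast
    then show ?thesis
      using k contF[OF jk k] cinv_in[OF k] cdom_pts[OF k] by (intro chart_integrable[of k D]) auto
  qed
  \<comment> \<open>The factor \<open>\<tau> k\<close> confines the product to chart k and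
    \<open>\<eta> j\<close> confines it to chart j. It lives on the overlap and may be integrated in
    either chart.\<close>
  have swap: "integral (cimg X j) (?F j k j) = integral (cimg X k) (?F j k k)" if jk: "j \<in> J" "k \<in> K" for j k
  proof -
    have k: "k \<in> idx X" and j: "j \<in> idx X" using pou_idx[OF \<tau> jk(2)] J jk by auto
    obtain D where D: "compact D" "D \<subseteq> cdom X k" "\<And>p. p \<in> pts X \<Longrightarrow> p \<notin> D \<Longrightarrow> \<tau> k p = 0"
      by (rule pou_support[OF \<tau> jk(2)]) blast
    show ?thesis
    proof (rule integral_change_chart[of j k "?F j k", OF j k _ _ _ intj[OF jk] intk[OF jk]])
      show "?F j k j x = det (matrix (dtransition X j k x)) *\<^sub>R ?F j k k (transition X j k x)"
        if x: "x \<in> overlap X j k" for x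
      proof -
        have "\<eta> j j x = det (matrix (dtransition X j k x)) *\<^sub>R \<eta> j k (transition X j k x)"
          using dens[OF jk(1)] j k x unfolding top_density_def by blast
        then show ?thesis using cinv_transition[OF j k x] by simp
      qed
      show "?F j k j x = 0" if "x \<in> cimg X j" "x \<notin> overlap X j k" for x
        using that D cinv_in[OF j] cdom_pts[OF j] by (auto simp: overlap_eq[OF j])
      show "?F j k k x = 0" if "x \<in> cimg X k" "x \<notin> overlap X k j" for x
        using that C[OF jk(1)] zero[OF jk(1) k] by (auto simp: overlap_eq[OF k])
    qed
  qed
  have "(\<Sum>j\<in>J. integral (cimg X j) (\<eta> j j)) = (\<Sum>j\<in>J. \<Sum>k\<in>K. integral (cimg X j) (?F j k j))"
  proof (rule sum.cong[OF refl])
    fix j assume j: "j \<in> J"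
    have "integral (cimg X j) (\<eta> j j) = integral (cimg X j) (\<lambda>x. \<Sum>k\<in>K. ?F j k j x)"
      using pou_sum[OF \<tau>, of j] j J(2)
      by (intro integral_cong) (auto simp flip: scaleR_left.sum)
    also have "\<dots> = (\<Sum>k\<in>K. integral (cimg X j) (?F j k j))"
      using intj[OF j] pou_finite[OF \<tau>] by (intro integral_sum set_lebesgue_integral_eq_integral)
    finally show "integral (cimg X j) (\<eta> j j) = (\<Sum>k\<in>K. integral (cimg X j) (?F j k j))" .
  qed
  also have "\<dots> = (\<Sum>j\<in>J. \<Sum>k\<in>K. integral (cimg X k) (?F j k k))"
    using swap by (intro sum.cong refl)
  also have "\<dots> = (\<Sum>k\<in>K. \<Sum>j\<in>J. integral (cimg X k) (?F j k k))" by (rule sum.swap)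
  also have "\<dots> = (\<Sum>k\<in>K. integral (cimg X k) (\<lambda>x. \<tau> k (cinv X k x) *\<^sub>R (\<Sum>j\<in>J. \<eta> j k x)))"
  proof (rule sum.cong[OF refl])
    fix k assume k: "k \<in> K"
    have "(\<Sum>j\<in>J. integral (cimg X k) (?F j k k)) = integral (cimg X k) (\<lambda>x. \<Sum>j\<in>J. ?F j k k x)"
      using intk[OF _ k] J(1) by (intro integral_sum[symmetric] set_lebesgue_integral_eq_integral)
    then show "(\<Sum>j\<in>J. integral (cimg X k) (?F j k k)) =
        integral (cimg X k) (\<lambda>x. \<tau> k (cinv X k x) *\<^sub>R (\<Sum>j\<in>J. \<eta> j k x))"
      by (simp add: scaleR_sum_right)
  qed
  finally show ?thesis unfolding pou_integral_def .
qed

text \<open>The transfer is applied to the densities \<rho>_j \<omega>; afterwards the factors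
  \<rho>_j add up to 1.\<close>

lemma pou_integral_indep:
  assumes \<rho>: "partition_of_unity X J \<rho>" and \<tau>: "partition_of_unity X K \<tau>"
    and cont: "chartwise_continuous \<omega>" and dens: "top_density \<omega>"
  shows "pou_integral J \<rho> \<omega> = pou_integral K \<tau> \<omega>"
proof -
  let ?\<eta> = "\<lambda>j i x. \<rho> j (cinv X i x) *\<^sub>R \<omega> i x"
  have "\<exists>D. compact D \<and> D \<subseteq> cdom X j \<and> (\<forall>p\<in>pts X. p \<notin> D \<longrightarrow> \<rho> j p = 0)" if "j \<in> J" for j
    using pou_support[OF \<rho> that] by metis
  then obtain C where C: "\<And>j. j \<in> J \<Longrightarrow> compact (C j) \<and> C j \<subseteq> cdom X j \<and> (\<forall>p\<in>pts X. p \<notin> C j \<longrightarrow> \<rho> j p = 0)"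
    by metis
  have "pou_integral J \<rho> \<omega> = pou_integral K \<tau> (\<lambda>i x. \<Sum>j\<in>J. ?\<eta> j i x)"
    unfolding pou_integral_def[of J]
  proof (rule sum_integral_transfer[OF \<tau> pou_finite[OF \<rho>], of C ?\<eta>])
    show "J \<subseteq> idx X" using pou_idx[OF \<rho>] by auto
    show "compact (C j) \<and> C j \<subseteq> cdom X j" if "j \<in> J" for j using C that by blast
    show "chartwise_continuous (?\<eta> j)" if "j \<in> J" for j
      using cont pou_continuous[OF \<rho> that] unfolding chartwise_continuous_def
      by (auto intro!: continuous_intros)
    show "top_density (?\<eta> j)" if "j \<in> J" for j
      unfolding top_density_def
    proof (intro ballI)
      fix a b x assume ab: "a \<in> idx X" "b \<in> idx X" "x \<in> overlap X a b"
      have "\<omega> a x = det (matrix (dtransition X a b x)) *\<^sub>R \<omega> b (transition X a b x)"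
        using dens ab unfolding top_density_def by blast
      then show "?\<eta> j a x = det (matrix (dtransition X a b x)) *\<^sub>R ?\<eta> j b (transition X a b x)"
        using cinv_transition[OF ab] by simp
    qed
    show "?\<eta> j i x = 0" if "j \<in> J" "i \<in> idx X" "x \<in> cimg X i" "cinv X i x \<notin> C j" for j i x
      using C[OF that(1)] that cinv_in[OF that(2,3)] cdom_pts[OF that(2)] by simp
  qed
  also have "\<dots> = pou_integral K \<tau> \<omega>"
    unfolding pou_integral_def
  proof (intro sum.cong refl integral_cong)
    fix k x assume "k \<in> K" "x \<in> cimg X k"
    then show "\<tau> k (cinv X k x) *\<^sub>R (\<Sum>j\<in>J. \<rho> j (cinv X k x) *\<^sub>R \<omega> k x) = \<tau> k (cinv X k x) *\<^sub>R \<omega> k x"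
      using pou_sum[OF \<rho>, of k x] pou_idx[OF \<tau>] by (simp flip: scaleR_left.sum)
  qed
  finally show ?thesis .
qed

text \<open>The choice made by \<open>SOME\<close> does not involve the integrand. One partition
  therefore serves all forms at once, and linearity becomes a termwise statement.\<close>

lemma mfd_integral_pou:
  obtains J \<rho> where "partition_of_unity X J \<rho>" "\<And>\<omega>. mfd_integral X \<omega> = pou_integral J \<rho> \<omega>"
proof -
  obtain J \<rho> where J: "(SOME (J, \<rho>). partition_of_unity X J \<rho>) = (J, \<rho>)" by fastforce
  have "case (SOME (J, \<rho>). partition_of_unity X J \<rho>) of (J, \<rho>) \<Rightarrow> partition_of_unity X J \<rho>"
    using partition_of_unity_exists[OF cpt] by (intro someI_ex[of "\<lambda>(J, \<rho>). partition_of_unity X J \<rho>"]) auto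
  then have "partition_of_unity X J \<rho>" by (simp add: J)
  moreover have "mfd_integral X \<omega> = pou_integral J \<rho> \<omega>" for \<omega>
    by (simp add: mfd_integral_def pou_integral_def J)
  ultimately show ?thesis using that by blast
qed

text \<open>For use where the partition is prescribed: on the boundary it has to be the restriction
  of the one chosen on X.\<close>

lemma mfd_integral_eq:
  assumes "partition_of_unity X J \<rho>" "chartwise_continuous \<omega>" "top_density \<omega>"
  shows "mfd_integral X \<omega> = pou_integral J \<rho> \<omega>"
  using mfd_integral_pou pou_integral_indep assms by metis

lemma pou_integrable:
  assumes \<rho>: "partition_of_unity X J \<rho>" and j: "j \<in> J" and c: "chartwise_continuous \<omega>"
  shows "(\<lambda>x. \<rho> j (cinv X j x) *\<^sub>R \<omega> j x) integrable_on cimg X j"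
proof -
  have k: "j \<in> idx X" using pou_idx[OF \<rho> j] .
  obtain D where "compact D" "D \<subseteq> cdom X j" "\<And>p. p \<in> pts X \<Longrightarrow> p \<notin> D \<Longrightarrow> \<rho> j p = 0"
    by (rule pou_support[OF \<rho> j]) blast
  then have "(\<lambda>x. \<rho> j (cinv X j x) *\<^sub>R \<omega> j x) absolutely_integrable_on cimg X j"
    using k c pou_continuous[OF \<rho> j k] cinv_in[OF k] cdom_pts[OF k] unfolding chartwise_continuous_def
    by (intro chart_integrable[of j D] continuous_intros) auto
  then show ?thesis by (rule set_lebesgue_integral_eq_integral)
qed

lemma mfd_integral_cong:
  assumes "\<And>i x. i \<in> idx X \<Longrightarrow> x \<in> cimg X i \<Longrightarrow> \<omega> i x = \<omega>' i x"
  shows "mfd_integral X \<omega> = mfd_integral X \<omega>'"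
proof -
  obtain J \<rho> where J: "partition_of_unity X J \<rho>" "\<And>\<omega>. mfd_integral X \<omega> = pou_integral J \<rho> \<omega>"
    using mfd_integral_pou by blast
  show ?thesis
    using assms pou_idx[OF J(1)] unfolding J(2) pou_integral_def
    by (intro sum.cong refl integral_cong) auto
qed

lemma mfd_integral_add:
  assumes c: "chartwise_continuous \<omega>" "chartwise_continuous \<omega>'"
  shows "mfd_integral X (\<lambda>i x. \<omega> i x + \<omega>' i x) = mfd_integral X \<omega> + mfd_integral X \<omega>'"
proof -
  obtain J \<rho> where J: "partition_of_unity X J \<rho>" "\<And>\<omega>. mfd_integral X \<omega> = pou_integral J \<rho> \<omega>"
    using mfd_integral_pou by blast
  show ?thesis
    using pou_integrable[OF J(1)] c unfolding J(2) pou_integral_def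
    by (simp add: scaleR_add_right integral_add sum.distrib)
qed

lemma mfd_integral_scale:
  "mfd_integral X (\<lambda>i x. c * \<omega> i x) = c * mfd_integral X \<omega>"
proof -
  obtain J \<rho> where J: "partition_of_unity X J \<rho>" "\<And>\<omega>. mfd_integral X \<omega> = pou_integral J \<rho> \<omega>"
    using mfd_integral_pou by blast
  show ?thesis unfolding J(2) pou_integral_def
    by (simp add: sum_distrib_left flip: mult_scaleR_right)
qed

lemma mfd_integral_lin:
  assumes "\<And>i x. i \<in> idx X \<Longrightarrow> x \<in> cimg X i \<Longrightarrow> h i x = r *\<^sub>R f i x + g i x"
    and f: "chartwise_continuous f" and g: "chartwise_continuous g"
  shows "mfd_integral X h = r *\<^sub>R mfd_integral X f + mfd_integral X g"
proof -
  have "mfd_integral X h = mfd_integral X (\<lambda>i x. of_real r * f i x + g i x)"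
    by (rule mfd_integral_cong) (simp add: assms(1) scaleR_conv_of_real)
  also have "\<dots> = mfd_integral X (\<lambda>i x. of_real r * f i x) + mfd_integral X g"
    using f g unfolding chartwise_continuous_def
    by (intro mfd_integral_add) (auto simp: chartwise_continuous_def intro!: continuous_intros)
  finally show ?thesis by (simp add: mfd_integral_scale scaleR_conv_of_real)
qed

end

section \<open>Alternating forms and determinants\<close>

text \<open>Arguments are indexed by the coordinates, as rows of a matrix are, so that the
  comparison with \<open>det\<close> needs no enumeration. Values lie in any real vector space since
  both real and complex forms occur.\<close>

definition alternating_top :: "(('d::finite \<Rightarrow> real^'d) \<Rightarrow> 'b::real_vector) \<Rightarrow> bool" where
  "alternating_top f \<longleftrightarrow> (\<forall>v k. linear (\<lambda>y. f (v(k := y)))) \<and>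
     (\<forall>v k l. k \<noteq> l \<longrightarrow> v k = v l \<longrightarrow> f v = 0)"

lemma alternating_top_swap:
  assumes f: "alternating_top f" and kl: "k \<noteq> l"
  shows "f (v(k := y, l := x)) = - f (v(k := x, l := y))"
proof -
  have lin: "linear (\<lambda>y. f (w(m := y)))" for w m using f by (simp add: alternating_top_def)
  have add: "f (w(m := y + z)) = f (w(m := y)) + f (w(m := z))" for w m y z
    using linear_add[OF lin] .
  have zero: "f (v(k := z, l := z)) = 0" for z
    using f kl unfolding alternating_top_def by (metis fun_upd_apply)
  have add': "f (v(k := y + z, l := u)) = f (v(k := y, l := u)) + f (v(k := z, l := u))" for y z u
    using add[of "v(l := u)" k y z] kl by (simp add: fun_upd_twist)
  have "0 = f (v(k := x + y, l := x + y))" by (simp add: zero)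
  also have "\<dots> = f (v(k := x, l := y)) + f (v(k := y, l := x))"
    by (simp add: add add' zero)
  finally show ?thesis by (simp add: eq_neg_iff_add_eq_0 add.commute)
qed

text \<open>Top-degree alternating forms are determined by their value on the standard basis.
  Instead of expanding over permutations, the matrix is built from elementary ones, for each of
  which one defining property of \<open>f\<close> gives the determinant.\<close>

lemma alternating_top_rows:
  fixes A :: "real^'d^'d" and f :: "('d::finite \<Rightarrow> real^'d) \<Rightarrow> 'b::real_vector"
  assumes "alternating_top f"
  shows "f (\<lambda>k. row k A) = det A *\<^sub>R f (\<lambda>k. axis k 1)"
proof -
  \<comment> \<open>The form is quantified inside the induction predicate, because for a product the
    hypothesis on the first factor is applied to a different form.\<close>
  let ?P = "\<lambda>A. \<forall>f :: ('d \<Rightarrow> real^'d) \<Rightarrow> 'b. alternating_top f \<longrightarrow>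
    f (\<lambda>k. row k A) = det A *\<^sub>R f (\<lambda>k. axis k 1)"
  have "?P A"
  proof (rule induct_matrix_elementary[of ?P])
    fix A B :: "real^'d^'d"
    assume A: "?P A" and B: "?P B"
    show "?P (A ** B)"
    proof (intro allI impI)
      fix f :: "('d \<Rightarrow> real^'d) \<Rightarrow> 'b" assume f: "alternating_top f"
      \<comment> \<open>The transpose of \<open>B\<close> sends row k of \<open>A\<close> to row k
        of \<open>A ** B\<close>, and the k-th basis vector to row k of \<open>B\<close>.\<close>
      let ?T = "(*v) (transpose B)"
      let ?g = "\<lambda>v. f (\<lambda>k. ?T (v k))"
      have upd: "(\<lambda>m. ?T ((v(k := y)) m)) = (\<lambda>m. ?T (v m))(k := ?T y)" for v k y by auto
      have "alternating_top ?g"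
        unfolding alternating_top_def upd
      proof (intro conjI allI impI)
        show "linear (\<lambda>y. f ((\<lambda>m. ?T (v m))(k := ?T y)))" for v k
          using f linear_compose[OF matrix_vector_mul_linear[of "transpose B"], of "\<lambda>y. f ((\<lambda>m. ?T (v m))(k := y))"]
          unfolding alternating_top_def by (simp add: comp_def)
        show "f (\<lambda>k. ?T (v k)) = 0" if "k \<noteq> l" "v k = v l" for v :: "'d \<Rightarrow> real^'d" and k l
          using f that unfolding alternating_top_def by metis
      qed
      then have "?g (\<lambda>k. row k A) = det A *\<^sub>R ?g (\<lambda>k. axis k 1)" using A by blast
      moreover have "?T (row k A) = row k (A ** B)" for k
        by (simp add: vec_eq_iff row_def matrix_matrix_mult_def matrix_vector_mult_def transpose_def mult.commute)
      moreover have "?T (axis k 1) = row k B" for k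
        by (simp add: matrix_vector_mul_component vec_eq_iff row_def matrix_vector_mult_basis column_def transpose_def)
      moreover have "f (\<lambda>k. row k B) = det B *\<^sub>R f (\<lambda>k. axis k 1)" using B f by blast
      ultimately show "f (\<lambda>k. row k (A ** B)) = det (A ** B) *\<^sub>R f (\<lambda>k. axis k 1)"
        by (simp add: det_mul)
    qed
  next
    fix A :: "real^'d^'d" and i assume z: "row i A = 0"
    show "?P A"
    proof (intro allI impI)
      fix f :: "('d \<Rightarrow> real^'d) \<Rightarrow> 'b" assume f: "alternating_top f"
      have "f ((\<lambda>k. row k A)(i := 0)) = 0"
        using f linear_0 unfolding alternating_top_def by blast
      then show "f (\<lambda>k. row k A) = det A *\<^sub>R f (\<lambda>k. axis k 1)"
        using z det_zero_row(2)[OF z] by (metis fun_upd_triv scaleR_zero_left)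
    qed
  next
    fix A :: "real^'d^'d" assume d: "\<And>i j. i \<noteq> j \<Longrightarrow> A $ i $ j = 0"
    show "?P A"
    proof (intro allI impI)
      fix f :: "('d \<Rightarrow> real^'d) \<Rightarrow> 'b" assume f: "alternating_top f"
      have r: "row k A = A $ k $ k *\<^sub>R axis k 1" for k
        using d by (auto simp: vec_eq_iff row_def axis_def)
      \<comment> \<open>The diagonal entries are pulled out one argument at a time; the claim is the
        case where \<open>S\<close> consists of all indices.\<close>
      have "f (\<lambda>k. if k \<in> S then A $ k $ k *\<^sub>R axis k 1 else axis k 1) =
          (\<Prod>k\<in>S. A $ k $ k) *\<^sub>R f (\<lambda>k. axis k 1)" if "finite S" for S
        using that
      proof (induction S rule: finite_induct)
        case (insert i S)
        let ?v = "\<lambda>k. if k \<in> S then A $ k $ k *\<^sub>R axis k 1 else (axis k 1 :: real^'d)"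
        have "(\<lambda>k. if k \<in> insert i S then A $ k $ k *\<^sub>R axis k 1 else axis k 1) =
            ?v(i := A $ i $ i *\<^sub>R axis i 1)" by auto
        moreover have "f (?v(i := A $ i $ i *\<^sub>R axis i 1)) = A $ i $ i *\<^sub>R f (?v(i := axis i 1))"
          using f linear_cmul unfolding alternating_top_def by blast
        moreover have "?v(i := axis i 1) = ?v" using insert.hyps by auto
        ultimately have "f (\<lambda>k. if k \<in> insert i S then A $ k $ k *\<^sub>R axis k 1 else axis k 1) = A $ i $ i *\<^sub>R f ?v"
          by (simp only:)
        also have "\<dots> = A $ i $ i *\<^sub>R ((\<Prod>k\<in>S. A $ k $ k) *\<^sub>R f (\<lambda>k. axis k 1))"
          by (simp only: insert.IH)
        finally show ?case using insert.hyps by simp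
      qed simp
      from this[of UNIV] show "f (\<lambda>k. row k A) = det A *\<^sub>R f (\<lambda>k. axis k 1)"
        by (simp add: r det_diagonal[OF d])
    qed
  next
    fix m n :: 'd assume mn: "m \<noteq> n"
    let ?A = "(\<chi> i j. mat 1 $ i $ Transposition.transpose m n j) :: real^'d^'d"
    show "?P ?A"
    proof (intro allI impI)
      fix f :: "('d \<Rightarrow> real^'d) \<Rightarrow> 'b" assume f: "alternating_top f"
      let ?e = "\<lambda>k. axis k 1 :: real^'d"
      have "k = Transposition.transpose m n j \<longleftrightarrow> j = Transposition.transpose m n k" for k j
        by (metis transpose_involutory)
      then have "row k ?A = axis (Transposition.transpose m n k) 1" for k
        by (simp add: vec_eq_iff row_def axis_def mat_def)
      moreover have "axis (Transposition.transpose m n k) 1 = (?e(m := axis n 1, n := axis m 1)) k" for k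
        using mn by (cases "k = n"; cases "k = m") auto
      ultimately have "(\<lambda>k. row k ?A) = ?e(m := axis n 1, n := axis m 1)"
        by (intro ext) simp
      then have "f (\<lambda>k. row k ?A) = - f (?e(m := axis m 1, n := axis n 1))"
        using alternating_top_swap[OF f mn, of ?e "axis n 1" "axis m 1"] by (simp only:)
      moreover have "det ?A = - 1"
        using det_permute_columns[of "Transposition.transpose m n" "mat 1"] mn
        by (simp add: permutes_swap_id sign_swap_id)
      moreover have "?e(m := axis m 1, n := axis n 1) = ?e" by auto
      ultimately show "f (\<lambda>k. row k ?A) = det ?A *\<^sub>R f ?e" by simp
    qed
  next
    fix m n :: 'd and c assume mn: "m \<noteq> n"
    let ?A = "(\<chi> i j. if i = m \<and> j = n then c else of_bool (i = j)) :: real^'d^'d"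
    show "?P ?A"
    proof (intro allI impI)
      fix f :: "('d \<Rightarrow> real^'d) \<Rightarrow> 'b" assume f: "alternating_top f"
      let ?e = "\<lambda>k. axis k 1 :: real^'d"
      have lin: "linear (\<lambda>y. f (?e(m := y)))" using f unfolding alternating_top_def by blast
      have "(\<lambda>k. row k ?A) = ?e(m := axis m 1 + c *\<^sub>R axis n 1)"
      proof
        show "row k ?A = (?e(m := axis m 1 + c *\<^sub>R axis n 1)) k" for k
          using mn by (cases "k = m") (simp_all add: vec_eq_iff row_def axis_def of_bool_def)
      qed
      then have "f (\<lambda>k. row k ?A) = f (?e(m := axis m 1)) + c *\<^sub>R f (?e(m := axis n 1))"
        by (simp only: linear_add[OF lin] linear_cmul[OF lin])
      moreover have "f (?e(m := axis n 1)) = 0"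
      proof -
        have "(?e(m := axis n 1)) m = (?e(m := axis n 1)) n" using mn by simp
        with f mn show ?thesis unfolding alternating_top_def by blast
      qed
      moreover have "det ?A = 1"
      proof -
        have "?A = (\<chi> k. if k = m then row m (mat 1) + c *s row n (mat 1) else row k (mat 1))"
          unfolding vec_eq_iff
        proof (intro allI)
          show "?A $ k $ j = (\<chi> k. if k = m then row m (mat 1) + c *s row n (mat 1) else row k (mat 1)) $ k $ j"
            for k j using mn by (cases "k = m"; cases "j = n") (simp_all add: row_def mat_def)
        qed
        then show ?thesis using det_row_operation[OF mn, of "mat 1" c] by simp
      qed
      moreover have "?e(m := axis m 1) = ?e" by auto
      ultimately show "f (\<lambda>k. row k ?A) = det ?A *\<^sub>R f ?e" by simp
    qed
  qed
  with assms show ?thesis by blast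
qed

lemma alternating_top_det:
  fixes T :: "real^'d \<Rightarrow> real^'d::finite"
  assumes f: "alternating_top f" and T: "linear T"
  shows "f (\<lambda>k. T (axis k 1)) = det (matrix T) *\<^sub>R f (\<lambda>k. axis k 1)"
proof -
  have "row k (transpose (matrix T)) = T (axis k 1)" for k
    by (simp add: vec_eq_iff row_def transpose_def matrix_def)
  with alternating_top_rows[OF f, of "transpose (matrix T)"] show ?thesis by simp
qed

section \<open>Alternating three-forms and their product with a covector\<close>

definition alternating3 :: "('v::real_vector \<Rightarrow> 'v \<Rightarrow> 'v \<Rightarrow> 'b::real_vector) \<Rightarrow> bool" where
  "alternating3 w \<longleftrightarrow> (\<forall>u v. linear (\<lambda>x. w x u v) \<and> linear (\<lambda>x. w u x v) \<and> linear (\<lambda>x. w u v x)) \<and>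
     (\<forall>u v. w u u v = 0 \<and> w u v u = 0 \<and> w v u u = 0)"

lemma alternating3_swap:
  assumes "alternating3 w"
  shows "w v u x = - w u v x" "w u x v = - w u v x" "w x v u = - w u v x"
proof -
  have z: "w u u v = 0" "w u v u = 0" "w v u u = 0" for u v using assms by (auto simp: alternating3_def)
  have l: "linear (\<lambda>x. w x u v)" "linear (\<lambda>x. w u x v)" "linear (\<lambda>x. w u v x)" for u v
    using assms by (auto simp: alternating3_def)
  note a = linear_add[OF l(1)] linear_add[OF l(2)] linear_add[OF l(3)]
  have "w (u + v) (u + v) x = w u v x + w v u x" "w u (v + x) (v + x) = w u v x + w u x v"
    "w (u + x) v (u + x) = w u v x + w x v u"
    by (simp_all only: a) (simp_all add: z)
  then show "w v u x = - w u v x" "w u x v = - w u v x" "w x v u = - w u v x"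
    by (simp_all add: z eq_neg_iff_add_eq_0 add.commute)
qed

lemma alternating3_det:
  fixes w :: "real^3 \<Rightarrow> real^3 \<Rightarrow> real^3 \<Rightarrow> 'b::real_vector"
  assumes w: "alternating3 w" and T: "linear T"
  shows "w (T (axis 1 1)) (T (axis 2 1)) (T (axis 3 1)) =
    det (matrix T) *\<^sub>R w (axis 1 1) (axis 2 1) (axis 3 1)"
proof -
  have "alternating_top (\<lambda>v. w (v 1) (v 2) (v 3))"
    unfolding alternating_top_def
  proof (intro conjI allI impI)
    show "linear (\<lambda>y. w ((v(k := y)) 1) ((v(k := y)) 2) ((v(k := y)) 3))" for v :: "3 \<Rightarrow> real^3" and k
      using w exhaust_3[of k] by (auto simp: alternating3_def)
    show "w (v 1) (v 2) (v 3) = 0" if "k \<noteq> l" "v k = v l" for v :: "3 \<Rightarrow> real^3" and k l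
      using w that exhaust_3[of k] exhaust_3[of l] by (auto simp: alternating3_def)
  qed
  from alternating_top_det[OF this T] show ?thesis .
qed

text \<open>For alternating \<open>w\<close> this is the wedge product of the covector
  \<open>L\<close> with \<open>w\<close>, written as the sum over the (1,3)-shuffles.\<close>

definition wedge13 :: "('v \<Rightarrow> real) \<Rightarrow> ('v \<Rightarrow> 'v \<Rightarrow> 'v \<Rightarrow> 'b::real_vector) \<Rightarrow> 'v \<Rightarrow> 'v \<Rightarrow> 'v \<Rightarrow> 'v \<Rightarrow> 'b" where
  "wedge13 L w a b c d = L a *\<^sub>R w b c d - L b *\<^sub>R w a c d + L c *\<^sub>R w a b d - L d *\<^sub>R w a b c"

text \<open>Used twice: with \<open>L\<close> the differential of a partition function it makes
  these products top densities in Stokes' theorem, and with \<open>L\<close> the first coordinate it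
  splits the Jacobian at the boundary.\<close>

lemma wedge13_det:
  fixes w :: "real^4 \<Rightarrow> real^4 \<Rightarrow> real^4 \<Rightarrow> 'b::real_vector"
  assumes w: "alternating3 w" and L: "linear L" and T: "linear T"
  shows "wedge13 L w (T (axis 1 1)) (T (axis 2 1)) (T (axis 3 1)) (T (axis 4 1)) =
    det (matrix T) *\<^sub>R wedge13 L w (axis 1 1) (axis 2 1) (axis 3 1) (axis 4 1)"
proof -
  have l: "linear (\<lambda>x. w x u v)" "linear (\<lambda>x. w u x v)" "linear (\<lambda>x. w u v x)" for u v
    using w by (auto simp: alternating3_def)
  have z: "w u u v = 0" "w u v u = 0" "w v u u = 0" for u v using w by (auto simp: alternating3_def)
  have "alternating_top (\<lambda>v. wedge13 L w (v 1) (v 2) (v 3) (v 4))"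
    unfolding alternating_top_def
  proof (intro conjI allI impI)
    fix v :: "4 \<Rightarrow> real^4" and k
    have "linear (\<lambda>y. wedge13 L w y b c d)" "linear (\<lambda>y. wedge13 L w b y c d)"
         "linear (\<lambda>y. wedge13 L w b c y d)" "linear (\<lambda>y. wedge13 L w b c d y)" for b c d
      unfolding wedge13_def
      by (rule linearI; simp add: linear_add[OF L] linear_cmul[OF L] linear_add[OF l(1)] linear_add[OF l(2)]
          linear_add[OF l(3)] linear_cmul[OF l(1)] linear_cmul[OF l(2)] linear_cmul[OF l(3)] algebra_simps)+
    then show "linear (\<lambda>y. wedge13 L w ((v(k := y)) 1) ((v(k := y)) 2) ((v(k := y)) 3) ((v(k := y)) 4))"
      using exhaust_4[of k] by auto
  next
    fix v :: "4 \<Rightarrow> real^4" and k l assume kl: "k \<noteq> l" "v k = v l"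
    note s = alternating3_swap[OF w]
    have "wedge13 L w a a c d = 0" "wedge13 L w b c c d = 0" "wedge13 L w a b c c = 0" for a b c d
      by (simp_all add: wedge13_def z)
    \<comment> \<open>For repeated arguments that are not adjacent, two terms survive; they differ
      by a transposition inside \<open>w\<close> and cancel.\<close>
    moreover have "wedge13 L w a b a d = 0" for a b d using s(1)[of b a d] by (simp add: wedge13_def z)
    moreover have "wedge13 L w b a d a = 0" for a b d using s(2)[of b a d] by (simp add: wedge13_def z)
    moreover have "wedge13 L w a b d a = 0" for a b d
      using s(1)[of a b d] s(2)[of b a d] by (simp add: wedge13_def z)
    ultimately show "wedge13 L w (v 1) (v 2) (v 3) (v 4) = 0"
      using kl exhaust_4[of k] exhaust_4[of l] by auto
  qed
  from alternating_top_det[OF this T] show ?thesis .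
qed

section \<open>The boundary manifold\<close>

lemma vector_4 [simp]:
  "(vector [x, y, z, w] :: 'a::zero^4) $ 1 = x"
  "(vector [x, y, z, w] :: 'a::zero^4) $ 2 = y"
  "(vector [x, y, z, w] :: 'a::zero^4) $ 3 = z"
  "(vector [x, y, z, w] :: 'a::zero^4) $ 4 = w"
  unfolding vector_def by simp_all

lemma bdry_incl_nth [simp]:
  "bdry_incl y $ 1 = 0" "bdry_incl y $ 2 = y $ 1" "bdry_incl y $ 3 = y $ 2" "bdry_incl y $ 4 = y $ 3"
  by (simp_all add: bdry_incl_def)

lemma bdry_proj_nth [simp]:
  "bdry_proj x $ 1 = x $ 2" "bdry_proj x $ 2 = x $ 3" "bdry_proj x $ 3 = x $ 4"
  by (simp_all add: bdry_proj_def vector_3)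

lemma bdry_proj_incl [simp]: "bdry_proj (bdry_incl y) = y"
  by (simp add: vec_eq_iff forall_3)

lemma bdry_incl_proj: "x $ 1 = 0 \<Longrightarrow> bdry_incl (bdry_proj x) = x"
  by (simp add: vec_eq_iff forall_4)

lemma linear_bdry_incl: "linear bdry_incl"
  by (rule linearI) (simp_all add: vec_eq_iff forall_4)

lemma linear_bdry_proj: "linear bdry_proj"
  by (rule linearI) (simp_all add: vec_eq_iff forall_3)

lemma bounded_linear_bdry_incl: "bounded_linear bdry_incl"
  using linear_bdry_incl by (simp add: linear_conv_bounded_linear)

lemma bounded_linear_bdry_proj: "bounded_linear bdry_proj"
  using linear_bdry_proj by (simp add: linear_conv_bounded_linear)

lemma bdry_incl_half_space [simp]: "bdry_incl y \<in> half_space"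
  by (simp add: half_space_def)

lemma bdry_incl_axis:
  "bdry_incl (axis 1 1) = axis 2 1" "bdry_incl (axis 2 1) = axis 3 1" "bdry_incl (axis 3 1) = axis 4 1"
  by (simp_all add: vec_eq_iff forall_4 axis_def)

lemma bdry_simps [simp]:
  "pts (bdry X) = bdry_pts X" "idx (bdry X) = idx X" "cdom (bdry X) i = cdom X i \<inter> bdry_pts X"
  "chart (bdry X) i p = bdry_proj (chart X i p)"
  by (simp_all add: bdry_def)

locale manifold4 = compact_manifold half_space X for X :: "('x::t2_space, 'i, 4) mfd"
begin

lemma cimg_half_space: "i \<in> idx X \<Longrightarrow> cimg X i \<subseteq> half_space"
  using cimg_openin openin_imp_subset by blast

text \<open>
  Invariance of the boundary: otherwise the first coordinate of the transition map has an interior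
  maximum, and its derivative is singular.
\<close>

lemma transition_interior_to_boundary:
  assumes i: "i \<in> idx X" and j: "j \<in> idx X" and x: "x \<in> overlap X i j"
    and x0: "x $ 1 \<noteq> 0" and T0: "transition X i j x $ 1 = 0"
  shows False
proof -
  have le: "transition X i j y $ 1 \<le> 0" if "y \<in> overlap X i j" for y
    using transition_in[OF i j that] overlap_sub[OF j, of i] cimg_half_space[OF j] by (auto simp: half_space_def)
  obtain U where U: "open U" "overlap X i j = half_space \<inter> U"
    using overlap_openin[OF i j] by (auto simp: openin_open)
  \<comment> \<open>Dropping the hyperplane makes this set open in the full space, so that the
    criterion for interior extrema is available at x.\<close>
  define V where "V = U \<inter> {y. y $ 1 < 0}"
  have "open {y :: real^4. y $ 1 < 0}" by (intro open_Collect_less continuous_intros)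
  then have V: "open V" "V \<subseteq> overlap X i j"
    unfolding U(2) V_def half_space_def using U(1) by (blast intro: open_Int, auto)
  have "x \<in> V" using x x0 U by (auto simp: V_def half_space_def)
  then obtain e where e: "e > 0" "ball x e \<subseteq> V" using V openE by blast
  have at: "at x within overlap X i j = at x"
    by (rule at_within_interior) (use \<open>x \<in> V\<close> V in \<open>auto simp: interior_def\<close>)
  have der: "(transition X i j has_derivative dtransition X i j x) (at x)"
    using transition_deriv[OF i j x] by (simp add: at)
  then have "frechet_derivative (transition X i j) (at x) = dtransition X i j x"
    using frechet_derivative_at by metis
  moreover have "jacobian (transition X i j) (at x) $ 1 = 0"
  proof (rule differential_zero_maxmin_cart[OF e(1)])
    show "(\<forall>y\<in>ball x e. transition X i j y $ 1 \<le> transition X i j x $ 1) \<or>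
          (\<forall>y\<in>ball x e. transition X i j x $ 1 \<le> transition X i j y $ 1)"
      using le e(2) V(2) T0 by auto
    show "transition X i j differentiable at x" using der differentiableI by blast
  qed
  ultimately have "row 1 (matrix (dtransition X i j x)) = 0"
    by (simp add: jacobian_def row_def vec_eq_iff)
  then have "det (matrix (dtransition X i j x)) = 0" by (rule det_zero_row)
  then show False using det_pos[OF i j x] by simp
qed

text \<open>The definition of a boundary point asks for one suitable chart; by invariance of the
  boundary all charts around the point agree.\<close>

lemma bdry_pts_iff:
  assumes i: "i \<in> idx X" and p: "p \<in> cdom X i"
  shows "p \<in> bdry_pts X \<longleftrightarrow> chart X i p $ 1 = 0"
proof
  assume "p \<in> bdry_pts X"
  then obtain j where j: "j \<in> idx X" "p \<in> cdom X j" "chart X j p $ 1 = 0" by (auto simp: bdry_pts_def)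
  let ?x = "chart X i p"
  have "?x \<in> overlap X i j" using p j by (auto simp: overlap_def)
  moreover have "transition X i j ?x = chart X j p" using cinv_chart[OF i p] by (simp add: transition_def)
  ultimately show "?x $ 1 = 0" using transition_interior_to_boundary[OF i j(1)] j(3) by metis
qed (use assms in \<open>auto simp: bdry_pts_def\<close>)

lemma bdry_pts_sub: "bdry_pts X \<subseteq> pts X"
  using cdom_pts by (auto simp: bdry_pts_def)

lemma cimg_bdry: "i \<in> idx X \<Longrightarrow> cimg (bdry X) i = {y. bdry_incl y \<in> cimg X i}"
proof
  assume i: "i \<in> idx X"
  show "cimg (bdry X) i \<subseteq> {y. bdry_incl y \<in> cimg X i}"
  proof
    fix y assume "y \<in> cimg (bdry X) i"
    then obtain p where p: "p \<in> cdom X i" "p \<in> bdry_pts X" "y = bdry_proj (chart X i p)"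
      by (auto simp: cimg_def)
    then show "y \<in> {y. bdry_incl y \<in> cimg X i}"
      using bdry_pts_iff[OF i p(1)] chart_in[OF p(1)] by (simp add: bdry_incl_proj)
  qed
  show "{y. bdry_incl y \<in> cimg X i} \<subseteq> cimg (bdry X) i"
  proof
    fix y assume "y \<in> {y. bdry_incl y \<in> cimg X i}"
    then have y: "bdry_incl y \<in> cimg X i" by simp
    let ?p = "cinv X i (bdry_incl y)"
    have p: "?p \<in> cdom X i" "chart X i ?p = bdry_incl y" using cinv_in[OF i y] chart_cinv[OF i y] by auto
    then have "?p \<in> bdry_pts X" using bdry_pts_iff[OF i p(1)] by simp
    then show "y \<in> cimg (bdry X) i" using p unfolding cimg_def by (auto intro!: image_eqI[of _ _ ?p])
  qed
qed

text \<open>The inverse of a boundary chart is an \<open>inv_into\<close>, so injectivity is the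
  point: the forgotten first coordinate is 0 on the boundary, and projecting loses nothing.\<close>

lemma cinv_bdry:
  assumes i: "i \<in> idx X" and y: "y \<in> cimg (bdry X) i"
  shows "cinv (bdry X) i y = cinv X i (bdry_incl y)"
proof -
  have y': "bdry_incl y \<in> cimg X i" using y cimg_bdry[OF i] by auto
  let ?p = "cinv X i (bdry_incl y)"
  have p: "?p \<in> cdom X i" "chart X i ?p = bdry_incl y" using cinv_in[OF i y'] chart_cinv[OF i y'] by auto
  have pb: "?p \<in> bdry_pts X" using bdry_pts_iff[OF i p(1)] p by simp
  have inj: "inj_on (chart (bdry X) i) (cdom (bdry X) i)"
  proof (rule inj_onI)
    fix q r assume q: "q \<in> cdom (bdry X) i" and r: "r \<in> cdom (bdry X) i"
      and eq: "chart (bdry X) i q = chart (bdry X) i r"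
    have qr: "q \<in> cdom X i" "q \<in> bdry_pts X" "r \<in> cdom X i" "r \<in> bdry_pts X" using q r by auto
    have "chart X i q = bdry_incl (bdry_proj (chart X i q))"
      using bdry_incl_proj bdry_pts_iff[OF i qr(1)] qr(2) by simp
    also have "bdry_proj (chart X i q) = bdry_proj (chart X i r)" using eq by simp
    also have "bdry_incl \<dots> = chart X i r"
      using bdry_incl_proj bdry_pts_iff[OF i qr(3)] qr(4) by simp
    finally have "cinv X i (chart X i q) = cinv X i (chart X i r)" by simp
    then show "q = r" using cinv_chart[OF i] qr by simp
  qed
  show ?thesis unfolding cinv_def[of "bdry X"]
    by (rule inv_into_f_eq[OF inj]) (use p pb in auto)
qed

lemma overlap_bdry:
  assumes i: "i \<in> idx X" and j: "j \<in> idx X"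
  shows "overlap (bdry X) i j = {y. bdry_incl y \<in> overlap X i j}"
proof (intro set_eqI iffI)
  fix y assume "y \<in> overlap (bdry X) i j"
  then obtain p where p: "p \<in> cdom X i" "p \<in> cdom X j" "p \<in> bdry_pts X" "y = bdry_proj (chart X i p)"
    by (auto simp: overlap_def)
  then have "bdry_incl y = chart X i p" using bdry_pts_iff[OF i p(1)] by (simp add: bdry_incl_proj)
  then show "y \<in> {y. bdry_incl y \<in> overlap X i j}" using p by (auto simp: overlap_def)
next
  fix y assume "y \<in> {y. bdry_incl y \<in> overlap X i j}"
  then have "bdry_incl y \<in> overlap X i j" by simp
  then obtain p where p: "p \<in> cdom X i" "p \<in> cdom X j" "bdry_incl y = chart X i p" 
    unfolding overlap_def by blast
  moreover have "p \<in> bdry_pts X" using bdry_pts_iff[OF i p(1)] p(3) by (metis bdry_incl_nth(1))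
  moreover have "y = bdry_proj (chart X i p)" using p(3) by (metis bdry_proj_incl)
  ultimately show "y \<in> overlap (bdry X) i j" by (auto simp: overlap_def)
qed

lemma transition_bdry:
  assumes i: "i \<in> idx X" and j: "j \<in> idx X" and y: "y \<in> overlap (bdry X) i j"
  shows "transition (bdry X) i j y = bdry_proj (transition X i j (bdry_incl y))"
    and "bdry_incl (transition (bdry X) i j y) = transition X i j (bdry_incl y)"
proof -
  have y': "bdry_incl y \<in> overlap X i j" using y overlap_bdry[OF i j] by simp
  then have "y \<in> cimg (bdry X) i" using cimg_bdry[OF i] overlap_sub[OF i, of j] by auto
  then show eq: "transition (bdry X) i j y = bdry_proj (transition X i j (bdry_incl y))"
    using cinv_bdry[OF i] by (simp add: transition_def)
  have "transition X i j (bdry_incl y) $ 1 = 0"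
  \<comment> \<open>Otherwise the reverse transition would carry an interior point to a boundary
    point.\<close>
  proof (rule ccontr)
    assume "transition X i j (bdry_incl y) $ 1 \<noteq> 0"
    moreover have "transition X j i (transition X i j (bdry_incl y)) $ 1 = 0"
      using transition_transition[OF i j y'] by simp
    ultimately show False
      using transition_interior_to_boundary[OF j i transition_in[OF i j y']] by blast
  qed
  then show "bdry_incl (transition (bdry X) i j y) = transition X i j (bdry_incl y)"
    unfolding eq by (rule bdry_incl_proj)
qed

lemma open_bdry_incl_vimage:
  assumes "openin (top_of_set half_space) V"
  shows "open {y. bdry_incl y \<in> V}"
proof -
  obtain T where T: "open T" "V = half_space \<inter> T" using assms by (auto simp: openin_open)
  have "open (bdry_incl -` T)"
    using T(1) linear_continuous_on[OF bounded_linear_bdry_incl] by (rule open_vimage)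
  moreover have "bdry_incl -` T = {y. bdry_incl y \<in> V}" using T by auto
  ultimately show ?thesis by simp
qed

lemma overlap_bdry_open: "i \<in> idx X \<Longrightarrow> j \<in> idx X \<Longrightarrow> open (overlap (bdry X) i j)"
  using open_bdry_incl_vimage[OF overlap_openin] overlap_bdry by simp

text \<open>On the slice x_1 = 0 the first coordinate of the transition is constantly 0.
  Differentiating this along the slice gives the third claim: vectors tangent to the boundary stay
  tangent to it.\<close>

lemma transition_bdry_deriv:
  assumes i: "i \<in> idx X" and j: "j \<in> idx X" and y: "y \<in> overlap (bdry X) i j"
  defines "D \<equiv> dtransition X i j (bdry_incl y)"
  shows "(transition (bdry X) i j has_derivative (\<lambda>v. bdry_proj (D (bdry_incl v)))) (at y within overlap (bdry X) i j)"
    and "dtransition (bdry X) i j y = (\<lambda>v. bdry_proj (D (bdry_incl v)))"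
    and "D (bdry_incl v) $ 1 = 0"
proof -
  let ?O = "overlap (bdry X) i j"
  have y': "bdry_incl y \<in> overlap X i j" using y overlap_bdry[OF i j] by simp
  have acc: "axis_accessible ?O"
    using model_space_openin_accessible[OF model_space_UNIV] overlap_bdry_open[OF i j] by simp
  have "(transition X i j has_derivative D) (at (bdry_incl y) within bdry_incl ` ?O)"
    unfolding D_def using overlap_bdry[OF i j] by (intro has_derivative_subset[OF transition_deriv[OF i j y']]) auto
  then have d: "((\<lambda>y. transition X i j (bdry_incl y)) has_derivative (\<lambda>v. D (bdry_incl v))) (at y within ?O)"
    using has_derivative_in_compose[OF bounded_linear_imp_has_derivative[OF bounded_linear_bdry_incl]] by blast
  have "((\<lambda>y. bdry_proj (transition X i j (bdry_incl y))) has_derivative (\<lambda>v. bdry_proj (D (bdry_incl v)))) (at y within ?O)"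
    using bounded_linear.has_derivative[OF bounded_linear_bdry_proj d] .
  then show dB: "(transition (bdry X) i j has_derivative (\<lambda>v. bdry_proj (D (bdry_incl v)))) (at y within ?O)"
    by (rule has_derivative_transform[rotated 2]) (use y transition_bdry(1)[OF i j] in auto)
  show "dtransition (bdry X) i j y = (\<lambda>v. bdry_proj (D (bdry_incl v)))"
    unfolding dtransition_def using frechet_derivative_eqI[OF acc y dB] .
  have "((\<lambda>y. transition X i j (bdry_incl y) $ 1) has_derivative (\<lambda>v. D (bdry_incl v) $ 1)) (at y within ?O)"
    using bounded_linear.has_derivative[OF bounded_linear_vec_nth d] .
  then have "((\<lambda>y. 0) has_derivative (\<lambda>v. D (bdry_incl v) $ 1)) (at y within ?O)"
    by (rule has_derivative_transform[rotated 2]) (use y transition_bdry(2)[OF i j] in \<open>auto simp flip: transition_bdry(2)[OF i j]\<close>)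
  then have "(\<lambda>v. D (bdry_incl v) $ 1) = (\<lambda>v. 0)"
    using has_derivative_within_unique[OF acc y _ has_derivative_const] by blast
  then show "D (bdry_incl v) $ 1 = 0" by metis
qed

text \<open>At a boundary point the first row of the Jacobian is zero except for its first entry, so
  its determinant is that entry times the boundary determinant. The entry is not negative because
  the half-space is mapped into itself; positivity of the product then makes both factors
  positive.\<close>

lemma det_bdry_pos:
  assumes i: "i \<in> idx X" and j: "j \<in> idx X" and y: "y \<in> overlap (bdry X) i j"
  shows "det (matrix (dtransition (bdry X) i j y)) > 0"
proof -
  let ?x = "bdry_incl y"
  define D where "D = dtransition X i j ?x"
  let ?B = "\<lambda>v. bdry_proj (D (bdry_incl v))"
  have x: "?x \<in> overlap X i j" using y overlap_bdry[OF i j] by simp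
  have lin: "linear D" unfolding D_def by (rule dtransition_linear[OF i j x])
  \<comment> \<open>The determinant of the boundary components. Its product with the first
    coordinate is the volume form, so \<open>wedge13_det\<close> performs the block
    expansion.\<close>
  define w where "w u v z = det (vector [bdry_proj u, bdry_proj v, bdry_proj z] :: real^3^3)" for u v z :: "real^4"
  have w: "alternating3 w"
    unfolding alternating3_def w_def det_3 vector_3 bdry_proj_nth
    by (intro conjI allI linearI) (simp_all add: algebra_simps)
  have L: "linear (\<lambda>v::real^4. v $ 1)" by (rule linearI) auto
  have D0: "D (axis 2 1) $ 1 = 0" "D (axis 3 1) $ 1 = 0" "D (axis 4 1) $ 1 = 0"
    using transition_bdry_deriv(3)[OF i j y] unfolding D_def by (metis bdry_incl_axis)+
  have "wedge13 (\<lambda>v. v $ 1) w (axis 1 1) (axis 2 1) (axis 3 1) (axis 4 1) = 1"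
    by (simp add: wedge13_def w_def det_3 vector_3 axis_def)
  then have "det (matrix D) = D (axis 1 1) $ 1 * w (D (axis 2 1)) (D (axis 3 1)) (D (axis 4 1))"
    using wedge13_det[OF w L lin] D0 by (simp add: wedge13_def)
  also have "w (D (axis 2 1)) (D (axis 3 1)) (D (axis 4 1)) = det (transpose (matrix ?B))"
    unfolding w_def det_3 vector_3 by (simp add: transpose_def matrix_def bdry_incl_axis)
  finally have det: "det (matrix D) = D (axis 1 1) $ 1 * det (matrix ?B)" by simp
  \<comment> \<open>With a negative entry, a small step from the boundary into the interior, along
    \<open>- axis 1 1\<close>, would raise the first coordinate of the image above 0.\<close>
  have "D (axis 1 1) $ 1 \<ge> 0"
  proof (rule ccontr)
    assume neg: "\<not> D (axis 1 1) $ 1 \<ge> 0"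
    let ?c = "\<lambda>t::real. ?x + t *\<^sub>R axis 1 1"
    let ?S = "{t. ?c t \<in> overlap X i j}"
    have "(?c has_derivative (\<lambda>t. t *\<^sub>R axis 1 1)) (at 0 within ?S)"
      by (auto intro!: derivative_eq_intros)
    moreover have "(transition X i j has_derivative D) (at (?c 0) within ?c ` ?S)"
      unfolding D_def using transition_deriv[OF i j x] by (auto intro: has_derivative_subset)
    ultimately have "((\<lambda>t. transition X i j (?c t)) has_derivative (\<lambda>t. D (t *\<^sub>R axis 1 1))) (at 0 within ?S)"
      by (rule has_derivative_in_compose)
    from bounded_linear.has_derivative[OF bounded_linear_vec_nth this]
    have "((\<lambda>t. transition X i j (?c t) $ 1) has_derivative (\<lambda>t. D (axis 1 1) $ 1 * t)) (at 0 within ?S)"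
      by (simp add: linear_cmul[OF lin] mult.commute)
    then have "((\<lambda>t. transition X i j (?c t) $ 1) has_real_derivative D (axis 1 1) $ 1) (at 0 within ?S)"
      by (simp add: has_field_derivative_def)
    from has_real_derivative_neg_dec_left[OF this] neg
    obtain d where d: "d > 0" "\<And>h. 0 < h \<Longrightarrow> - h \<in> ?S \<Longrightarrow> h < d \<Longrightarrow>
        transition X i j ?x $ 1 < transition X i j (?c (- h)) $ 1"
      by auto
    obtain T where T: "open T" "overlap X i j = half_space \<inter> T"
      using overlap_openin[OF i j] by (auto simp: openin_open)
    then obtain e where e: "e > 0" "ball ?x e \<subseteq> T" using x openE by blast
    let ?h = "min d e / 2"
    have h: "0 < ?h" "?h < d" using d e by auto
    have "?c (- ?h) \<in> ball ?x e" using d e by (simp add: dist_norm)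
    moreover have "?c (- ?h) \<in> half_space" using h by (simp add: half_space_def axis_def)
    ultimately have S: "- ?h \<in> ?S" using e T by auto
    have "transition X i j ?x $ 1 = 0" using transition_bdry(2)[OF i j y] by (metis bdry_incl_nth(1))
    then have "0 < transition X i j (?c (- ?h)) $ 1" using d(2)[OF h(1) S h(2)] by simp
    moreover have "transition X i j (?c (- ?h)) \<in> half_space"
      using transition_in[OF i j] S overlap_sub[OF j, of i] cimg_half_space[OF j] by blast
    ultimately show False by (simp add: half_space_def)
  qed
  moreover have "D (axis 1 1) $ 1 * det (matrix ?B) > 0" using det det_pos[OF i j x] by (simp add: D_def)
  ultimately have "det (matrix ?B) > 0" by (simp add: zero_less_mult_iff)
  then show ?thesis using transition_bdry_deriv(2)[OF i j y] by (simp add: D_def)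
qed

lemma oriented_manifold_bdry: "oriented_manifold UNIV (bdry X)"
  unfolding oriented_manifold_def
proof (intro conjI ballI)
  show "pts (bdry X) = (\<Union>i\<in>idx (bdry X). cdom (bdry X) i)"
    using pts_eq bdry_pts_sub by auto
next
  fix i assume "i \<in> idx (bdry X)"
  then have i: "i \<in> idx X" by simp
  obtain T where T: "open T" "cdom X i = pts X \<inter> T" using cdom_openin[OF i] by (auto simp: openin_open)
  then have "cdom (bdry X) i = pts (bdry X) \<inter> T" using bdry_pts_sub by auto
  with T show "openin (top_of_set (pts (bdry X))) (cdom (bdry X) i)" by (auto simp: openin_open)
  show "openin (top_of_set UNIV) (cimg (bdry X) i)"
    using open_bdry_incl_vimage[OF cimg_openin[OF i]] cimg_bdry[OF i] by simp
  have cc: "continuous_on (cdom X i) (chart X i)" and ci: "continuous_on (cimg X i) (cinv X i)"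
    using chart_homeo[OF i] by (auto simp: homeomorphism_def)
  have c1: "continuous_on (cdom (bdry X) i) (chart (bdry X) i)"
  proof -
    have "continuous_on (cdom X i \<inter> bdry_pts X) (\<lambda>p. bdry_proj (chart X i p))"
      by (rule continuous_on_subset[OF bounded_linear.continuous_on[OF bounded_linear_bdry_proj cc]]) auto
    then show ?thesis by (subst continuous_on_cong[OF refl bdry_simps(4)]) simp
  qed
  have "continuous_on (cimg (bdry X) i) (\<lambda>y. cinv X i (bdry_incl y))"
    by (rule continuous_on_compose2[OF ci linear_continuous_on[OF bounded_linear_bdry_incl]])
       (use cimg_bdry[OF i] in auto)
  then have c2: "continuous_on (cimg (bdry X) i) (cinv (bdry X) i)"
    by (subst continuous_on_cong[OF refl cinv_bdry[OF i]])
  have inv1: "cinv (bdry X) i (chart (bdry X) i p) = p" if "p \<in> cdom (bdry X) i" for p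
  proof -
    have p: "p \<in> cdom X i" "p \<in> bdry_pts X" using that by auto
    have "chart (bdry X) i p \<in> cimg (bdry X) i" using that by (simp add: cimg_def)
    then have "cinv (bdry X) i (chart (bdry X) i p) = cinv X i (bdry_incl (bdry_proj (chart X i p)))"
      using cinv_bdry[OF i] by simp
    also have "\<dots> = p" using p bdry_pts_iff[OF i p(1)] cinv_chart[OF i p(1)] by (simp add: bdry_incl_proj)
    finally show ?thesis .
  qed
  have "chart (bdry X) i ` cdom (bdry X) i = cimg (bdry X) i" by (simp add: cimg_def)
  with c1 c2 inv1 show "homeomorphism (cdom (bdry X) i) (cimg (bdry X) i) (chart (bdry X) i) (cinv (bdry X) i)"
    by (intro homeomorphismI) (auto simp: cimg_def)
next
  fix i j assume "i \<in> idx (bdry X)" "j \<in> idx (bdry X)"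
  then have i: "i \<in> idx X" and j: "j \<in> idx X" by simp_all
  show "smooth (overlap (bdry X) i j) (transition (bdry X) i j)"
    unfolding smooth_def
  proof
    fix k
    have T: "Ck k (overlap X i j) (transition X i j)" using transition_smooth[OF i j] by (simp add: smooth_def)
    have incl: "Ck k (overlap (bdry X) i j) bdry_incl" by (rule Ck_linear[OF bounded_linear_bdry_incl])
    have "Ck k (overlap (bdry X) i j) (\<lambda>y. transition X i j (bdry_incl y))"
      by (rule Ck_compose[OF T incl]) (use overlap_bdry[OF i j] in auto)
    then have "Ck k (overlap (bdry X) i j) (\<lambda>y. bdry_proj (transition X i j (bdry_incl y)))"
      by (rule Ck_compose[OF Ck_linear[OF bounded_linear_bdry_proj, of k UNIV]]) simp
    then show "Ck k (overlap (bdry X) i j) (transition (bdry X) i j)"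
      by (subst Ck_cong[OF transition_bdry(1)[OF i j]])
  qed
  show "det (matrix (dtransition (bdry X) i j y)) > 0" if "y \<in> overlap (bdry X) i j" for y
    using det_bdry_pos[OF i j that] .
qed

lemma compact_bdry_pts: "compact (bdry_pts X)"
proof -
  have "closedin (top_of_set (pts X)) (bdry_pts X)"
  proof -
    have "openin (top_of_set (pts X)) (\<Union>i\<in>idx X. {p \<in> cdom X i. chart X i p $ 1 \<noteq> 0})"
    proof (intro openin_Union ballI; clarify)
      fix i assume i: "i \<in> idx X"
      have "continuous_on (cdom X i) (chart X i)" using chart_homeo[OF i] by (simp add: homeomorphism_def)
      then have "openin (top_of_set (cdom X i)) (cdom X i \<inter> (\<lambda>p. chart X i p $ 1) -` (- {0}))"
        by (intro continuous_openin_preimage_gen continuous_intros) auto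
      moreover have "cdom X i \<inter> (\<lambda>p. chart X i p $ 1) -` (- {0}) = {p \<in> cdom X i. chart X i p $ 1 \<noteq> 0}" by auto
      ultimately have "openin (top_of_set (cdom X i)) {p \<in> cdom X i. chart X i p $ 1 \<noteq> 0}" by simp
      then show "openin (top_of_set (pts X)) {p \<in> cdom X i. chart X i p $ 1 \<noteq> 0}"
        using cdom_openin[OF i] by (rule openin_trans)
    qed
    moreover have "(\<Union>i\<in>idx X. {p \<in> cdom X i. chart X i p $ 1 \<noteq> 0}) = pts X - bdry_pts X"
    proof (intro set_eqI iffI)
      show "p \<in> pts X - bdry_pts X" if "p \<in> (\<Union>i\<in>idx X. {p \<in> cdom X i. chart X i p $ 1 \<noteq> 0})" for p
        using that bdry_pts_iff cdom_pts by auto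
      show "p \<in> (\<Union>i\<in>idx X. {p \<in> cdom X i. chart X i p $ 1 \<noteq> 0})" if "p \<in> pts X - bdry_pts X" for p
        using that bdry_pts_iff pts_eq by auto
    qed
    ultimately show ?thesis using bdry_pts_sub by (simp add: closedin_def)
  qed
  then show ?thesis using cpt closedin_compact by blast
qed

lemma compact_manifold_bdry: "compact_manifold UNIV (bdry X)"
  by unfold_locales (simp_all add: model_space_UNIV oriented_manifold_bdry compact_bdry_pts)

end

section \<open>Stokes' theorem\<close>

text \<open>A linear map that matches the two bases pulls boxes back to boxes with the same side
  lengths, and boxes determine Lebesgue measure. Domain and codomain may be different types, here a
  product and \<open>real^4\<close>.\<close>

lemma lborel_distr_Basis:
  fixes \<phi> :: "'a::euclidean_space \<Rightarrow> 'b::euclidean_space"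
  assumes lin: "linear \<phi>" and bij: "bij_betw \<phi> Basis Basis"
  shows "distr lborel borel \<phi> = lborel"
proof (rule lborel_eqI[symmetric])
  have meas: "\<phi> \<in> borel_measurable borel"
    using lin by (intro borel_measurable_continuous_onI linear_continuous_on) (simp add: linear_conv_bounded_linear)
  have inner: "\<phi> x \<bullet> \<phi> b = x \<bullet> b" if b: "b \<in> Basis" for x b
  proof -
    have "\<phi> x = \<phi> (\<Sum>c\<in>Basis. (x \<bullet> c) *\<^sub>R c)" by (simp add: euclidean_representation)
    also have "\<dots> = (\<Sum>c\<in>Basis. (x \<bullet> c) *\<^sub>R \<phi> c)" by (simp add: linear_sum[OF lin] linear_cmul[OF lin])
    finally have "\<phi> x \<bullet> \<phi> b = (\<Sum>c\<in>Basis. (x \<bullet> c) * (\<phi> c \<bullet> \<phi> b))" by (simp add: inner_sum_left)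
    also have "\<dots> = (\<Sum>c\<in>Basis. if c = b then x \<bullet> c else 0)"
    proof (rule sum.cong[OF refl])
      fix c :: 'a assume c: "c \<in> Basis"
      have "\<phi> c \<in> Basis" "\<phi> b \<in> Basis" "\<phi> c = \<phi> b \<longleftrightarrow> c = b"
        using bij b c by (auto simp: bij_betw_def inj_on_def)
      then show "x \<bullet> c * (\<phi> c \<bullet> \<phi> b) = (if c = b then x \<bullet> c else 0)" by (simp add: inner_Basis)
    qed
    finally show ?thesis using b by simp
  qed
  fix l u :: 'b assume lu: "\<And>b. b \<in> Basis \<Longrightarrow> l \<bullet> b \<le> u \<bullet> b"
  define l' where "l' = (\<Sum>b\<in>Basis. (l \<bullet> \<phi> b) *\<^sub>R b)"
  define u' where "u' = (\<Sum>b\<in>Basis. (u \<bullet> \<phi> b) *\<^sub>R b)"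
  have lu': "l' \<bullet> b = l \<bullet> \<phi> b" "u' \<bullet> b = u \<bullet> \<phi> b" if "b \<in> Basis" for b
    using that by (simp_all add: l'_def u'_def)
  have "\<phi> -` box l u = box l' u'"
  proof -
    have "\<phi> x \<in> box l u \<longleftrightarrow> (\<forall>b\<in>Basis. l \<bullet> \<phi> b < \<phi> x \<bullet> \<phi> b \<and> \<phi> x \<bullet> \<phi> b < u \<bullet> \<phi> b)" for x
    proof -
      have im: "\<phi> ` Basis = Basis" using bij by (simp add: bij_betw_def)
      show ?thesis unfolding mem_box by (subst im[symmetric]) simp
    qed
    then show ?thesis by (auto simp: mem_box inner lu')
  qed
  then have "emeasure (distr lborel borel \<phi>) (box l u) = emeasure lborel (box l' u')"
    using meas by (simp add: emeasure_distr)
  also have "\<dots> = (\<Prod>b\<in>Basis. (u' - l') \<bullet> b)"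
    using lu bij_betwE[OF bij] by (intro emeasure_lborel_box) (simp add: lu')
  also have "(\<Prod>b\<in>Basis. (u' - l') \<bullet> b) = (\<Prod>b\<in>Basis. (u - l) \<bullet> \<phi> b)"
    by (intro prod.cong refl) (simp add: inner_diff_left lu')
  also have "\<dots> = (\<Prod>b\<in>Basis. (u - l) \<bullet> b)"
    using prod.reindex_bij_betw[OF bij, of "\<lambda>b. (u - l) \<bullet> b"] by simp
  finally show "emeasure (distr lborel borel \<phi>) (box l u) = ennreal (\<Prod>b\<in>Basis. (u - l) \<bullet> b)" .
qed simp

text \<open>Splits off one coordinate while keeping the others in order. For \<open>m = 1\<close>
  and t = 0 it is \<open>bdry_incl\<close>.\<close>

definition insert_coord :: "4 \<Rightarrow> real \<times> (real^3) \<Rightarrow> real^4" where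
  "insert_coord m p = (case p of (t, y) \<Rightarrow>
     if m = 1 then vector [t, y $ 1, y $ 2, y $ 3]
     else if m = 2 then vector [y $ 1, t, y $ 2, y $ 3]
     else if m = 3 then vector [y $ 1, y $ 2, t, y $ 3]
     else vector [y $ 1, y $ 2, y $ 3, t])"

lemma insert_coord_linear: "linear (insert_coord m)"
  by (rule linearI) (auto simp: insert_coord_def vec_eq_iff forall_4)

lemma insert_coord_line: "insert_coord m (t, y) = insert_coord m (0, y) + t *\<^sub>R axis m 1"
  using exhaust_4[of m] by (auto simp: insert_coord_def vec_eq_iff forall_4 axis_def)

lemma insert_coord_nth: "insert_coord m (t, y) $ m = t"
  using exhaust_4[of m] by (auto simp: insert_coord_def)

lemma Basis_real3: "(Basis :: (real^3) set) = {axis 1 1, axis 2 1, axis 3 1}"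
  unfolding Basis_vec_def UNIV_3 by auto

lemma Basis_real4: "(Basis :: (real^4) set) = {axis 1 1, axis 2 1, axis 3 1, axis 4 1}"
  unfolding Basis_vec_def UNIV_4 by auto

lemma insert_coord_Basis: "bij_betw (insert_coord m) Basis Basis"
proof -
  have B: "(Basis :: (real \<times> (real^3)) set) = {(1, 0), (0, axis 1 1), (0, axis 2 1), (0, axis 3 1)}"
    unfolding Basis_prod_def Basis_real3 by auto
  have im: "insert_coord m ` Basis = Basis"
  proof -
    have e: "insert_coord m (1, 0) = axis m 1"
      "insert_coord m (0, axis 1 1) = (if m = 1 then axis 2 1 else axis 1 1)"
      "insert_coord m (0, axis 2 1) = (if m = 1 \<or> m = 2 then axis 3 1 else axis 2 1)"
      "insert_coord m (0, axis 3 1) = (if m = 4 then axis 3 1 else axis 4 1)"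
      using exhaust_4[of m] by (auto simp: insert_coord_def vec_eq_iff forall_4 axis_def)
    have "insert_coord m ` Basis = {axis m 1, if m = 1 then axis 2 1 else axis 1 1,
        if m = 1 \<or> m = 2 then axis 3 1 else axis 2 1, if m = 4 then axis 3 1 else axis 4 1}"
      unfolding B by (simp only: image_insert image_empty e)
    also have "\<dots> = Basis" unfolding Basis_real4 using exhaust_4[of m] by auto
    finally show ?thesis .
  qed
  have "card (Basis :: (real \<times> (real^3)) set) = card (Basis :: (real^4) set)" by simp
  then have "inj_on (insert_coord m) Basis"
    using im by (metis eq_card_imp_inj_on finite_Basis)
  with im show ?thesis by (simp add: bij_betw_def)
qed

text \<open>Fubini's theorem with the innermost integration along the m-th axis, so that a partial
  derivative in that direction can be integrated first.\<close>

lemma lborel_integral_insert_coord: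
  fixes g :: "real^4 \<Rightarrow> complex"
  assumes g: "integrable lborel g"
  shows "(\<integral>x. g x \<partial>lborel) = (\<integral>y. (\<integral>t. g (insert_coord m (t, y)) \<partial>lborel) \<partial>lborel)"
proof -
  let ?p = "insert_coord m"
  have d: "distr lborel borel ?p = lborel" using lborel_distr_Basis[OF insert_coord_linear insert_coord_Basis] .
  have meas: "?p \<in> measurable lborel borel"
    using insert_coord_linear[of m]
    by (auto intro!: borel_measurable_continuous_onI linear_continuous_on simp: linear_conv_bounded_linear)
  have gm: "g \<in> borel_measurable borel" using g borel_measurable_integrable by simp
  have "(\<integral>x. g x \<partial>lborel) = (\<integral>x. g x \<partial>(distr lborel borel ?p))" by (simp add: d)
  also have "\<dots> = (\<integral>z. g (?p z) \<partial>lborel)" by (rule integral_distr[OF meas gm])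
  also have "\<dots> = (\<integral>z. g (?p z) \<partial>(lborel \<Otimes>\<^sub>M lborel))" by (simp add: lborel_prod)
  also have "\<dots> = (\<integral>y. (\<integral>t. g (?p (t, y)) \<partial>lborel) \<partial>lborel)"
  proof -
    have "integrable (distr lborel borel ?p) g" using g by (simp add: d)
    then have "integrable lborel (\<lambda>z. g (?p z))" by (simp add: integrable_distr_eq[OF meas gm])
    then have "integrable (lborel \<Otimes>\<^sub>M lborel) (case_prod (\<lambda>t y. g (?p (t, y))))"
      by (simp add: lborel_prod case_prod_beta')
    from lborel_pair.integral_snd[OF this] show ?thesis by (simp add: case_prod_beta')
  qed
  finally show ?thesis .
qed

section \<open>Stokes' theorem on the half-space\<close>

lemma half_space_accessible: "axis_accessible half_space"
  using model_space_openin_accessible[OF model_space_half_space] by simp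

text \<open>\<open>Ck\<close> only provides some family of derivatives; accessibility identifies it
  with \<open>frechet_derivative\<close>, which then inherits continuity.\<close>

lemma Ck1_derivative:
  assumes V: "axis_accessible V" and f: "Ck 1 V f"
  shows "x \<in> V \<Longrightarrow> (f has_derivative frechet_derivative f (at x within V)) (at x within V)"
    and "continuous_on V (\<lambda>x. frechet_derivative f (at x within V) v)"
proof -
  from f obtain D where D: "\<And>x. x \<in> V \<Longrightarrow> (f has_derivative D x) (at x within V)" "\<And>v. continuous_on V (\<lambda>x. D x v)"
    by (auto simp: One_nat_def)
  have eq: "frechet_derivative f (at x within V) = D x" if "x \<in> V" for x
    using frechet_derivative_eqI[OF V that D(1)[OF that]] .
  show "x \<in> V \<Longrightarrow> (f has_derivative frechet_derivative f (at x within V)) (at x within V)"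
    using eq D(1) by simp
  show "continuous_on V (\<lambda>x. frechet_derivative f (at x within V) v)"
    using D(2)[of v] eq by (metis (mono_tags, lifting) continuous_on_cong)
qed

lemma frechet_derivative_zero_openin:
  assumes V: "axis_accessible V" and U: "openin (top_of_set V) U" "x \<in> U" and z: "\<And>y. y \<in> U \<Longrightarrow> f y = c"
  shows "frechet_derivative f (at x within V) = (\<lambda>v. 0)"
proof -
  have "(f has_derivative (\<lambda>v. 0)) (at x within U)"
    by (rule has_derivative_transform[of x U f "\<lambda>_. c"]) (use U z in auto)
  then show ?thesis
    using frechet_derivative_eqI[OF V] at_within_openin[OF U] U openin_imp_subset by (metis subsetD)
qed

text \<open>Along axis lines this is the fundamental theorem of calculus. A line in the first
  direction leaves the half-space at t = 0 and contributes a boundary value. A line in another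
  direction lies entirely inside or entirely outside, and compact support leaves nothing.\<close>

lemma half_space_stokes:
  fixes h :: "real^4 \<Rightarrow> complex"
  assumes h: "Ck 1 half_space h" and C: "compact C" "C \<subseteq> half_space"
    and z: "\<And>x. x \<in> half_space \<Longrightarrow> x \<notin> C \<Longrightarrow> h x = 0"
  defines "G \<equiv> \<lambda>m x. if x \<in> half_space then frechet_derivative h (at x within half_space) (axis m 1) else 0"
  shows "integral UNIV (G m) = (if m = 1 then (\<integral>y. h (bdry_incl y) \<partial>lborel) else 0)"
proof -
  let ?D = "\<lambda>x. frechet_derivative h (at x within half_space)"
  note der = Ck1_derivative(1)[OF half_space_accessible h] and cont = Ck1_derivative(2)[OF half_space_accessible h]
  have opn: "openin (top_of_set half_space) (half_space - C)"
    unfolding Diff_eq by (intro openin_open_Int open_Compl compact_imp_closed C(1))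
  have Dz: "?D x v = 0" if "x \<in> half_space" "x \<notin> C" for x v
    using frechet_derivative_zero_openin[OF half_space_accessible opn, of x h 0] that z by auto
  have "integrable lborel (\<lambda>x. indicator C x *\<^sub>R ?D x (axis m 1))"
    using C(1) continuous_on_subset[OF cont C(2)] by (rule borel_integrable_compact)
  moreover have "(\<lambda>x. indicator C x *\<^sub>R ?D x (axis m 1)) = G m"
    using Dz C(2) by (auto simp: G_def fun_eq_iff indicator_def)
  ultimately have int: "integrable lborel (G m)" by simp
  obtain R where R: "R > 0" "\<And>x. x \<in> C \<Longrightarrow> norm x \<le> R" using compact_imp_bounded[OF C(1)] bounded_pos by blast
  have out: "x \<notin> C" if "\<bar>x $ k\<bar> > R" for x and k :: 4
    using component_le_norm_cart[of x k] R(2)[of x] that by auto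
  \<comment> \<open>The fundamental theorem for a segment inside the half-space outside of which the
    integrand vanishes; the two cases of m differ only in the segment.\<close>
  have line: "(\<integral>t. G m (insert_coord m (t, y)) \<partial>lborel) = h (insert_coord m (b, y)) - h (insert_coord m (a, y))"
    if ab: "a \<le> b" and inH: "\<And>t. t \<in> {a..b} \<Longrightarrow> insert_coord m (t, y) \<in> half_space"
      and zero: "\<And>t. t \<notin> {a..b} \<Longrightarrow> G m (insert_coord m (t, y)) = 0" for a b y
  proof -
    let ?c = "\<lambda>t. insert_coord m (t, y)"
    have cl: "?c = (\<lambda>t. insert_coord m (0, y) + t *\<^sub>R axis m 1)"
      by (rule ext) (rule insert_coord_line)
    have c: "(?c has_derivative (\<lambda>s. s *\<^sub>R axis m 1)) (at t within {a..b})" for t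
      unfolding cl by (auto intro!: derivative_eq_intros)
    have vd: "((\<lambda>t. h (?c t)) has_vector_derivative G m (?c t)) (at t within {a..b})" if t: "t \<in> {a..b}" for t
    proof -
      have "(h has_derivative ?D (?c t)) (at (?c t) within ?c ` {a..b})"
        using inH t by (intro has_derivative_subset[OF der]) auto
      then have "((\<lambda>t. h (?c t)) has_derivative (\<lambda>s. ?D (?c t) (s *\<^sub>R axis m 1))) (at t within {a..b})"
        by (rule has_derivative_in_compose[OF c])
      moreover have "?D (?c t) (s *\<^sub>R axis m 1) = s *\<^sub>R G m (?c t)" for s
        using linear_cmul[OF has_derivative_linear[OF der[OF inH[OF t]]]] inH[OF t] by (simp add: G_def)
      ultimately show ?thesis by (simp add: has_vector_derivative_def)
    qed
    have cc: "continuous_on {a..b} ?c"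
      unfolding cl by (intro continuous_intros)
    have "continuous_on {a..b} (\<lambda>t. ?D (?c t) (axis m 1))"
      by (rule continuous_on_compose2[OF cont cc]) (use inH in auto)
    then have cG: "continuous_on {a..b} (\<lambda>t. G m (?c t))"
      by (rule continuous_on_eq) (use inH in \<open>simp add: G_def\<close>)
    have "(\<integral>t. G m (?c t) \<partial>lborel) = (\<integral>t. indicator {a..b} t *\<^sub>R G m (?c t) \<partial>lborel)"
      by (intro Bochner_Integration.integral_cong refl) (use zero in \<open>auto simp: indicator_def\<close>)
    also have "\<dots> = h (?c b) - h (?c a)"
      by (rule integral_FTC_Icc[OF ab _ cG]) (use vd in auto)
    finally show ?thesis .
  qed
  have Gz: "G m x = 0" if "x \<notin> C" for x using Dz that by (simp add: G_def)
  have hz: "h x = 0" if "x \<in> half_space" "\<bar>x $ k\<bar> > R" for x and k :: 4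
    using z out that by blast
  have inner: "(\<integral>t. G m (insert_coord m (t, y)) \<partial>lborel) = (if m = 1 then h (bdry_incl y) else 0)" for y
  proof (cases "m = 1")
    case True
    have nth1: "insert_coord m (t, y) $ 1 = t" for t using insert_coord_nth[of m] True by simp
    have hs: "insert_coord m (t, y) \<in> half_space \<longleftrightarrow> t \<le> 0" for t by (simp add: half_space_def nth1)
    \<comment> \<open>The upper end is the boundary, since \<open>G\<close> is 0 for t > 0. The
      lower end is \<open>- R - 1\<close> instead of \<open>- R\<close> because points of
      \<open>C\<close> may have norm exactly \<open>R\<close>.\<close>
    have "(\<integral>t. G m (insert_coord m (t, y)) \<partial>lborel) =
        h (insert_coord m (0, y)) - h (insert_coord m (- R - 1, y))"
    proof (rule line)
      fix t assume t: "t \<notin> {- R - 1..0}"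
      show "G m (insert_coord m (t, y)) = 0"
      proof (cases "t > 0")
        case True
        then show ?thesis by (simp add: G_def hs)
      next
        case False
        then have "\<bar>insert_coord m (t, y) $ 1\<bar> > R" using t by (auto simp: nth1)
        then show ?thesis using Gz out by blast
      qed
    qed (use R hs in auto)
    moreover have "h (insert_coord m (- R - 1, y)) = 0"
      by (rule hz[of _ 1]) (use R in \<open>simp_all add: hs nth1\<close>)
    moreover have "insert_coord m (0, y) = bdry_incl y"
      using True by (simp add: insert_coord_def bdry_incl_def)
    ultimately show ?thesis using True by simp
  next
    case False
    have nthm: "insert_coord m (t, y) $ m = t" for t by (rule insert_coord_nth)
    have nth1: "insert_coord m (t, y) $ 1 = y $ 1" for t
      using False exhaust_4[of m] by (auto simp: insert_coord_def)
    show ?thesis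
    \<comment> \<open>For m different from 1 the first coordinate is constant along the line, so its
      sign decides whether the line meets the half-space.\<close>
    proof (cases "y $ 1 \<le> 0")
      case True
      have hs: "insert_coord m (t, y) \<in> half_space" for t using True by (simp add: half_space_def nth1)
      have "(\<integral>t. G m (insert_coord m (t, y)) \<partial>lborel) =
          h (insert_coord m (R + 1, y)) - h (insert_coord m (- R - 1, y))"
      proof (rule line)
        fix t assume "t \<notin> {- R - 1..R + 1}"
        then have "\<bar>insert_coord m (t, y) $ m\<bar> > R" using R by (auto simp: nthm)
        then show "G m (insert_coord m (t, y)) = 0" using Gz out by blast
      qed (use R hs in auto)
      moreover have "h (insert_coord m (R + 1, y)) = 0" "h (insert_coord m (- R - 1, y)) = 0"
        using R by (auto intro!: hz[of _ m] simp: hs nthm)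
      ultimately show ?thesis using False by simp
    next
      case y: False
      then have "G m (insert_coord m (t, y)) = 0" for t by (simp add: G_def half_space_def nth1)
      then show ?thesis using False by simp
    qed
  qed
  have "integral UNIV (G m) = (\<integral>x. G m x \<partial>lborel)" using integral_lborel[OF int] .
  also have "\<dots> = (\<integral>y. (if m = 1 then h (bdry_incl y) else 0) \<partial>lborel)"
    unfolding lborel_integral_insert_coord[OF int, of m] inner ..
  finally show ?thesis by simp
qed


section \<open>Stokes' theorem on the manifold\<close>

definition ext_deriv3 :: "('x, 'i, 4) mfd \<Rightarrow> ('i \<Rightarrow> real^4 \<Rightarrow> real^4 \<Rightarrow> real^4 \<Rightarrow> real^4 \<Rightarrow> complex) \<Rightarrow>
    'i \<Rightarrow> real^4 \<Rightarrow> complex" where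
  "ext_deriv3 X \<omega> i x =
     frechet_derivative (\<lambda>y. \<omega> i y (axis 2 1) (axis 3 1) (axis 4 1)) (at x within cimg X i) (axis 1 1)
   - frechet_derivative (\<lambda>y. \<omega> i y (axis 1 1) (axis 3 1) (axis 4 1)) (at x within cimg X i) (axis 2 1)
   + frechet_derivative (\<lambda>y. \<omega> i y (axis 1 1) (axis 2 1) (axis 4 1)) (at x within cimg X i) (axis 3 1)
   - frechet_derivative (\<lambda>y. \<omega> i y (axis 1 1) (axis 2 1) (axis 3 1)) (at x within cimg X i) (axis 4 1)"

definition C1_three_form :: "('x, 'i, 4) mfd \<Rightarrow> ('i \<Rightarrow> real^4 \<Rightarrow> real^4 \<Rightarrow> real^4 \<Rightarrow> real^4 \<Rightarrow> complex) \<Rightarrow> bool" where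
  "C1_three_form X \<omega> \<longleftrightarrow>
     (\<forall>i\<in>idx X. (\<forall>x\<in>cimg X i. alternating3 (\<omega> i x)) \<and> (\<forall>u v z. Ck 1 (cimg X i) (\<lambda>x. \<omega> i x u v z))) \<and>
     (\<forall>i\<in>idx X. \<forall>j\<in>idx X. \<forall>x\<in>overlap X i j. \<forall>u v z. \<omega> i x u v z =
       \<omega> j (transition X i j x) (dtransition X i j x u) (dtransition X i j x v) (dtransition X i j x z))"

context manifold4
begin

interpretation B: compact_manifold UNIV "bdry X" by (rule compact_manifold_bdry)

text \<open>Extension by zero reduces a function with compact support in one chart to the
  half-space; the boundary of the half-space then becomes the boundary chart.\<close>

lemma chart_stokes:
  fixes f :: "real^4 \<Rightarrow> complex"
  assumes j: "j \<in> idx X" and K: "compact K" "K \<subseteq> cdom X j" and f: "Ck 1 (cimg X j) f"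
    and z: "\<And>x. x \<in> cimg X j \<Longrightarrow> cinv X j x \<notin> K \<Longrightarrow> f x = 0"
  shows "(\<lambda>x. frechet_derivative f (at x within cimg X j) v) absolutely_integrable_on cimg X j"
    and "integral (cimg X j) (\<lambda>x. frechet_derivative f (at x within cimg X j) (axis m 1)) =
      (if m = 1 then integral (cimg (bdry X) j) (\<lambda>y. f (bdry_incl y)) else 0)"
proof -
  let ?V = "cimg X j"
  let ?C = "chart X j ` K"
  let ?df = "\<lambda>x. frechet_derivative f (at x within ?V)"
  have acc: "axis_accessible ?V" by (rule cimg_accessible[OF j])
  have dz: "?df x v = 0" if "x \<in> ?V" "cinv X j x \<notin> K" for x v
    using frechet_derivative_zero_openin[OF acc cimg_minus_openin[OF j K(1)], of x f 0] that z by auto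
  show "(\<lambda>x. ?df x v) absolutely_integrable_on ?V"
    by (rule chart_integrable[OF j K Ck1_derivative(2)[OF acc f]]) (rule dz)
  have "continuous_on (cdom X j) (chart X j)" using chart_homeo[OF j] by (simp add: homeomorphism_def)
  then have C: "compact ?C" "?C \<subseteq> ?V"
    using K continuous_on_subset by (blast intro: compact_continuous_image, auto simp: cimg_def)
  have notC: "cinv X j x \<notin> K" if "x \<in> ?V" "x \<notin> ?C" for x
    using that chart_cinv[OF j, of x] by (metis imageI)
  define h where "h x = (if x \<in> ?V then f x else 0)" for x
  have opn: "openin (top_of_set half_space) (half_space - ?C)"
    unfolding Diff_eq by (intro openin_open_Int open_Compl compact_imp_closed C(1))
  have hz: "h x = 0" if "x \<notin> ?C" for x using that z notC by (simp add: h_def)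
  have Ch: "?C \<subseteq> half_space" using C(2) cimg_half_space[OF j] by blast
  \<comment> \<open>The chart image and the complement of the compact set \<open>?C\<close> are
    relatively open and cover the half-space, and the extension is C^1 on each.\<close>
  have h: "Ck 1 half_space h"
  proof (rule Ck_local[OF half_space_accessible])
    fix x :: "real^4" assume x: "x \<in> half_space"
    show "\<exists>U. openin (top_of_set half_space) U \<and> x \<in> U \<and> Ck 1 U h"
    proof (cases "x \<in> ?V")
      case True
      have "Ck 1 ?V h \<longleftrightarrow> Ck 1 ?V f" by (rule Ck_cong) (simp add: h_def)
      with f True show ?thesis using cimg_openin[OF j] by blast
    next
      case False
      have "Ck 1 (half_space - ?C) h \<longleftrightarrow> Ck 1 (half_space - ?C) (\<lambda>x. 0 :: complex)"
        by (rule Ck_cong) (use hz in auto)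
      then have "Ck 1 (half_space - ?C) h" using Ck_const by blast
      moreover have "x \<in> half_space - ?C" using x False C(2) by blast
      ultimately show ?thesis using opn by blast
    qed
  qed
  let ?dh = "\<lambda>x. frechet_derivative h (at x within half_space)"
  have eq1: "?dh x = ?df x" if x: "x \<in> ?V" for x
  proof (rule frechet_derivative_eqI[OF half_space_accessible])
    show "x \<in> half_space" using x cimg_half_space[OF j] by blast
    have "(h has_derivative ?df x) (at x within ?V)"
      by (rule has_derivative_transform[OF x _ Ck1_derivative(1)[OF acc f x]]) (simp add: h_def)
    then show "(h has_derivative ?df x) (at x within half_space)"
      using at_within_openin[OF cimg_openin[OF j] x] by simp
  qed
  have eq2: "?dh x v = 0" if "x \<in> half_space" "x \<notin> ?V" for x v
  proof -
    have "x \<in> half_space - ?C" using that C(2) by blast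
    then show ?thesis
      using frechet_derivative_zero_openin[OF half_space_accessible opn, of x h 0] hz by auto
  qed
  have "integral ?V (\<lambda>x. ?df x (axis m 1)) = integral UNIV (\<lambda>x. if x \<in> ?V then ?df x (axis m 1) else 0)"
    by (rule integral_restrict_UNIV[symmetric])
  also have "(\<lambda>x. if x \<in> ?V then ?df x (axis m 1) else 0) =
      (\<lambda>x. if x \<in> half_space then ?dh x (axis m 1) else 0)"
  proof
    show "(if x \<in> ?V then ?df x (axis m 1) else 0) = (if x \<in> half_space then ?dh x (axis m 1) else 0)" for x
      using eq1[of x] eq2[of x] cimg_half_space[OF j] by (cases "x \<in> ?V") auto
  qed
  also have "integral UNIV \<dots> = (if m = 1 then (\<integral>y. h (bdry_incl y) \<partial>lborel) else 0)"
    by (rule half_space_stokes[OF h C(1) Ch]) (rule hz)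
  \<comment> \<open>The restriction of the extension to the boundary is continuous with compact
    support, so its Lebesgue integral is also the \<open>integral\<close> over the boundary
    chart.\<close>
  also have "(\<integral>y. h (bdry_incl y) \<partial>lborel) = integral (cimg (bdry X) j) (\<lambda>y. f (bdry_incl y))"
  proof -
    let ?B = "bdry_proj ` (?C \<inter> {x. x $ 1 = 0})"
    have "closed {x::real^4. x $ 1 = 0}" by (intro closed_Collect_eq continuous_intros)
    then have B: "compact ?B"
      by (intro compact_continuous_image linear_continuous_on bounded_linear_bdry_proj compact_Int_closed C(1))
    have Bz: "h (bdry_incl y) = 0" if "y \<notin> ?B" for y
    proof (rule hz)
      show "bdry_incl y \<notin> ?C"
      proof
        assume "bdry_incl y \<in> ?C"
        then have "bdry_proj (bdry_incl y) \<in> ?B" by (intro imageI) simp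
        then show False using that by simp
      qed
    qed
    have "continuous_on UNIV (\<lambda>y. h (bdry_incl y))"
      by (rule continuous_on_compose2[OF Ck_imp_continuous_on[OF h] linear_continuous_on[OF bounded_linear_bdry_incl]]) auto
    then have "integrable lborel (\<lambda>y. indicator ?B y *\<^sub>R h (bdry_incl y))"
      using B by (intro borel_integrable_compact) (auto intro: continuous_on_subset)
    moreover have "(\<lambda>y. indicator ?B y *\<^sub>R h (bdry_incl y)) = (\<lambda>y. h (bdry_incl y))"
      using Bz by (auto simp: fun_eq_iff indicator_def)
    ultimately have "integrable lborel (\<lambda>y. h (bdry_incl y))" by simp
    then have "(\<integral>y. h (bdry_incl y) \<partial>lborel) = integral UNIV (\<lambda>y. h (bdry_incl y))"
      by (rule integral_lborel[symmetric])
    also have "\<dots> = integral UNIV (\<lambda>y. if y \<in> cimg (bdry X) j then f (bdry_incl y) else 0)"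
      by (rule integral_cong) (use cimg_bdry[OF j] in \<open>auto simp: h_def\<close>)
    also have "\<dots> = integral (cimg (bdry X) j) (\<lambda>y. f (bdry_incl y))"
      by (rule integral_restrict_UNIV)
    finally show ?thesis .
  qed
  finally show "integral ?V (\<lambda>x. ?df x (axis m 1)) =
      (if m = 1 then integral (cimg (bdry X) j) (\<lambda>y. f (bdry_incl y)) else 0)" .
qed

lemma pou_bdry:
  assumes \<rho>: "partition_of_unity X J \<rho>"
  shows "partition_of_unity (bdry X) J \<rho>"
  unfolding partition_of_unity_def
proof (intro conjI ballI)
  show "finite J" "J \<subseteq> idx (bdry X)" using pou_finite[OF \<rho>] pou_idx[OF \<rho>] by auto
  show "\<rho> j p \<ge> 0" if "j \<in> J" "p \<in> pts (bdry X)" for j p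
    using that \<rho> bdry_pts_sub unfolding partition_of_unity_def by auto
  show "(\<Sum>j\<in>J. \<rho> j p) = 1" if "p \<in> pts (bdry X)" for p
    using that \<rho> bdry_pts_sub unfolding partition_of_unity_def by auto
  show "pts (bdry X) \<inter> closure {p \<in> pts (bdry X). \<rho> j p \<noteq> 0} \<subseteq> cdom (bdry X) j" if j: "j \<in> J" for j
  proof -
    have "closure {p \<in> bdry_pts X. \<rho> j p \<noteq> 0} \<subseteq> closure {p \<in> pts X. \<rho> j p \<noteq> 0}"
      by (rule closure_mono) (use bdry_pts_sub in auto)
    moreover have "pts X \<inter> closure {p \<in> pts X. \<rho> j p \<noteq> 0} \<subseteq> cdom X j"
      using \<rho> j unfolding partition_of_unity_def by blast
    ultimately show ?thesis using bdry_pts_sub by auto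
  qed
  show "smooth (cimg (bdry X) i) (\<rho> j \<circ> cinv (bdry X) i)" if j: "j \<in> J" and i': "i \<in> idx (bdry X)" for j i
    unfolding smooth_def
  proof
    fix k
    have i: "i \<in> idx X" using i' by simp
    have "Ck k (cimg (bdry X) i) (\<lambda>y. \<rho> j (cinv X i (bdry_incl y)))"
      by (rule Ck_compose[OF pou_Ck[OF \<rho> j i] Ck_linear[OF bounded_linear_bdry_incl]])
         (use cimg_bdry[OF i] in auto)
    moreover have "(\<rho> j \<circ> cinv (bdry X) i) y = \<rho> j (cinv X i (bdry_incl y))" if "y \<in> cimg (bdry X) i" for y
      using cinv_bdry[OF i that] by simp
    ultimately show "Ck k (cimg (bdry X) i) (\<rho> j \<circ> cinv (bdry X) i)"
      by (subst Ck_cong)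
  qed
qed

text \<open>The Jacobian of X maps boundary vectors as the boundary Jacobian does
  (\<open>inclT\<close>), so the restricted three-form transforms with the three-dimensional
  determinant. This makes its integral independent of the partition.\<close>

lemma bdry_density:
  assumes \<omega>: "C1_three_form X \<omega>"
  defines "\<beta> \<equiv> \<lambda>i y. \<omega> i (bdry_incl y) (axis 2 1) (axis 3 1) (axis 4 1)"
  shows "B.chartwise_continuous \<beta>" and "B.top_density \<beta>"
proof -
  show "B.chartwise_continuous \<beta>"
    unfolding B.chartwise_continuous_def
  proof
    fix i assume "i \<in> idx (bdry X)"
    then have i: "i \<in> idx X" by simp
    have "Ck 1 (cimg X i) (\<lambda>x. \<omega> i x (axis 2 1) (axis 3 1) (axis 4 1))"
      using \<omega> i unfolding C1_three_form_def by blast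
    then have "continuous_on (cimg X i) (\<lambda>x. \<omega> i x (axis 2 1) (axis 3 1) (axis 4 1))"
      by (rule Ck_imp_continuous_on)
    then show "continuous_on (cimg (bdry X) i) (\<beta> i)"
      unfolding \<beta>_def
      by (rule continuous_on_compose2[OF _ linear_continuous_on[OF bounded_linear_bdry_incl]])
         (use cimg_bdry[OF i] in auto)
  qed
  show "B.top_density \<beta>"
    unfolding B.top_density_def
  proof (intro ballI)
    fix i j y assume "i \<in> idx (bdry X)" "j \<in> idx (bdry X)" and y: "y \<in> overlap (bdry X) i j"
    then have i: "i \<in> idx X" and j: "j \<in> idx X" by auto
    let ?x = "bdry_incl y"
    have x: "?x \<in> overlap X i j" using y overlap_bdry[OF i j] by simp
    define D where "D = dtransition X i j ?x"
    define T where "T = dtransition (bdry X) i j y"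
    let ?z = "transition X i j ?x"
    have inclT: "bdry_incl (T v) = D (bdry_incl v)" for v
      using transition_bdry_deriv(2,3)[OF i j y] by (simp add: T_def D_def bdry_incl_proj)
    have z: "?z = bdry_incl (transition (bdry X) i j y)" using transition_bdry(2)[OF i j y] by simp
    have "?z \<in> cimg X j" using transition_in[OF i j x] overlap_sub[OF j, of i] by blast
    then have alt: "alternating3 (\<omega> j ?z)" using \<omega> j unfolding C1_three_form_def by blast
    have "alternating3 (\<lambda>u v w. \<omega> j ?z (bdry_incl u) (bdry_incl v) (bdry_incl w))"
    proof -
      have l: "linear (\<lambda>x. \<omega> j ?z x u v)" "linear (\<lambda>x. \<omega> j ?z u x v)" "linear (\<lambda>x. \<omega> j ?z u v x)" for u v
        using alt by (auto simp: alternating3_def)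
      have "linear (\<lambda>x. \<omega> j ?z (bdry_incl x) u v)" "linear (\<lambda>x. \<omega> j ?z u (bdry_incl x) v)"
        "linear (\<lambda>x. \<omega> j ?z u v (bdry_incl x))" for u v
        using linear_compose[OF linear_bdry_incl l(1)] linear_compose[OF linear_bdry_incl l(2)]
          linear_compose[OF linear_bdry_incl l(3)] by (simp_all add: comp_def)
      then show ?thesis using alt by (simp add: alternating3_def)
    qed
    from alternating3_det[OF this B.dtransition_linear[of i j y]] y i j
    have "\<omega> j ?z (D (axis 2 1)) (D (axis 3 1)) (D (axis 4 1)) =
        det (matrix T) *\<^sub>R \<omega> j ?z (axis 2 1) (axis 3 1) (axis 4 1)"
      using inclT bdry_incl_axis by (simp add: T_def)
    moreover have "\<omega> i ?x (axis 2 1) (axis 3 1) (axis 4 1) = \<omega> j ?z (D (axis 2 1)) (D (axis 3 1)) (D (axis 4 1))"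
      using \<omega> i j x unfolding C1_three_form_def D_def by blast
    ultimately show "\<beta> i y = det (matrix (dtransition (bdry X) i j y)) *\<^sub>R \<beta> j (transition (bdry X) i j y)"
      by (simp add: \<beta>_def z T_def)
  qed
qed

theorem stokes:
  assumes \<omega>: "C1_three_form X \<omega>"
  shows "mfd_integral X (ext_deriv3 X \<omega>) =
    mfd_integral (bdry X) (\<lambda>i y. \<omega> i (bdry_incl y) (axis 2 1) (axis 3 1) (axis 4 1))"
proof -
  let ?e = "\<lambda>k::4. axis k 1 :: real^4"
  let ?\<beta> = "\<lambda>i y. \<omega> i (bdry_incl y) (?e 2) (?e 3) (?e 4)"
  obtain J \<rho> where \<rho>: "partition_of_unity X J \<rho>" and Jint: "\<And>\<omega>. mfd_integral X \<omega> = pou_integral J \<rho> \<omega>"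
    using mfd_integral_pou by blast
  have alt: "alternating3 (\<omega> i x)" if "i \<in> idx X" "x \<in> cimg X i" for i x
    using \<omega> that unfolding C1_three_form_def by blast
  have C1: "Ck 1 (cimg X i) (\<lambda>x. \<omega> i x u v z)" if "i \<in> idx X" for i u v z
    using \<omega> that unfolding C1_three_form_def by blast
  have tr: "\<omega> i x u v z = \<omega> j (transition X i j x) (dtransition X i j x u) (dtransition X i j x v) (dtransition X i j x z)"
    if "i \<in> idx X" "j \<in> idx X" "x \<in> overlap X i j" for i j x u v z
    using \<omega> that unfolding C1_three_form_def by blast
  define r where "r j i x = \<rho> j (cinv X i x)" for j i x
  define dr where "dr j i x = frechet_derivative (r j i) (at x within cimg X i)" for j i x
  \<comment> \<open>The coefficient of d\<rho>_j \<and> \<omega>, in every chart and not only in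
    chart j.\<close>
  define \<eta> where "\<eta> j i x = wedge13 (dr j i x) (\<omega> i x) (?e 1) (?e 2) (?e 3) (?e 4)" for j i x
  have rC1: "Ck 1 (cimg X i) (r j i)" if "j \<in> J" "i \<in> idx X" for j i
    using pou_Ck[OF \<rho> that] unfolding r_def .
  have dr: "(r j i has_derivative dr j i x) (at x within cimg X i)" if "j \<in> J" "i \<in> idx X" "x \<in> cimg X i" for j i x
    unfolding dr_def using Ck1_derivative(1)[OF cimg_accessible[OF that(2)] rC1[OF that(1,2)] that(3)] .
  have drc: "continuous_on (cimg X i) (\<lambda>x. dr j i x v)" if "j \<in> J" "i \<in> idx X" for j i v
    unfolding dr_def using Ck1_derivative(2)[OF cimg_accessible[OF that(2)] rC1[OF that]] .
  have "\<exists>D. compact D \<and> D \<subseteq> cdom X j \<and> (\<forall>p\<in>pts X. p \<notin> D \<longrightarrow> \<rho> j p = 0)" if "j \<in> J" for j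
    using pou_support[OF \<rho> that] by metis
  then obtain C where C: "\<And>j. j \<in> J \<Longrightarrow> compact (C j) \<and> C j \<subseteq> cdom X j \<and> (\<forall>p\<in>pts X. p \<notin> C j \<longrightarrow> \<rho> j p = 0)"
    by metis
  have rz: "r j i x = 0" if "j \<in> J" "i \<in> idx X" "x \<in> cimg X i" "cinv X i x \<notin> C j" for j i x
    unfolding r_def using C[OF that(1)] cdom_pts[OF that(2) cinv_in[OF that(2,3)]] that(4) by blast
  have drz: "dr j i x v = 0" if "j \<in> J" "i \<in> idx X" "x \<in> cimg X i" "cinv X i x \<notin> C j" for j i x v
  proof -
    have cC: "compact (C j)" using C[OF that(1)] by blast
    have "dr j i x = (\<lambda>v. 0)" unfolding dr_def
      by (rule frechet_derivative_zero_openin[OF cimg_accessible[OF that(2)] cimg_minus_openin[OF that(2) cC], of x _ 0])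
         (use that rz[OF that(1,2)] in auto)
    then show ?thesis by simp
  qed
  have sum_eta: "(\<Sum>j\<in>J. integral (cimg X j) (\<eta> j j)) = pou_integral J \<rho> (\<lambda>i x. \<Sum>j\<in>J. \<eta> j i x)"
  proof (rule sum_integral_transfer[OF \<rho> pou_finite[OF \<rho>], of C \<eta>])
    show "J \<subseteq> idx X" using pou_idx[OF \<rho>] by auto
    show "compact (C j) \<and> C j \<subseteq> cdom X j" if "j \<in> J" for j using C[OF that] by blast
    show "chartwise_continuous (\<eta> j)" if "j \<in> J" for j
      unfolding chartwise_continuous_def \<eta>_def wedge13_def
      by (intro ballI continuous_intros drc that Ck_imp_continuous_on[OF C1])
    show "\<eta> j i x = 0" if "j \<in> J" "i \<in> idx X" "x \<in> cimg X i" "cinv X i x \<notin> C j" for j i x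
      using drz[OF that] by (simp add: \<eta>_def wedge13_def)
    show "top_density (\<eta> j)" if j: "j \<in> J" for j
      unfolding top_density_def
    proof (intro ballI)
      fix a b x assume a: "a \<in> idx X" and b: "b \<in> idx X" and x: "x \<in> overlap X a b"
      let ?T = "transition X a b" and ?D = "dtransition X a b x"
      have xa: "x \<in> cimg X a" and Tb: "?T x \<in> cimg X b"
        using x overlap_sub[OF a, of b] transition_in[OF a b x] overlap_sub[OF b, of a] by auto
      have acc: "axis_accessible (overlap X a b)"
        using model_space_openin_accessible[OF model overlap_openin[OF a b]] .
      \<comment> \<open>The transformation of d\<rho>_j is the chain rule for a function, and
        \<omega> transforms by assumption; hence only first derivatives of the transition
        enter.\<close>
      have "(r j b has_derivative dr j b (?T x)) (at (?T x) within ?T ` overlap X a b)"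
        using dr[OF j b Tb] transition_image[OF a b] overlap_sub[OF b, of a] by (auto intro: has_derivative_subset)
      then have "((\<lambda>x. r j b (?T x)) has_derivative (\<lambda>v. dr j b (?T x) (?D v))) (at x within overlap X a b)"
        by (rule has_derivative_in_compose[OF transition_deriv[OF a b x]])
      then have "(r j a has_derivative (\<lambda>v. dr j b (?T x) (?D v))) (at x within overlap X a b)"
        by (rule has_derivative_transform[rotated 2])
           (use x cinv_transition[OF a b] in \<open>simp_all add: r_def\<close>)
      moreover have "(r j a has_derivative dr j a x) (at x within overlap X a b)"
        using dr[OF j a xa] at_within_overlap[OF a b x] by simp
      ultimately have chain: "dr j a x = (\<lambda>v. dr j b (?T x) (?D v))"
        using has_derivative_within_unique[OF acc x] by blast
      have "\<eta> j a x = wedge13 (dr j b (?T x)) (\<omega> b (?T x)) (?D (?e 1)) (?D (?e 2)) (?D (?e 3)) (?D (?e 4))"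
        unfolding \<eta>_def wedge13_def chain tr[OF a b x] ..
      also have "\<dots> = det (matrix ?D) *\<^sub>R \<eta> j b (?T x)"
        unfolding \<eta>_def
        by (rule wedge13_det[OF alt[OF b Tb] has_derivative_linear[OF dr[OF j b Tb]] dtransition_linear[OF a b x]])
      finally show "\<eta> j a x = det (matrix ?D) *\<^sub>R \<eta> j b (?T x)" .
    qed
  qed
  \<comment> \<open>The differential of the constant \<Sum> \<rho>_j = 1 vanishes, and the product
    is linear in the covector.\<close>
  have eta0: "(\<Sum>j\<in>J. \<eta> j i x) = 0" if i: "i \<in> idx X" and x: "x \<in> cimg X i" for i x
  proof -
    have "((\<lambda>x. \<Sum>j\<in>J. r j i x) has_derivative (\<lambda>v. \<Sum>j\<in>J. dr j i x v)) (at x within cimg X i)"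
      by (rule has_derivative_sum) (use dr i x in auto)
    then have "((\<lambda>x. 1) has_derivative (\<lambda>v. \<Sum>j\<in>J. dr j i x v)) (at x within cimg X i)"
      by (rule has_derivative_transform[rotated 2]) (use x pou_sum[OF \<rho> i] in \<open>simp_all add: r_def\<close>)
    then have "(\<lambda>v. \<Sum>j\<in>J. dr j i x v) = (\<lambda>v. 0)"
      using has_derivative_within_unique[OF cimg_accessible[OF i] x _ has_derivative_const] by blast
    then have "(\<Sum>j\<in>J. dr j i x v) = 0" for v by metis
    moreover have "(\<Sum>j\<in>J. \<eta> j i x) = wedge13 (\<lambda>v. \<Sum>j\<in>J. dr j i x v) (\<omega> i x) (?e 1) (?e 2) (?e 3) (?e 4)"
      unfolding \<eta>_def wedge13_def by (simp add: sum.distrib sum_subtractf scaleR_left.sum)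
    ultimately show ?thesis by (simp add: wedge13_def)
  qed
  have "pou_integral J \<rho> (\<lambda>i x. \<Sum>j\<in>J. \<eta> j i x) = 0"
    unfolding pou_integral_def
  proof (rule sum.neutral, rule ballI)
    fix j assume "j \<in> J"
    then have "integral (cimg X j) (\<lambda>x. \<rho> j (cinv X j x) *\<^sub>R (\<Sum>k\<in>J. \<eta> k j x)) = integral (cimg X j) (\<lambda>x. 0)"
      using eta0 pou_idx[OF \<rho>] by (intro integral_cong) auto
    then show "integral (cimg X j) (\<lambda>x. \<rho> j (cinv X j x) *\<^sub>R (\<Sum>k\<in>J. \<eta> k j x)) = 0" by simp
  qed
  with sum_eta have eta_int: "(\<Sum>j\<in>J. integral (cimg X j) (\<eta> j j)) = 0" by simp
  \<comment> \<open>The Leibniz rule \<rho>_j d\<omega> = d(\<rho>_j \<omega>) - d\<rho>_j \<and>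
    \<omega>. Of the four partial derivatives in d(\<rho>_j \<omega>) only the one normal to the
    boundary has a nonzero integral in general.\<close>
  have chart: "integral (cimg X j) (\<lambda>x. r j j x *\<^sub>R ext_deriv3 X \<omega> j x) =
      integral (cimg (bdry X) j) (\<lambda>y. \<rho> j (cinv (bdry X) j y) *\<^sub>R ?\<beta> j y) - integral (cimg X j) (\<eta> j j)"
    if j: "j \<in> J" for j
  proof -
    have jX: "j \<in> idx X" using pou_idx[OF \<rho> j] .
    have cC: "compact (C j)" "C j \<subseteq> cdom X j" using C[OF j] by auto
    note acc = cimg_accessible[OF jX]
    let ?f = "\<lambda>u v z x. r j j x *\<^sub>R \<omega> j x u v z"
    let ?d = "\<lambda>u v z x. frechet_derivative (?f u v z) (at x within cimg X j)"
    have fC1: "Ck 1 (cimg X j) (?f u v z)" for u v z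
      by (rule Ck_scaleR[OF rC1[OF j jX] C1[OF jX]])
    have fz: "?f u v z x = 0" if "x \<in> cimg X j" "cinv X j x \<notin> C j" for u v z x
      using rz[OF j jX that] by simp
    note st = chart_stokes[OF jX cC fC1 fz]
    have int: "(\<lambda>x. ?d u v z x w) integrable_on cimg X j" for u v z w
      using st(1) by (rule set_lebesgue_integral_eq_integral)
    have prod: "?d u v z x w = r j j x *\<^sub>R frechet_derivative (\<lambda>x. \<omega> j x u v z) (at x within cimg X j) w +
        dr j j x w *\<^sub>R \<omega> j x u v z" if x: "x \<in> cimg X j" for u v z x w
    proof -
      have "(?f u v z has_derivative (\<lambda>w. r j j x *\<^sub>R frechet_derivative (\<lambda>x. \<omega> j x u v z) (at x within cimg X j) w +
        dr j j x w *\<^sub>R \<omega> j x u v z)) (at x within cimg X j)"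
        by (rule has_derivative_scaleR[OF dr[OF j jX x] Ck1_derivative(1)[OF acc C1[OF jX] x]])
      from frechet_derivative_eqI[OF acc x this] show ?thesis by simp
    qed
    let ?a = "\<lambda>x. ?d (?e 2) (?e 3) (?e 4) x (?e 1)" and ?b = "\<lambda>x. ?d (?e 1) (?e 3) (?e 4) x (?e 2)"
      and ?c = "\<lambda>x. ?d (?e 1) (?e 2) (?e 4) x (?e 3)" and ?g = "\<lambda>x. ?d (?e 1) (?e 2) (?e 3) x (?e 4)"
    have "r j j x *\<^sub>R ext_deriv3 X \<omega> j x = ?a x - ?b x + ?c x - ?g x - \<eta> j j x" if "x \<in> cimg X j" for x
      unfolding prod[OF that] ext_deriv3_def \<eta>_def wedge13_def by (simp add: algebra_simps)
    then have "integral (cimg X j) (\<lambda>x. r j j x *\<^sub>R ext_deriv3 X \<omega> j x) =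
        integral (cimg X j) (\<lambda>x. ?a x - ?b x + ?c x - ?g x - \<eta> j j x)"
      by (rule integral_cong)
    also have "\<dots> = integral (cimg X j) ?a - integral (cimg X j) ?b + integral (cimg X j) ?c
        - integral (cimg X j) ?g - integral (cimg X j) (\<eta> j j)"
    proof -
      have "\<eta> j j absolutely_integrable_on cimg X j"
      proof (rule chart_integrable[OF jX cC])
        show "continuous_on (cimg X j) (\<eta> j j)"
          unfolding \<eta>_def wedge13_def
          by (intro continuous_intros drc j jX Ck_imp_continuous_on[OF C1])
        show "\<eta> j j x = 0" if "x \<in> cimg X j" "cinv X j x \<notin> C j" for x
          using drz[OF j jX that] by (simp add: \<eta>_def wedge13_def)
      qed
      then have "\<eta> j j integrable_on cimg X j" by (rule set_lebesgue_integral_eq_integral)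
      then show ?thesis
        by (simp add: integral_diff integral_add integrable_diff integrable_add int)
    qed
    also have "integral (cimg X j) ?a = integral (cimg (bdry X) j) (\<lambda>y. ?f (?e 2) (?e 3) (?e 4) (bdry_incl y))"
      using st(2)[of "?e 2" "?e 3" "?e 4" 1] by simp
    also have "\<dots> = integral (cimg (bdry X) j) (\<lambda>y. \<rho> j (cinv (bdry X) j y) *\<^sub>R ?\<beta> j y)"
      by (rule integral_cong) (use cinv_bdry[OF jX] in \<open>simp add: r_def\<close>)
    also have "integral (cimg X j) ?b = 0" using st(2)[of "?e 1" "?e 3" "?e 4" 2] by simp
    also have "integral (cimg X j) ?c = 0" using st(2)[of "?e 1" "?e 2" "?e 4" 3] by simp
    also have "integral (cimg X j) ?g = 0" using st(2)[of "?e 1" "?e 2" "?e 3" 4] by simp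
    finally show ?thesis by simp
  qed
  have "mfd_integral X (ext_deriv3 X \<omega>) = (\<Sum>j\<in>J. integral (cimg X j) (\<lambda>x. r j j x *\<^sub>R ext_deriv3 X \<omega> j x))"
    unfolding Jint pou_integral_def r_def ..
  also have "\<dots> = (\<Sum>j\<in>J. integral (cimg (bdry X) j) (\<lambda>y. \<rho> j (cinv (bdry X) j y) *\<^sub>R ?\<beta> j y))
      - (\<Sum>j\<in>J. integral (cimg X j) (\<eta> j j))"
    unfolding sum_subtractf[symmetric] by (rule sum.cong[OF refl chart])
  also have "\<dots> = B.pou_integral J \<rho> ?\<beta>" unfolding eta_int B.pou_integral_def by simp
  \<comment> \<open>\<open>SOME\<close> may pick another partition on the boundary; independence of
    the choice bridges the two.\<close>
  also have "\<dots> = mfd_integral (bdry X) ?\<beta>"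
    by (rule B.mfd_integral_eq[OF pou_bdry[OF \<rho>] bdry_density[OF \<omega>], symmetric])
  finally show ?thesis .
qed

end

section \<open>Traces of wedge products\<close>

lemma bounded_bilinear_matrix_mult:
  "bounded_bilinear ((**) :: 'n::finite cmat \<Rightarrow> 'n cmat \<Rightarrow> 'n cmat)"
  unfolding bilinear_conv_bounded_bilinear[symmetric] bilinear_def
  by (intro conjI allI linearI)
     (simp_all add: vec_eq_iff matrix_matrix_mult_def algebra_simps sum.distrib scaleR_sum_right)

lemma bounded_linear_trace: "bounded_linear (trace :: 'n::finite cmat \<Rightarrow> complex)"
  by (rule linear_conv_bounded_linear[THEN iffD1], rule linearI)
     (simp_all add: trace_def sum.distrib scaleR_sum_right)

definition tr3 :: "'n::finite cmat \<Rightarrow> 'n cmat \<Rightarrow> 'n cmat \<Rightarrow> complex" where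
  "tr3 x y z = trace ((x ** y) ** z)"

definition tr4 :: "'n::finite cmat \<Rightarrow> 'n cmat \<Rightarrow> 'n cmat \<Rightarrow> 'n cmat \<Rightarrow> complex" where
  "tr4 x y z w = trace ((x ** y) ** (z ** w))"

lemma tr3_cyc: "tr3 z x y = tr3 x y z"
  unfolding tr3_def by (metis trace_mul_sym matrix_mul_assoc)

lemma tr4_cyc: "tr4 w x y z = tr4 x y z w"
  unfolding tr4_def by (metis trace_mul_sym matrix_mul_assoc)

lemmas mat_lin =
  bounded_bilinear.add_left[OF bounded_bilinear_matrix_mult]
  bounded_bilinear.add_right[OF bounded_bilinear_matrix_mult]
  bounded_bilinear.diff_left[OF bounded_bilinear_matrix_mult]
  bounded_bilinear.diff_right[OF bounded_bilinear_matrix_mult]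
  bounded_bilinear.minus_left[OF bounded_bilinear_matrix_mult]
  bounded_bilinear.minus_right[OF bounded_bilinear_matrix_mult]
  bounded_bilinear.scaleR_left[OF bounded_bilinear_matrix_mult]
  bounded_bilinear.scaleR_right[OF bounded_bilinear_matrix_mult]

lemmas trace_lin =
  linear_add[OF bounded_linear.linear[OF bounded_linear_trace]]
  linear_diff[OF bounded_linear.linear[OF bounded_linear_trace]]
  linear_neg[OF bounded_linear.linear[OF bounded_linear_trace]]
  linear_cmul[OF bounded_linear.linear[OF bounded_linear_trace]]

lemma tr3_lin:
  "tr3 (r *\<^sub>R x + x') y z = r *\<^sub>R tr3 x y z + tr3 x' y z"
  "tr3 y (r *\<^sub>R x + x') z = r *\<^sub>R tr3 y x z + tr3 y x' z"
  "tr3 y z (r *\<^sub>R x + x') = r *\<^sub>R tr3 y z x + tr3 y z x'"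
  by (simp_all add: tr3_def mat_lin trace_lin)

lemma tr4_lin:
  "tr4 (r *\<^sub>R x + x') y z w = r *\<^sub>R tr4 x y z w + tr4 x' y z w"
  "tr4 y (r *\<^sub>R x + x') z w = r *\<^sub>R tr4 y x z w + tr4 y x' z w"
  "tr4 y z (r *\<^sub>R x + x') w = r *\<^sub>R tr4 y z x w + tr4 y z x' w"
  "tr4 y z w (r *\<^sub>R x + x') = r *\<^sub>R tr4 y z w x + tr4 y z w x'"
  by (simp_all add: tr4_def mat_lin trace_lin)

lemma continuous_on_tr3:
  "continuous_on S f \<Longrightarrow> continuous_on S g \<Longrightarrow> continuous_on S h \<Longrightarrow> continuous_on S (\<lambda>x. tr3 (f x) (g x) (h x))"
  unfolding tr3_def
  by (intro bounded_linear.continuous_on[OF bounded_linear_trace]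
      bounded_bilinear.continuous_on[OF bounded_bilinear_matrix_mult])

lemma continuous_on_tr4:
  "continuous_on S f \<Longrightarrow> continuous_on S g \<Longrightarrow> continuous_on S h \<Longrightarrow> continuous_on S k \<Longrightarrow>
   continuous_on S (\<lambda>x. tr4 (f x) (g x) (h x) (k x))"
  unfolding tr4_def
  by (intro bounded_linear.continuous_on[OF bounded_linear_trace]
      bounded_bilinear.continuous_on[OF bounded_bilinear_matrix_mult])

lemma Ck_tr3: "Ck k V f \<Longrightarrow> Ck k V g \<Longrightarrow> Ck k V h \<Longrightarrow> Ck k V (\<lambda>x. tr3 (f x) (g x) (h x))"
  unfolding tr3_def
  by (rule Ck_compose[OF Ck_linear[OF bounded_linear_trace, of k UNIV]])
     (auto intro: Ck_bilinear[OF bounded_bilinear_matrix_mult] simp del: Ck.simps)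

lemma has_derivative_tr3:
  assumes "(f has_derivative f') (at x within V)" "(g has_derivative g') (at x within V)"
    "(h has_derivative h') (at x within V)"
  shows "((\<lambda>x. tr3 (f x) (g x) (h x)) has_derivative
    (\<lambda>v. tr3 (f' v) (g x) (h x) + tr3 (f x) (g' v) (h x) + tr3 (f x) (g x) (h' v))) (at x within V)"
proof -
  have "((\<lambda>x. (f x ** g x) ** h x) has_derivative
      (\<lambda>v. (f x ** g x) ** h' v + (f x ** g' v + f' v ** g x) ** h x)) (at x within V)"
    by (intro bounded_bilinear.FDERIV[OF bounded_bilinear_matrix_mult] assms)
  from bounded_linear.has_derivative[OF bounded_linear_trace this] show ?thesis
    unfolding tr3_def by (simp add: mat_lin trace_lin algebra_simps)
qed

definition alt_sum4 :: "('v \<Rightarrow> 'v \<Rightarrow> 'v \<Rightarrow> 'v \<Rightarrow> 'b::real_vector) \<Rightarrow> 'v \<Rightarrow> 'v \<Rightarrow> 'v \<Rightarrow> 'v \<Rightarrow> 'b" where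
  "alt_sum4 F a b c d =
     (F a b c d - F a b d c - F a c b d + F a c d b + F a d b c - F a d c b) -
     (F b a c d - F b a d c - F b c a d + F b c d a + F b d a c - F b d c a) +
     (F c a b d - F c a d b - F c b a d + F c b d a + F c d a b - F c d b a) -
     (F d a b c - F d a c b - F d b a c + F d b c a + F d c a b - F d c b a)"

definition alt_sum3 :: "('v \<Rightarrow> 'v \<Rightarrow> 'v \<Rightarrow> 'b::real_vector) \<Rightarrow> 'v \<Rightarrow> 'v \<Rightarrow> 'v \<Rightarrow> 'b" where
  "alt_sum3 F a b c = F a b c - F a c b - F b a c + F b c a + F c a b - F c b a"

text \<open>\<open>sum_over_permutations_insert\<close> peels off one element at a time until a
  singleton with its identity is left. In this way the permutation sums of \<open>wedge\<close>
  become explicit, and identities between them reduce to matching terms.\<close>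

lemma sum_permutes2:
  "(\<Sum>\<sigma> | \<sigma> permutes {..<2::nat}. of_int (sign \<sigma>) *\<^sub>R F (\<sigma> 0) (\<sigma> 1)) = F 0 1 - (F 1 0 :: 'b::real_vector)"
proof -
  have S: "{..<2::nat} = insert 0 {1}" by auto
  have f: "finite {1::nat}" "0 \<notin> {1::nat}" by auto
  show ?thesis unfolding S sum_over_permutations_insert[OF f] permutes_sing
    by (simp add: sign_swap_id permutation_swap_id sign_compose sign_id transpose_def)
qed

lemma sum_permutes3:
  "(\<Sum>\<sigma> | \<sigma> permutes {..<3::nat}. of_int (sign \<sigma>) *\<^sub>R F (\<sigma> 0) (\<sigma> 1) (\<sigma> 2)) =
   (alt_sum3 F 0 1 2 :: 'b::real_vector)"
proof -
  have S: "{..<3::nat} = insert 0 (insert 1 {2})" by auto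
  have f: "finite {1,2::nat}" "0 \<notin> {1,2::nat}" "finite {2::nat}" "1 \<notin> {2::nat}" by auto
  show ?thesis unfolding S sum_over_permutations_insert[OF f(1,2)] sum_over_permutations_insert[OF f(3,4)] permutes_sing
    by (simp add: sign_swap_id permutation_swap_id sign_compose sign_id transpose_def alt_sum3_def permutation_compose)
qed

lemma sum_permutes4:
  "(\<Sum>\<sigma> | \<sigma> permutes {..<4::nat}. of_int (sign \<sigma>) *\<^sub>R F (\<sigma> 0) (\<sigma> 1) (\<sigma> 2) (\<sigma> 3)) =
   (alt_sum4 F 0 1 2 3 :: 'b::real_vector)"
proof -
  have S: "{..<4::nat} = insert 0 (insert 1 (insert 2 {3}))" by auto
  have f: "finite {1,2,3::nat}" "0 \<notin> {1,2,3::nat}" "finite {2,3::nat}" "1 \<notin> {2,3::nat}"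
    "finite {3::nat}" "2 \<notin> {3::nat}" by auto
  show ?thesis
    unfolding S sum_over_permutations_insert[OF f(1,2)] sum_over_permutations_insert[OF f(3,4)]
      sum_over_permutations_insert[OF f(5,6)] permutes_sing
    by (simp add: sign_swap_id permutation_swap_id sign_compose sign_id transpose_def alt_sum4_def permutation_compose)
qed

lemma alt_sum3_image: "alt_sum3 (\<lambda>i j k. F (v i) (v j) (v k)) a b c = alt_sum3 F (v a) (v b) (v c)"
  by (simp add: alt_sum3_def)

lemma alt_sum4_image:
  "alt_sum4 (\<lambda>i j k l. F (v i) (v j) (v k) (v l)) a b c d = alt_sum4 F (v a) (v b) (v c) (v d)"
  by (simp add: alt_sum4_def)

lemma trace_alt_sum3:
  fixes F :: "'v \<Rightarrow> 'v \<Rightarrow> 'v \<Rightarrow> 'n::finite cmat"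
  shows "trace (alt_sum3 F a b c) = alt_sum3 (\<lambda>u v w. trace (F u v w)) a b c"
  by (simp add: alt_sum3_def trace_lin)

lemma trace_alt_sum4:
  fixes F :: "'v \<Rightarrow> 'v \<Rightarrow> 'v \<Rightarrow> 'v \<Rightarrow> 'n::finite cmat"
  shows "trace (alt_sum4 F a b c d) = alt_sum4 (\<lambda>u v w z. trace (F u v w z)) a b c d"
  by (simp add: alt_sum4_def trace_lin)

lemma alt_sum3_antisym:
  fixes f :: "'v \<Rightarrow> 'v \<Rightarrow> 'v \<Rightarrow> complex"
  shows "alt_sum3 (\<lambda>u v w. f u v w - f v u w) a b c = 2 * alt_sum3 f a b c"
  by (simp add: alt_sum3_def)

text \<open>Antisymmetrising twice inside a full alternating sum only repeats it; the factor 4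
  cancels the 1/(2! 2!) in the product of two 2-forms.\<close>

lemma alt_sum4_antisym:
  fixes f :: "'v \<Rightarrow> 'v \<Rightarrow> 'v \<Rightarrow> 'v \<Rightarrow> complex"
  shows "alt_sum4 (\<lambda>u v w z. f u v w z - f v u w z - f u v z w + f v u z w) a b c d = 4 * alt_sum4 f a b c d"
  by (simp add: alt_sum4_def)

lemma alt_sum4_lin:
  "alt_sum4 (\<lambda>u v w z. r *\<^sub>R F u v w z + G u v w z) a b c d = r *\<^sub>R alt_sum4 F a b c d + alt_sum4 G a b c d"
  by (simp add: alt_sum4_def algebra_simps)

lemma alt_sum3_lin:
  "alt_sum3 (\<lambda>u v w. r *\<^sub>R F u v w + G u v w) a b c = r *\<^sub>R alt_sum3 F a b c + alt_sum3 G a b c"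
  by (simp add: alt_sum3_def algebra_simps)

text \<open>A 4-cycle is odd, whereas the 3-cycle of \<open>alt_sum3_rotate\<close> is even.
  Together with cyclicity of the trace this yields the sign for four 1-forms and its absence for
  three.\<close>

lemma alt_sum4_rotate: "alt_sum4 (\<lambda>u v w z. F z u v w) a b c d = - alt_sum4 F a b c d"
  by (simp add: alt_sum4_def)

lemma alt_sum3_rotate: "alt_sum3 (\<lambda>u v w. F w u v) a b c = alt_sum3 F a b c"
  by (simp add: alt_sum3_def)

text \<open>Expansion along the third slot, which in \<open>tr_abdc\<close> holds the direction of
  differentiation. Moving that slot to the front passes two arguments and so costs no sign.\<close>

lemma alt_sum4_expand:
  "alt_sum3 (\<lambda>u v w. F u v a w) b c d - alt_sum3 (\<lambda>u v w. F u v b w) a c d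
    + alt_sum3 (\<lambda>u v w. F u v c w) a b d - alt_sum3 (\<lambda>u v w. F u v d w) a b c = alt_sum4 F a b c d"
  by (simp add: alt_sum4_def alt_sum3_def)

lemma continuous_on_alt_sum4:
  fixes F :: "'a::topological_space \<Rightarrow> 'v \<Rightarrow> 'v \<Rightarrow> 'v \<Rightarrow> 'v \<Rightarrow> complex"
  shows "(\<And>u v w z. continuous_on S (\<lambda>x. F x u v w z)) \<Longrightarrow> continuous_on S (\<lambda>x. alt_sum4 (F x) a b c d)"
  unfolding alt_sum4_def by (intro continuous_intros)

lemma Ck_alt_sum3:
  fixes F :: "_ \<Rightarrow> _ \<Rightarrow> _ \<Rightarrow> _ \<Rightarrow> complex"
  assumes "\<And>u v w. Ck k V (\<lambda>x. F x u v w)"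
  shows "Ck k V (\<lambda>x. alt_sum3 (F x) a b c)"
proof -
  have "Ck k V (\<lambda>x. F x a b c + (- 1) * F x a c b + (- 1) * F x b a c + F x b c a + F x c a b + (- 1) * F x c b a)"
    by (intro Ck_add Ck_mult Ck_const assms)
  then show ?thesis by (simp add: alt_sum3_def)
qed

lemma has_derivative_alt_sum3:
  "(\<And>u v w. ((\<lambda>x. F x u v w) has_derivative (\<lambda>h. F' h u v w)) net) \<Longrightarrow>
   ((\<lambda>x. alt_sum3 (F x) a b c) has_derivative (\<lambda>h. alt_sum3 (F' h) a b c)) net"
  unfolding alt_sum3_def by (intro has_derivative_add has_derivative_diff)

lemma alternating3_alt_sum3:
  assumes "\<And>u v. linear (\<lambda>x. F x u v)" "\<And>u v. linear (\<lambda>x. F u x v)" "\<And>u v. linear (\<lambda>x. F u v x)"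
  shows "alternating3 (alt_sum3 F)"
  unfolding alternating3_def alt_sum3_def
  by (intro conjI allI linear_compose_add linear_compose_sub assms) simp_all

lemma frechet_derivative_cong:
  assumes "x \<in> V" "\<And>y. y \<in> V \<Longrightarrow> f y = g y"
  shows "frechet_derivative f (at x within V) = frechet_derivative g (at x within V)"
proof -
  have "(f has_derivative D) (at x within V) \<longleftrightarrow> (g has_derivative D) (at x within V)" for D
    using assms by (metis has_derivative_transform)
  then show ?thesis by (simp add: frechet_derivative_def)
qed

lemma wedge_1_1:
  assumes "\<And>v. a i x v = a' (v 0)" "\<And>v. b i x v = b' (v 0)"
  shows "wedge 1 1 a b i x v = a' (v 0) ** b' (v 1) - a' (v 1) ** b' (v 0)"
  using sum_permutes2[of "\<lambda>k l. a' (v k) ** b' (v l)"]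
  by (simp add: wedge_def assms numeral_2_eq_2)

text \<open>A 2-form written as \<alpha>(u,v) - \<alpha>(v,u) may be replaced by \<alpha> itself:
  the outer alternating sum antisymmetrises anyway, and the resulting factor 2 cancels the 1/(2! 1!)
  of the wedge product.\<close>

lemma trace_wedge_2_1:
  assumes "\<And>v. P i x v = \<alpha> (v 0) (v 1) - \<alpha> (v 1) (v 0)" "\<And>v. c i x v = c' (v 0)"
  shows "trace (wedge 2 1 P c i x v) = alt_sum3 (\<lambda>u v w. trace (\<alpha> u v ** c' w)) (v 0) (v 1) (v 2)"
proof -
  let ?f = "\<lambda>u v w. trace (\<alpha> u v ** c' w)"
  have "wedge 2 1 P c i x v = (1 / 2) *\<^sub>R alt_sum3 (\<lambda>j k l. (\<alpha> (v j) (v k) - \<alpha> (v k) (v j)) ** c' (v l)) 0 1 2"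
    unfolding wedge_def assms sum_permutes3[symmetric] by simp
  then have "trace (wedge 2 1 P c i x v) =
      (1 / 2) *\<^sub>R alt_sum3 (\<lambda>u v w. ?f u v w - ?f v u w) (v 0) (v 1) (v 2)"
    by (simp add: trace_lin trace_alt_sum3 mat_lin
        alt_sum3_image[of "\<lambda>u v w. ?f u v w - ?f v u w" v])
  then show ?thesis by (simp add: alt_sum3_antisym scaleR_conv_of_real)
qed

lemma trace_wedge_2_2:
  assumes "\<And>v. P i x v = \<alpha> (v 0) (v 1) - \<alpha> (v 1) (v 0)" "\<And>v. W i x v = \<beta> (v 0) (v 1) - \<beta> (v 1) (v 0)"
  shows "trace (wedge 2 2 P W i x v) =
    alt_sum4 (\<lambda>u v w z. trace (\<alpha> u v ** \<beta> w z)) (v 0) (v 1) (v 2) (v 3)"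
proof -
  let ?f = "\<lambda>u v w z. trace (\<alpha> u v ** \<beta> w z)"
  have "wedge 2 2 P W i x v = (1 / 4) *\<^sub>R alt_sum4 (\<lambda>j k l m.
      (\<alpha> (v j) (v k) - \<alpha> (v k) (v j)) ** (\<beta> (v l) (v m) - \<beta> (v m) (v l))) 0 1 2 3"
    unfolding wedge_def assms sum_permutes4[symmetric] by simp
  then have "trace (wedge 2 2 P W i x v) = (1 / 4) *\<^sub>R alt_sum4 (\<lambda>j k l m. ?f (v j) (v k) (v l) (v m)
      - ?f (v k) (v j) (v l) (v m) - ?f (v j) (v k) (v m) (v l) + ?f (v k) (v j) (v m) (v l)) 0 1 2 3"
    by (simp add: trace_lin trace_alt_sum4 mat_lin algebra_simps)
  also have "\<dots> = (1 / 4) *\<^sub>R alt_sum4 (\<lambda>u v w z. ?f u v w z - ?f v u w z - ?f u v z w + ?f v u z w)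
      (v 0) (v 1) (v 2) (v 3)"
    using alt_sum4_image[of "\<lambda>u v w z. ?f u v w z - ?f v u w z - ?f u v z w + ?f v u z w" v 0 1 2 3] by simp
  finally show ?thesis by (simp add: alt_sum4_antisym scaleR_conv_of_real)
qed

section \<open>One-forms of class C^1 and the coefficients of their trace forms\<close>

definition C1_one_form :: "('x, 'i, 4) mfd \<Rightarrow> ('i, 4, 'n::finite) form \<Rightarrow> bool" where
  "C1_one_form X a \<longleftrightarrow> (\<forall>i\<in>idx X.
     (\<forall>x\<in>cimg X i. \<forall>v. a i x v = a i x (\<lambda>_. v 0)) \<and> (\<forall>v. Ck 1 (cimg X i) (\<lambda>x. a i x v)))"

definition form_lin :: "real \<Rightarrow> ('i, 4, 'n::finite) form \<Rightarrow> ('i, 4, 'n) form \<Rightarrow> ('i, 4, 'n) form" where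
  "form_lin r a b = form_add (form_scale r a) b"

text \<open>The derivative of a(v) in direction u. The exterior derivative da is its
  antisymmetrisation, which the surrounding alternating sums perform.\<close>

definition dform :: "('x, 'i, 4) mfd \<Rightarrow> ('i, 4, 'n::finite) form \<Rightarrow> 'i \<Rightarrow> real^4 \<Rightarrow> real^4 \<Rightarrow> real^4 \<Rightarrow> 'n cmat" where
  "dform X a i x u v = frechet_derivative (\<lambda>y. a i y (\<lambda>_. v)) (at x within cimg X i) u"

text \<open>The coefficient of the four-form tr(a \<and> b \<and> c \<and> d) in the coordinates of
  chart i.\<close>

definition tr_abcd :: "('i, 4, 'n::finite) form \<Rightarrow> ('i, 4, 'n) form \<Rightarrow> ('i, 4, 'n) form \<Rightarrow> ('i, 4, 'n) form \<Rightarrow>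
    'i \<Rightarrow> real^4 \<Rightarrow> complex" where
  "tr_abcd a b c d i x = alt_sum4 (\<lambda>u v w z. tr4 (a i x (\<lambda>_. u)) (b i x (\<lambda>_. v)) (c i x (\<lambda>_. w)) (d i x (\<lambda>_. z)))
     (axis 1 1) (axis 2 1) (axis 3 1) (axis 4 1)"

text \<open>The coefficient of tr(a \<and> b \<and> dc). No factor 1/2 appears, because
  \<open>dform\<close> is not yet antisymmetrised.\<close>

definition tr_abdc :: "('x, 'i, 4) mfd \<Rightarrow> ('i, 4, 'n::finite) form \<Rightarrow> ('i, 4, 'n) form \<Rightarrow> ('i, 4, 'n) form \<Rightarrow>
    'i \<Rightarrow> real^4 \<Rightarrow> complex" where
  "tr_abdc X a b c i x = alt_sum4 (\<lambda>u v w z. tr3 (a i x (\<lambda>_. u)) (b i x (\<lambda>_. v)) (dform X c i x w z))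
     (axis 1 1) (axis 2 1) (axis 3 1) (axis 4 1)"

definition tr_abc :: "('i, 4, 'n::finite) form \<Rightarrow> ('i, 4, 'n) form \<Rightarrow> ('i, 4, 'n) form \<Rightarrow>
    'i \<Rightarrow> real^4 \<Rightarrow> real^4 \<Rightarrow> real^4 \<Rightarrow> real^4 \<Rightarrow> complex" where
  "tr_abc a b c i x = alt_sum3 (\<lambda>u v w. tr3 (a i x (\<lambda>_. u)) (b i x (\<lambda>_. v)) (c i x (\<lambda>_. w)))"

definition tr_bdry :: "('i, 4, 'n::finite) form \<Rightarrow> ('i, 4, 'n) form \<Rightarrow> ('i, 4, 'n) form \<Rightarrow> 'i \<Rightarrow> real^3 \<Rightarrow> complex" where
  "tr_bdry a b c i y = tr_abc a b c i (bdry_incl y) (axis 2 1) (axis 3 1) (axis 4 1)"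

lemma alternating_1:
  assumes "alternating 1 \<eta>"
  shows "\<eta> v = \<eta> (\<lambda>_. v 0)" and "linear (\<lambda>u. \<eta> (\<lambda>_. u))"
proof -
  have dep: "\<eta> v = \<eta> w" if "v 0 = w 0" for v w
    using assms that unfolding alternating_def by (metis less_one)
  show "\<eta> v = \<eta> (\<lambda>_. v 0)" by (rule dep) simp
  have "linear (\<lambda>u. \<eta> ((\<lambda>_. 0)(0 := u)))" using assms unfolding alternating_def by blast
  moreover have "\<eta> ((\<lambda>_. 0)(0 := u)) = \<eta> (\<lambda>_. u)" for u by (rule dep) simp
  ultimately show "linear (\<lambda>u. \<eta> (\<lambda>_. u))" by simp
qed

lemma one_forms_C1:
  assumes "a \<in> one_forms X s" shows "C1_one_form X a" and "diff_form X 1 a"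
proof -
  show d: "diff_form X 1 a" using assms unfolding one_forms_def by blast
  show "C1_one_form X a"
    unfolding C1_one_form_def
  proof (intro ballI conjI allI)
    fix i v assume i: "i \<in> idx X"
    show "a i x v = a i x (\<lambda>_. v 0)" if "x \<in> cimg X i" for x
      by (rule alternating_1(1)) (use d i that in \<open>unfold diff_form_def, blast\<close>)
    show "Ck 1 (cimg X i) (\<lambda>x. a i x v)"
      using assms i unfolding one_forms_def sobolev_def by blast
  qed
qed

lemma form_lin_apply: "form_lin r a b i x v = r *\<^sub>R a i x v + b i x v"
  by (simp add: form_lin_def form_add_def form_scale_def)

lemma C1_form_lin:
  assumes "C1_one_form X a" "C1_one_form X b" shows "C1_one_form X (form_lin r a b)"
  unfolding C1_one_form_def form_lin_apply
proof (intro ballI conjI allI)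
  fix i v assume i: "i \<in> idx X"
  show "r *\<^sub>R a i x v + b i x v = r *\<^sub>R a i x (\<lambda>_. v 0) + b i x (\<lambda>_. v 0)" if "x \<in> cimg X i" for x
    using assms i that unfolding C1_one_form_def by metis
  show "Ck 1 (cimg X i) (\<lambda>x. r *\<^sub>R a i x v + b i x v)"
    using assms i unfolding C1_one_form_def by (intro Ck_add Ck_scaleR Ck_const) blast+
qed

lemma tr_abcd_lin:
  "tr_abcd (form_lin r a a') b c d i x = r *\<^sub>R tr_abcd a b c d i x + tr_abcd a' b c d i x"
  "tr_abcd b (form_lin r a a') c d i x = r *\<^sub>R tr_abcd b a c d i x + tr_abcd b a' c d i x"
  "tr_abcd b c (form_lin r a a') d i x = r *\<^sub>R tr_abcd b c a d i x + tr_abcd b c a' d i x"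
  "tr_abcd b c d (form_lin r a a') i x = r *\<^sub>R tr_abcd b c d a i x + tr_abcd b c d a' i x"
  by (simp_all add: tr_abcd_def form_lin_apply tr4_lin alt_sum4_lin)

lemma tr_bdry_lin:
  "tr_bdry (form_lin r a a') b c i x = r *\<^sub>R tr_bdry a b c i x + tr_bdry a' b c i x"
  "tr_bdry b (form_lin r a a') c i x = r *\<^sub>R tr_bdry b a c i x + tr_bdry b a' c i x"
  "tr_bdry b c (form_lin r a a') i x = r *\<^sub>R tr_bdry b c a i x + tr_bdry b c a' i x"
  by (simp_all add: tr_bdry_def tr_abc_def form_lin_apply tr3_lin alt_sum3_lin)

lemma tr_abcd_cyc: "tr_abcd d a b c i x = - tr_abcd a b c d i x"
  unfolding tr_abcd_def
  using alt_sum4_rotate[of "\<lambda>z u v w. tr4 (d i x (\<lambda>_. z)) (a i x (\<lambda>_. u)) (b i x (\<lambda>_. v)) (c i x (\<lambda>_. w))"]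
  by (simp add: tr4_cyc)

lemma tr_bdry_cyc: "tr_bdry c a b i y = tr_bdry a b c i y"
  unfolding tr_bdry_def tr_abc_def
  using alt_sum3_rotate[of "\<lambda>w u v. tr3 (c i (bdry_incl y) (\<lambda>_. w)) (a i (bdry_incl y) (\<lambda>_. u)) (b i (bdry_incl y) (\<lambda>_. v))"]
  by (simp add: tr3_cyc)

text \<open>Along the line \<open>H\<close> is an exact quadratic polynomial, so the difference
  quotient is L + \<epsilon> Q and its limit is immediate.\<close>

lemma diff_quot_tendsto:
  assumes "\<And>\<epsilon>. H (form_add A (form_scale \<epsilon> c)) = H A + \<epsilon> *\<^sub>R L + \<epsilon>\<^sup>2 *\<^sub>R Q"
  shows "(diff_quot c H A \<longlongrightarrow> L) (at 0)"
proof -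
  have "((\<lambda>\<epsilon>. L + \<epsilon> *\<^sub>R Q) \<longlongrightarrow> L + 0 *\<^sub>R Q) (at 0)" by (intro tendsto_intros)
  then have "((\<lambda>\<epsilon>. L + \<epsilon> *\<^sub>R Q) \<longlongrightarrow> L) (at 0)" by simp
  then show ?thesis
  proof (rule Lim_transform_eventually)
    show "\<forall>\<^sub>F \<epsilon> in at 0. L + \<epsilon> *\<^sub>R Q = diff_quot c H A \<epsilon>"
      by (auto simp: eventually_at_filter diff_quot_def assms scaleR_add_right power2_eq_square)
  qed
qed

section \<open>Integrals of trace forms and Stokes' theorem for tr(a \<and> b \<and> c)\<close>

context manifold4
begin

interpretation B: compact_manifold UNIV "bdry X" by (rule compact_manifold_bdry)

lemma C1_one_form_at:
  assumes "C1_one_form X a" "i \<in> idx X"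
  shows "x \<in> cimg X i \<Longrightarrow> a i x v = a i x (\<lambda>_. v 0)"
    and "Ck 1 (cimg X i) (\<lambda>x. a i x v)"
  using assms unfolding C1_one_form_def by blast+

lemma dform_deriv:
  assumes "C1_one_form X a" "i \<in> idx X" "x \<in> cimg X i"
  shows "((\<lambda>y. a i y (\<lambda>_. v)) has_derivative (\<lambda>u. dform X a i x u v)) (at x within cimg X i)"
  unfolding dform_def using Ck1_derivative(1)[OF cimg_accessible C1_one_form_at(2)] assms by blast

lemma dform_continuous:
  assumes "C1_one_form X a" "i \<in> idx X"
  shows "continuous_on (cimg X i) (\<lambda>x. dform X a i x u v)"
  unfolding dform_def by (rule Ck1_derivative(2)[OF cimg_accessible[OF assms(2)] C1_one_form_at(2)[OF assms]])

lemma dform_lin: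
  assumes a: "C1_one_form X a" and b: "C1_one_form X b" and i: "i \<in> idx X" "x \<in> cimg X i"
  shows "dform X (form_lin r a b) i x u v = r *\<^sub>R dform X a i x u v + dform X b i x u v"
proof -
  have "((\<lambda>y. form_lin r a b i y (\<lambda>_. v)) has_derivative (\<lambda>u. r *\<^sub>R dform X a i x u v + dform X b i x u v))
      (at x within cimg X i)"
    unfolding form_lin_apply
    by (intro has_derivative_add has_derivative_scaleR_right dform_deriv a b i)
  from frechet_derivative_eqI[OF cimg_accessible[OF i(1)] i(2) this] show ?thesis
    unfolding dform_def[of X "form_lin r a b"] by simp
qed

lemma tr_abdc_lin:
  assumes "i \<in> idx X" "x \<in> cimg X i" "C1_one_form X a" "C1_one_form X a'"
  shows "tr_abdc X (form_lin r a a') b c i x = r *\<^sub>R tr_abdc X a b c i x + tr_abdc X a' b c i x"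
    and "tr_abdc X b (form_lin r a a') c i x = r *\<^sub>R tr_abdc X b a c i x + tr_abdc X b a' c i x"
    and "tr_abdc X b c (form_lin r a a') i x = r *\<^sub>R tr_abdc X b c a i x + tr_abdc X b c a' i x"
  using assms by (simp_all add: tr_abdc_def form_lin_apply dform_lin tr3_lin alt_sum4_lin)

lemma tr_abcd_continuous:
  assumes "C1_one_form X a" "C1_one_form X b" "C1_one_form X c" "C1_one_form X d"
  shows "chartwise_continuous (tr_abcd a b c d)"
  unfolding chartwise_continuous_def tr_abcd_def
proof
  fix i assume i: "i \<in> idx X"
  note c = assms[THEN C1_one_form_at(2), OF i, THEN Ck_imp_continuous_on]
  show "continuous_on (cimg X i) (\<lambda>x. alt_sum4 (\<lambda>u v w z. tr4 (a i x (\<lambda>_. u)) (b i x (\<lambda>_. v))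
      (c i x (\<lambda>_. w)) (d i x (\<lambda>_. z))) (axis 1 1) (axis 2 1) (axis 3 1) (axis 4 1))"
    by (intro continuous_on_alt_sum4 continuous_on_tr4 c)
qed

lemma tr_abdc_continuous:
  assumes "C1_one_form X a" "C1_one_form X b" "C1_one_form X c"
  shows "chartwise_continuous (tr_abdc X a b c)"
  unfolding chartwise_continuous_def tr_abdc_def
proof
  fix i assume i: "i \<in> idx X"
  note c = assms(1,2)[THEN C1_one_form_at(2), OF i, THEN Ck_imp_continuous_on]
  show "continuous_on (cimg X i) (\<lambda>x. alt_sum4 (\<lambda>u v w z. tr3 (a i x (\<lambda>_. u)) (b i x (\<lambda>_. v))
      (dform X c i x w z)) (axis 1 1) (axis 2 1) (axis 3 1) (axis 4 1))"
    by (intro continuous_on_alt_sum4 continuous_on_tr3 c dform_continuous[OF assms(3) i])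
qed

lemma tr_abc_Ck:
  assumes "C1_one_form X a" "C1_one_form X b" "C1_one_form X c" "i \<in> idx X"
  shows "Ck 1 (cimg X i) (\<lambda>x. tr_abc a b c i x u v w)"
  unfolding tr_abc_def
  by (intro Ck_alt_sum3 Ck_tr3 assms(1-3)[THEN C1_one_form_at(2), OF assms(4)])

lemma tr_bdry_continuous:
  assumes "C1_one_form X a" "C1_one_form X b" "C1_one_form X c"
  shows "B.chartwise_continuous (tr_bdry a b c)"
  unfolding B.chartwise_continuous_def
proof
  fix i assume "i \<in> idx (bdry X)"
  then have i: "i \<in> idx X" by simp
  show "continuous_on (cimg (bdry X) i) (tr_bdry a b c i)"
    unfolding tr_bdry_def
    by (rule continuous_on_compose2[OF Ck_imp_continuous_on[OF tr_abc_Ck[OF assms i]]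
          linear_continuous_on[OF bounded_linear_bdry_incl]])
       (use cimg_bdry[OF i] in auto)
qed

lemma wedge_comm_eval:
  assumes "C1_one_form X a" "C1_one_form X b" "i \<in> idx X" "x \<in> cimg X i"
  defines "\<alpha> \<equiv> \<lambda>u v. a i x (\<lambda>_. u) ** b i x (\<lambda>_. v) - b i x (\<lambda>_. u) ** a i x (\<lambda>_. v)"
  shows "wedge_comm a b i x v = \<alpha> (v 0) (v 1) - \<alpha> (v 1) (v 0)"
proof -
  have e: "\<And>v. a i x v = a i x (\<lambda>_. v 0)" "\<And>v. b i x v = b i x (\<lambda>_. v 0)"
    using C1_one_form_at(1) assms by blast+
  show ?thesis
    unfolding wedge_comm_def form_diff_def wedge_1_1[of a i x "\<lambda>u. a i x (\<lambda>_. u)" b "\<lambda>u. b i x (\<lambda>_. u)", OF e]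
      wedge_1_1[of b i x "\<lambda>u. b i x (\<lambda>_. u)" a "\<lambda>u. a i x (\<lambda>_. u)", OF e(2,1)] \<alpha>_def
    by simp
qed

lemma curvature_eval:
  assumes A: "C1_one_form X A" and i: "i \<in> idx X" and x: "x \<in> cimg X i"
  defines "\<beta> \<equiv> \<lambda>u v. dform X A i x u v + A i x (\<lambda>_. u) ** A i x (\<lambda>_. v)"
  shows "curvature X A i x v = \<beta> (v 0) (v 1) - \<beta> (v 1) (v 0)"
proof -
  have e: "\<And>v. A i x v = A i x (\<lambda>_. v 0)"
    using C1_one_form_at(1) assms by blast
  have d: "frechet_derivative (\<lambda>y. A i y w) (at x within cimg X i) u = dform X A i x u (w 0)" for w u
    unfolding dform_def
    by (subst frechet_derivative_cong[OF x C1_one_form_at(1)[OF A i]]) simp_all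
  have "ext_deriv X 1 A i x v = dform X A i x (v 0) (v 1) - dform X A i x (v 1) (v 0)"
    unfolding ext_deriv_def by (simp add: d)
  then show ?thesis
    unfolding curvature_def form_add_def wedge_1_1[of A i x "\<lambda>u. A i x (\<lambda>_. u)" A "\<lambda>u. A i x (\<lambda>_. u)", OF e e] \<beta>_def
    by simp
qed

lemma frame4_axis: "frame4 0 = axis 1 1" "frame4 1 = axis 2 1" "frame4 2 = axis 3 1" "frame4 3 = axis 4 1"
  by (simp_all add: frame4_def numeral_2_eq_2 numeral_3_eq_3)

lemma int_tr_curvature:
  assumes "C1_one_form X a" "C1_one_form X b" "C1_one_form X A"
  shows "int_tr X (wedge 2 2 (wedge_comm a b) (curvature X A)) =
    mfd_integral X (tr_abdc X a b A) - mfd_integral X (tr_abdc X b a A) +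
    (mfd_integral X (tr_abcd a b A A) - mfd_integral X (tr_abcd b a A A))"
proof -
  \<comment> \<open>The differences are written with a factor \<open>- 1\<close>, matching the form
    in which additivity and scaling of the integral are available.\<close>
  have "trace (wedge 2 2 (wedge_comm a b) (curvature X A) i x frame4) =
      (tr_abdc X a b A i x + (- 1) * tr_abdc X b a A i x) + (tr_abcd a b A A i x + (- 1) * tr_abcd b a A A i x)"
    if "i \<in> idx X" "x \<in> cimg X i" for i x
    unfolding trace_wedge_2_2[where P = "wedge_comm a b" and W = "curvature X A" and i = i and x = x and \<alpha> = "\<lambda>u v. a i x (\<lambda>_. u) ** b i x (\<lambda>_. v) - b i x (\<lambda>_. u) ** a i x (\<lambda>_. v)"
        and \<beta> = "\<lambda>u v. dform X A i x u v + A i x (\<lambda>_. u) ** A i x (\<lambda>_. v)",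
        OF wedge_comm_eval[OF assms(1,2) that] curvature_eval[OF assms(3) that]] frame4_axis
      tr_abdc_def tr_abcd_def tr3_def tr4_def
    by (simp add: mat_lin trace_lin alt_sum4_def algebra_simps)
  then have "int_tr X (wedge 2 2 (wedge_comm a b) (curvature X A)) = mfd_integral X (\<lambda>i x.
      (tr_abdc X a b A i x + (- 1) * tr_abdc X b a A i x) + (tr_abcd a b A A i x + (- 1) * tr_abcd b a A A i x))"
    unfolding int_tr_def by (rule mfd_integral_cong)
  also have "\<dots> = (mfd_integral X (tr_abdc X a b A) + (- 1) * mfd_integral X (tr_abdc X b a A)) +
      (mfd_integral X (tr_abcd a b A A) + (- 1) * mfd_integral X (tr_abcd b a A A))"
  proof -
    have c: "chartwise_continuous (\<lambda>i x. (- 1) * f i x)" if "chartwise_continuous f" for f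
      using that unfolding chartwise_continuous_def by (auto intro!: continuous_intros)
    have s: "chartwise_continuous (\<lambda>i x. f i x + g i x)" if "chartwise_continuous f" "chartwise_continuous g" for f g
      using that unfolding chartwise_continuous_def by (auto intro!: continuous_intros)
    note cont = tr_abdc_continuous[OF assms(1,2,3)] tr_abdc_continuous[OF assms(2,1,3)]
      tr_abcd_continuous[OF assms(1,2,3,3)] tr_abcd_continuous[OF assms(2,1,3,3)]
    show ?thesis
      unfolding mfd_integral_add[OF s[OF cont(1) c[OF cont(2)]] s[OF cont(3) c[OF cont(4)]]]
        mfd_integral_add[OF cont(1) c[OF cont(2)]] mfd_integral_add[OF cont(3) c[OF cont(4)]]
        mfd_integral_scale ..
  qed
  finally show ?thesis by simp
qed

lemma int_tr_wedge_AA: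
  assumes "C1_one_form X a" "C1_one_form X b" "C1_one_form X A"
  shows "int_tr X (wedge 2 2 (wedge_comm a b) (wedge 1 1 A A)) =
    mfd_integral X (tr_abcd a b A A) - mfd_integral X (tr_abcd b a A A)"
proof -
  have "trace (wedge 2 2 (wedge_comm a b) (wedge 1 1 A A) i x frame4) =
      tr_abcd a b A A i x + (- 1) * tr_abcd b a A A i x"
    if "i \<in> idx X" "x \<in> cimg X i" for i x
  proof -
    have e: "\<And>v. A i x v = A i x (\<lambda>_. v 0)"
      using C1_one_form_at(1)[OF assms(3) that] by blast
    show ?thesis
      unfolding trace_wedge_2_2[where P = "wedge_comm a b" and W = "wedge 1 1 A A" and i = i and x = x and \<alpha> = "\<lambda>u v. a i x (\<lambda>_. u) ** b i x (\<lambda>_. v) - b i x (\<lambda>_. u) ** a i x (\<lambda>_. v)"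
          and \<beta> = "\<lambda>u v. A i x (\<lambda>_. u) ** A i x (\<lambda>_. v)", OF wedge_comm_eval[OF assms(1,2) that]
          wedge_1_1[of A i x "\<lambda>u. A i x (\<lambda>_. u)" A "\<lambda>u. A i x (\<lambda>_. u)", OF e e]] frame4_axis tr_abcd_def tr4_def
      by (simp add: mat_lin trace_lin alt_sum4_def algebra_simps)
  qed
  then have "int_tr X (wedge 2 2 (wedge_comm a b) (wedge 1 1 A A)) =
      mfd_integral X (\<lambda>i x. tr_abcd a b A A i x + (- 1) * tr_abcd b a A A i x)"
    unfolding int_tr_def by (rule mfd_integral_cong)
  also have "\<dots> = mfd_integral X (tr_abcd a b A A) + (- 1) * mfd_integral X (tr_abcd b a A A)"
  proof -
    have c: "chartwise_continuous (\<lambda>i x. (- 1) * f i x)" if "chartwise_continuous f" for f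
      using that unfolding chartwise_continuous_def by (auto intro!: continuous_intros)
    show ?thesis
      unfolding mfd_integral_add[OF tr_abcd_continuous[OF assms(1,2,3,3)] c[OF tr_abcd_continuous[OF assms(2,1,3,3)]]]
        mfd_integral_scale ..
  qed
  finally show ?thesis by simp
qed

lemma int_tr_bdry_wedge:
  assumes "C1_one_form X a" "C1_one_form X b" "C1_one_form X A"
  shows "int_tr_bdry X (wedge 2 1 (wedge_comm a b) A) =
    mfd_integral (bdry X) (tr_bdry a b A) - mfd_integral (bdry X) (tr_bdry b a A)"
proof -
  have fr: "bdry_incl (frame3 0) = axis 2 1" "bdry_incl (frame3 1) = axis 3 1" "bdry_incl (frame3 2) = axis 4 1"
    using bdry_incl_axis by (simp_all add: frame3_def numeral_2_eq_2)
  have "trace (wedge 2 1 (wedge_comm a b) A i (bdry_incl y) (\<lambda>k. bdry_incl (frame3 k))) =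
      tr_bdry a b A i y + (- 1) * tr_bdry b a A i y"
    if "i \<in> idx (bdry X)" "y \<in> cimg (bdry X) i" for i y
  proof -
    have i: "i \<in> idx X" and x: "bdry_incl y \<in> cimg X i" using that cimg_bdry by auto
    have e: "\<And>v. A i (bdry_incl y) v = A i (bdry_incl y) (\<lambda>_. v 0)"
      using C1_one_form_at(1)[OF assms(3) i x] by blast
    show ?thesis
      unfolding trace_wedge_2_1[where P = "wedge_comm a b" and c = A and i = i and x = "bdry_incl y" and \<alpha> = "\<lambda>u v. a i (bdry_incl y) (\<lambda>_. u) ** b i (bdry_incl y) (\<lambda>_. v) - b i (bdry_incl y) (\<lambda>_. u) ** a i (bdry_incl y) (\<lambda>_. v)"
          and c' = "\<lambda>u. A i (bdry_incl y) (\<lambda>_. u)", OF wedge_comm_eval[OF assms(1,2) i x] e] fr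
        tr_bdry_def tr_abc_def tr3_def
      by (simp add: mat_lin trace_lin alt_sum3_def algebra_simps)
  qed
  then have "int_tr_bdry X (wedge 2 1 (wedge_comm a b) A) =
      mfd_integral (bdry X) (\<lambda>i y. tr_bdry a b A i y + (- 1) * tr_bdry b a A i y)"
    unfolding int_tr_bdry_def by (rule B.mfd_integral_cong)
  also have "\<dots> = mfd_integral (bdry X) (tr_bdry a b A) + (- 1) * mfd_integral (bdry X) (tr_bdry b a A)"
  proof -
    have c: "B.chartwise_continuous (\<lambda>i x. (- 1) * f i x)" if "B.chartwise_continuous f" for f
      using that unfolding B.chartwise_continuous_def by (auto intro!: continuous_intros)
    show ?thesis
      unfolding B.mfd_integral_add[OF tr_bdry_continuous[OF assms(1,2,3)] c[OF tr_bdry_continuous[OF assms(2,1,3)]]]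
        B.mfd_integral_scale ..
  qed
  finally show ?thesis by simp
qed

lemma one_form_linear:
  assumes a: "diff_form X 1 a" and i: "i \<in> idx X" and x: "x \<in> cimg X i"
  shows "linear (\<lambda>u. a i x (\<lambda>_. u))"
proof -
  have "alternating 1 (a i x)" using a i x unfolding diff_form_def by blast
  then show ?thesis by (rule alternating_1(2))
qed

lemma tr_abc_three_form:
  fixes a b c :: "('i, 4, 'n::finite) form"
  assumes d: "diff_form X 1 a" "diff_form X 1 b" "diff_form X 1 c"
    and C1: "C1_one_form X a" "C1_one_form X b" "C1_one_form X c"
  shows "C1_three_form X (tr_abc a b c)"
  unfolding C1_three_form_def
proof (intro conjI ballI allI)
  show "Ck 1 (cimg X i) (\<lambda>x. tr_abc a b c i x u v z)" if "i \<in> idx X" for i u v z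
    by (rule tr_abc_Ck[OF C1 that])
  show "alternating3 (tr_abc a b c i x)" if "i \<in> idx X" "x \<in> cimg X i" for i x
    unfolding tr_abc_def
  proof (rule alternating3_alt_sum3)
    note l = one_form_linear[OF d(1) that] one_form_linear[OF d(2) that] one_form_linear[OF d(3) that]
    have t: "linear (\<lambda>x. tr3 x y z)" "linear (\<lambda>x. tr3 y x z)" "linear (\<lambda>x. tr3 y z x)" for y z :: "'n cmat"
      by (rule linearI; simp add: tr3_def mat_lin trace_lin)+
    show "linear (\<lambda>u. tr3 (a i x (\<lambda>_. u)) (b i x (\<lambda>_. v)) (c i x (\<lambda>_. w)))"
      "linear (\<lambda>u. tr3 (a i x (\<lambda>_. v)) (b i x (\<lambda>_. u)) (c i x (\<lambda>_. w)))"
      "linear (\<lambda>u. tr3 (a i x (\<lambda>_. v)) (b i x (\<lambda>_. w)) (c i x (\<lambda>_. u)))" for v w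
      using linear_compose[OF l(1) t(1)] linear_compose[OF l(2) t(2)] linear_compose[OF l(3) t(3)]
      by (simp_all add: comp_def)
  qed
  show "tr_abc a b c i x u v z = tr_abc a b c j (transition X i j x)
      (dtransition X i j x u) (dtransition X i j x v) (dtransition X i j x z)"
    if "i \<in> idx X" "j \<in> idx X" "x \<in> overlap X i j" for i j x u v z
  proof -
    have "\<omega> i x (\<lambda>_. u) = \<omega> j (transition X i j x) (\<lambda>_. dtransition X i j x u)"
      if "diff_form X 1 \<omega>" for \<omega> :: "('i, 4, 'n) form" and u
      using that \<open>i \<in> idx X\<close> \<open>j \<in> idx X\<close> \<open>x \<in> overlap X i j\<close> unfolding diff_form_def by blast
    note t = this[OF d(1)] this[OF d(2)] this[OF d(3)]
    show ?thesis unfolding tr_abc_def alt_sum3_def t ..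
  qed
qed

text \<open>The Leibniz rule differentiates one factor at a time, and a cyclic shift under the trace
  brings that factor to the last place. The shifts are 3-cycles of the arguments, hence even, and
  all three terms keep a plus sign.\<close>

lemma ext_deriv3_tr_abc:
  assumes C1: "C1_one_form X a" "C1_one_form X b" "C1_one_form X c" and i: "i \<in> idx X" and x: "x \<in> cimg X i"
  shows "ext_deriv3 X (tr_abc a b c) i x = tr_abdc X a b c i x + tr_abdc X b c a i x + tr_abdc X c a b i x"
proof -
  let ?a = "\<lambda>u. a i x (\<lambda>_. u)" and ?b = "\<lambda>u. b i x (\<lambda>_. u)" and ?c = "\<lambda>u. c i x (\<lambda>_. u)"
  let ?F = "\<lambda>u v z w. tr3 (?a u) (?b v) (dform X c i x z w)"
  let ?G = "\<lambda>u v z w. tr3 (?b u) (?c v) (dform X a i x z w)"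
  let ?H = "\<lambda>u v z w. tr3 (?c u) (?a v) (dform X b i x z w)"
  let ?D = "\<lambda>z u v w. ?F u v z w + ?G v w z u + ?H w u z v"
  have "((\<lambda>y. tr_abc a b c i y u v w) has_derivative (\<lambda>z. alt_sum3 (?D z) u v w)) (at x within cimg X i)" for u v w
    unfolding tr_abc_def
  proof (rule has_derivative_alt_sum3)
    fix u v w
    have "((\<lambda>y. tr3 (a i y (\<lambda>_. u)) (b i y (\<lambda>_. v)) (c i y (\<lambda>_. w))) has_derivative
      (\<lambda>z. tr3 (dform X a i x z u) (?b v) (?c w) + tr3 (?a u) (dform X b i x z v) (?c w) + ?F u v z w))
      (at x within cimg X i)"
      by (rule has_derivative_tr3[OF dform_deriv[OF C1(1) i x] dform_deriv[OF C1(2) i x] dform_deriv[OF C1(3) i x]])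
    moreover have "tr3 (dform X a i x z u) (?b v) (?c w) = ?G v w z u" for z by (rule tr3_cyc)
    moreover have "tr3 (?a u) (dform X b i x z v) (?c w) = ?H w u z v" for z by (rule tr3_cyc[symmetric])
    ultimately show "((\<lambda>y. tr3 (a i y (\<lambda>_. u)) (b i y (\<lambda>_. v)) (c i y (\<lambda>_. w))) has_derivative
      (\<lambda>z. ?D z u v w)) (at x within cimg X i)"
      by (simp add: algebra_simps)
  qed
  from frechet_derivative_eqI[OF cimg_accessible[OF i] x this]
  have fd: "frechet_derivative (\<lambda>y. tr_abc a b c i y u v w) (at x within cimg X i) z = alt_sum3 (?D z) u v w" for u v w z
    by simp
  \<comment> \<open>The arguments of \<open>?G\<close> and \<open>?H\<close> in \<open>?D\<close>
    are cyclically permuted; the alternating sum does not notice even permutations.\<close>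
  have rot: "alt_sum3 (?D z) u v w = alt_sum3 (\<lambda>u v w. ?F u v z w) u v w + alt_sum3 (\<lambda>u v w. ?G u v z w) u v w
      + alt_sum3 (\<lambda>u v w. ?H u v z w) u v w" for z u v w
    unfolding alt_sum3_def by (simp add: algebra_simps)
  have tr: "tr_abdc X a b c i x = alt_sum4 ?F (axis 1 1) (axis 2 1) (axis 3 1) (axis 4 1)"
    "tr_abdc X b c a i x = alt_sum4 ?G (axis 1 1) (axis 2 1) (axis 3 1) (axis 4 1)"
    "tr_abdc X c a b i x = alt_sum4 ?H (axis 1 1) (axis 2 1) (axis 3 1) (axis 4 1)"
    by (simp_all add: tr_abdc_def)
  show ?thesis
    unfolding ext_deriv3_def fd rot tr alt_sum4_expand[symmetric] by (simp add: algebra_simps)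
qed

lemma stokes_tr:
  assumes d: "diff_form X 1 a" "diff_form X 1 b" "diff_form X 1 c"
    and C1: "C1_one_form X a" "C1_one_form X b" "C1_one_form X c"
  shows "mfd_integral X (tr_abdc X a b c) + mfd_integral X (tr_abdc X b c a) + mfd_integral X (tr_abdc X c a b) =
    mfd_integral (bdry X) (tr_bdry a b c)"
proof -
  note cont = tr_abdc_continuous[OF C1] tr_abdc_continuous[OF C1(2,3,1)] tr_abdc_continuous[OF C1(3,1,2)]
  have s: "chartwise_continuous (\<lambda>i x. tr_abdc X a b c i x + tr_abdc X b c a i x)"
    using cont unfolding chartwise_continuous_def by (auto intro!: continuous_intros)
  have "mfd_integral (bdry X) (tr_bdry a b c) = mfd_integral X (ext_deriv3 X (tr_abc a b c))"
    unfolding stokes[OF tr_abc_three_form[OF d C1]] tr_bdry_def by (rule B.mfd_integral_cong) simp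
  also have "\<dots> = mfd_integral X (\<lambda>i x. tr_abdc X a b c i x + tr_abdc X b c a i x + tr_abdc X c a b i x)"
    by (rule mfd_integral_cong) (rule ext_deriv3_tr_abc[OF C1])
  also have "\<dots> = mfd_integral X (tr_abdc X a b c) + mfd_integral X (tr_abdc X b c a) + mfd_integral X (tr_abdc X c a b)"
    unfolding mfd_integral_add[OF s cont(3)] mfd_integral_add[OF cont(1,2)] ..
  finally show ?thesis by simp
qed

section \<open>Multilinear functionals, the directional derivative of \<Omega>^t and
  closedness\<close>

abbreviation "I4 a b c d \<equiv> mfd_integral X (tr_abcd a b c d)"
abbreviation "I3 a b c \<equiv> mfd_integral X (tr_abdc X a b c)"
abbreviation "IB a b c \<equiv> mfd_integral (bdry X) (tr_bdry a b c)"

lemma I4_lin: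
  assumes "C1_one_form X a" "C1_one_form X a'" "C1_one_form X b" "C1_one_form X c" "C1_one_form X d"
  shows "I4 (form_lin r a a') b c d = r *\<^sub>R I4 a b c d + I4 a' b c d"
    and "I4 b (form_lin r a a') c d = r *\<^sub>R I4 b a c d + I4 b a' c d"
    and "I4 b c (form_lin r a a') d = r *\<^sub>R I4 b c a d + I4 b c a' d"
    and "I4 b c d (form_lin r a a') = r *\<^sub>R I4 b c d a + I4 b c d a'"
  by (rule mfd_integral_lin[OF tr_abcd_lin(1)] mfd_integral_lin[OF tr_abcd_lin(2)]
      mfd_integral_lin[OF tr_abcd_lin(3)] mfd_integral_lin[OF tr_abcd_lin(4)]; intro tr_abcd_continuous assms)+

lemma I3_lin:
  assumes "C1_one_form X a" "C1_one_form X a'" "C1_one_form X b" "C1_one_form X c"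
  shows "I3 (form_lin r a a') b c = r *\<^sub>R I3 a b c + I3 a' b c"
    and "I3 b (form_lin r a a') c = r *\<^sub>R I3 b a c + I3 b a' c"
    and "I3 b c (form_lin r a a') = r *\<^sub>R I3 b c a + I3 b c a'"
proof -
  note c = tr_abdc_continuous
  show "I3 (form_lin r a a') b c = r *\<^sub>R I3 a b c + I3 a' b c"
    by (rule mfd_integral_lin[OF tr_abdc_lin(1)[OF _ _ assms(1,2)] c[OF assms(1,3,4)] c[OF assms(2,3,4)]])
  show "I3 b (form_lin r a a') c = r *\<^sub>R I3 b a c + I3 b a' c"
    by (rule mfd_integral_lin[OF tr_abdc_lin(2)[OF _ _ assms(1,2)] c[OF assms(3,1,4)] c[OF assms(3,2,4)]])
  show "I3 b c (form_lin r a a') = r *\<^sub>R I3 b c a + I3 b c a'"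
    by (rule mfd_integral_lin[OF tr_abdc_lin(3)[OF _ _ assms(1,2)] c[OF assms(3,4,1)] c[OF assms(3,4,2)]])
qed

lemma IB_lin:
  assumes "C1_one_form X a" "C1_one_form X a'" "C1_one_form X b" "C1_one_form X c"
  shows "IB (form_lin r a a') b c = r *\<^sub>R IB a b c + IB a' b c"
    and "IB b (form_lin r a a') c = r *\<^sub>R IB b a c + IB b a' c"
    and "IB b c (form_lin r a a') = r *\<^sub>R IB b c a + IB b c a'"
  by (rule B.mfd_integral_lin[OF tr_bdry_lin(1)] B.mfd_integral_lin[OF tr_bdry_lin(2)]
      B.mfd_integral_lin[OF tr_bdry_lin(3)]; intro tr_bdry_continuous assms)+

lemma I4_cyc: "I4 d a b c = - I4 a b c d"
proof -
  have "I4 d a b c = mfd_integral X (\<lambda>i x. (- 1) * tr_abcd a b c d i x)"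
    by (rule mfd_integral_cong) (simp add: tr_abcd_cyc[of d a b c])
  also have "\<dots> = (- 1) * I4 a b c d" by (rule mfd_integral_scale)
  finally show ?thesis by simp
qed

lemma IB_cyc: "IB c a b = IB a b c"
  by (rule B.mfd_integral_cong) (rule tr_bdry_cyc)

text \<open>The directional derivative of \<Omega>^t(a, b) at A along c: each occurrence of A is
  replaced by c in turn. The direction c comes before the two arguments of the form.\<close>

definition Omega_t_lin :: "real \<Rightarrow> ('i, 4, 'n::finite) form \<Rightarrow> ('i, 4, 'n) form \<Rightarrow> ('i, 4, 'n) form \<Rightarrow>
    ('i, 4, 'n) form \<Rightarrow> complex" where
  "Omega_t_lin t A c a b =
     of_real (1 / (8 * pi ^ 3)) * (I3 a b c - I3 b a c + (I4 a b A c + I4 a b c A - I4 b a A c - I4 b a c A))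
   - of_real (1 / (24 * pi ^ 3)) * (IB a b c - IB b a c)
   - of_real (t - 1) * (of_real (1 / (24 * pi ^ 3)) * (I4 a b A c + I4 a b c A - I4 b a A c - I4 b a c A))"

lemma Omega_t_eq:
  assumes "C1_one_form X a" "C1_one_form X b" "C1_one_form X A"
  shows "Omega_t X t A a b =
     of_real (1 / (8 * pi ^ 3)) * (I3 a b A - I3 b a A + (I4 a b A A - I4 b a A A))
   - of_real (1 / (24 * pi ^ 3)) * (IB a b A - IB b a A)
   - of_real (t - 1) * (of_real (1 / (24 * pi ^ 3)) * (I4 a b A A - I4 b a A A))"
  unfolding Omega_t_def Omega_def gamma'_def int_tr_curvature[OF assms] int_tr_wedge_AA[OF assms]
    int_tr_bdry_wedge[OF assms] ..

lemma Omega_t_derivative: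
  assumes "C1_one_form X a" "C1_one_form X b" "C1_one_form X c" "C1_one_form X A"
  shows "(diff_quot c (\<lambda>B. Omega_t X t B a b) A \<longlongrightarrow> Omega_t_lin t A c a b) (at 0)"
proof (rule diff_quot_tendsto)
  fix \<epsilon> :: real
  have eq: "form_add A (form_scale \<epsilon> c) = form_lin \<epsilon> c A"
    by (simp add: form_lin_def form_add_def form_scale_def add.commute)
  note C = C1_form_lin[OF assms(3,4)]
  \<comment> \<open>The constants are made opaque so that simplification treats them as coefficients
    and does not rearrange the fractions in \<pi>.\<close>
  define p q \<tau> :: complex
    where "p = of_real (1 / (8 * pi ^ 3))" and "q = of_real (1 / (24 * pi ^ 3))" and "\<tau> = of_real (t - 1)"
  note pq = this[symmetric]
  \<comment> \<open>Only the terms containing A twice contribute at order \<epsilon>^2; the dA term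
    and the boundary term are linear in A.\<close>
  show "Omega_t X t (form_add A (form_scale \<epsilon> c)) a b = Omega_t X t A a b + \<epsilon> *\<^sub>R Omega_t_lin t A c a b +
    \<epsilon>\<^sup>2 *\<^sub>R (of_real (1 / (8 * pi ^ 3)) * (I4 a b c c - I4 b a c c)
      - of_real (t - 1) * (of_real (1 / (24 * pi ^ 3)) * (I4 a b c c - I4 b a c c)))"
    unfolding eq Omega_t_eq[OF assms(1,2) C] Omega_t_eq[OF assms(1,2,4)] Omega_t_lin_def pq
    by (simp add: I4_lin assms C I3_lin IB_lin scaleR_conv_of_real algebra_simps power2_eq_square)
qed

lemma Omega_t_closed:
  fixes a b c A :: "('i, 4, 'n::finite) form"
  assumes C1: "C1_one_form X a" "C1_one_form X b" "C1_one_form X c" "C1_one_form X A"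
    and d: "diff_form X 1 a" "diff_form X 1 b" "diff_form X 1 c"
  shows "Omega_t_lin t A a b c + Omega_t_lin t A b c a + Omega_t_lin t A c a b = 0"
proof -
  define k \<tau> :: complex where "k = of_real (1 / (24 * pi ^ 3))" and "\<tau> = of_real (t - 1)"
  note k\<tau> = this[symmetric]
  \<comment> \<open>The derivative of tr[(a \<and> b - b \<and> a) \<and> A \<and> A] along c. It
    occurs both in the curvature term and in \<gamma>', so one cancellation settles all values of
    t.\<close>
  define q where "q a b c = I4 a b A c + I4 a b c A - I4 b a A c - I4 b a c A" for a b c :: "('i, 4, 'n) form"
  \<comment> \<open>The two terms that end in c are shifted, with a sign, so that A is last
    everywhere. In the cyclic sum each even arrangement of a, b, c then occurs once with either
    sign, and so does each odd one.\<close>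
  have "q a b c = - I4 c a b A + I4 a b c A + I4 c b a A - I4 b a c A" for a b c
    unfolding q_def using I4_cyc[of c a b A] I4_cyc[of c b a A] by simp
  then have q: "q a b c + q b c a + q c a b = 0" by simp
  have s1: "I3 a b c + I3 b c a + I3 c a b = IB a b c" by (rule stokes_tr[OF d C1(1-3)])
  have s2: "I3 b a c + I3 a c b + I3 c b a = IB b a c"
    by (rule stokes_tr[OF d(2,1,3) C1(2,1,3)])
  have k3: "of_real (1 / (8 * pi ^ 3)) = 3 * k" by (simp add: k\<tau>[symmetric] field_simps)
  \<comment> \<open>Cyclic invariance merges the six boundary integrals into two, each with
    multiplicity three, to match the factor 3 in \<open>k3\<close>.\<close>
  have cyc: "IB b c a = IB a b c" "IB c a b = IB a b c" "IB c b a = IB b a c" "IB a c b = IB b a c"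
    using IB_cyc[of c a b] IB_cyc[of a b c] IB_cyc[of c b a] IB_cyc[of b a c] by simp_all
  have "Omega_t_lin t A a b c + Omega_t_lin t A b c a + Omega_t_lin t A c a b =
      3 * k * ((I3 a b c + I3 b c a + I3 c a b) - (I3 b a c + I3 a c b + I3 c b a) + (q a b c + q b c a + q c a b))
      - k * (3 * IB a b c - 3 * IB b a c) - \<tau> * (k * (q a b c + q b c a + q c a b))"
    unfolding Omega_t_lin_def k3 k\<tau> q_def cyc by (simp add: algebra_simps)
  also have "\<dots> = 0" unfolding q s1 s2 by (simp add: algebra_simps)
  finally show ?thesis .
qed

theorem Omega_t_presymplectic:
  "presymplectic (connections X s :: ('i, 4, 'n::finite) form set) (one_forms X s) (Omega_t X t)"
  unfolding presymplectic_def two_form_def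
proof (intro conjI ballI allI)
  fix A :: "('i, 4, 'n) form" assume "A \<in> connections X s"
  then have A: "C1_one_form X A" using one_forms_C1 unfolding connections_def by blast
  fix a :: "('i, 4, 'n) form" assume "a \<in> one_forms X s"
  then have a: "C1_one_form X a" "diff_form X 1 a" using one_forms_C1 by blast+
  show "Omega_t X t A a a = 0" by (simp add: Omega_t_eq[OF a(1) a(1) A])
  fix b :: "('i, 4, 'n) form" assume "b \<in> one_forms X s"
  then have b: "C1_one_form X b" "diff_form X 1 b" using one_forms_C1 by blast+
  fix c :: "('i, 4, 'n) form" assume "c \<in> one_forms X s"
  then have c: "C1_one_form X c" "diff_form X 1 c" using one_forms_C1 by blast+
  show "\<exists>l. (diff_quot c (\<lambda>B. Omega_t X t B a b) A \<longlongrightarrow> l) (at 0)"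
    using Omega_t_derivative[OF a(1) b(1) c(1) A] by blast
  \<comment> \<open>Stated for arbitrary forms since the exterior derivative uses it for all three
    cyclic placements of a, b, c.\<close>
  have dd: "dir_deriv c (\<lambda>B. Omega_t X t B a b) A = Omega_t_lin t A c a b"
    if "C1_one_form X a" "C1_one_form X b" "C1_one_form X c" for a b c :: "('i, 4, 'n) form"
    unfolding dir_deriv_def by (rule tendsto_Lim[OF _ Omega_t_derivative[OF that A]]) simp
  show "ext_deriv2 (Omega_t X t) A a b c = 0"
    unfolding ext_deriv2_def dd[OF b(1) c(1) a(1)] dd[OF c(1) a(1) b(1)] dd[OF a(1) b(1) c(1)]
    by (rule Omega_t_closed[OF a(1) b(1) c(1) A a(2) b(2) c(2)])
  fix r
  note ab = C1_form_lin[OF a(1) b(1), of r]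
  define p q \<tau> :: complex
    where "p = of_real (1 / (8 * pi ^ 3))" and "q = of_real (1 / (24 * pi ^ 3))" and "\<tau> = of_real (t - 1)"
  note pq = this[symmetric]
  show "Omega_t X t A (form_add (form_scale r a) b) c = r *\<^sub>R Omega_t X t A a c + Omega_t X t A b c"
    "Omega_t X t A c (form_add (form_scale r a) b) = r *\<^sub>R Omega_t X t A c a + Omega_t X t A c b"
    unfolding form_lin_def[symmetric] Omega_t_eq[OF ab c(1) A] Omega_t_eq[OF a(1) c(1) A] Omega_t_eq[OF b(1) c(1) A]
      Omega_t_eq[OF c(1) ab A] Omega_t_eq[OF c(1) a(1) A] Omega_t_eq[OF c(1) b(1) A] pq
    by (simp_all add: I4_lin I3_lin IB_lin a b c A scaleR_conv_of_real algebra_simps)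
qed

end

theorem theorem3p1:
  fixes X :: "('x::t2_space, 'i, 4) mfd"
    and g :: "'i \<Rightarrow> real^4 \<Rightarrow> real^4 \<Rightarrow> real^4 \<Rightarrow> real"
    and s :: nat
  assumes "oriented_manifold half_space X"
    and "compact (pts X)"
    and "connected (pts X)"
    and "riemannian_metric X g"
    and "CARD('n::finite) \<ge> 2"
    and "s \<ge> 4"
  shows "\<forall>t::real. presymplectic (connections X s :: ('i, 4, 'n) form set) (one_forms X s) (Omega_t X t)"
proof
  interpret manifold4 X
    by unfold_locales (use assms(1,2) model_space_half_space in auto)
  show "presymplectic (connections X s :: ('i, 4, 'n) form set) (one_forms X s) (Omega_t X t)" for t
    by (rule Omega_t_presymplectic)
qed

end
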